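(* Let $(H,B)$ be a Rota-Baxter Hopf algebra of weight $-1$, let $\widetilde{B}(x)=x_1B(S(x_2))$, and let $H_+=\operatorname{Im}B$ and $H_-=\operatorname{Im}\widetilde{B}$. Define the linear maps $\rhd:H_+\otimes H_-\to H_-$ by $$B(x)\rhd \widetilde{B}(y)=\widetilde{B}\big(B(x_1)\,y\,S(B(x_2))\big),\quad \forall\, x,y\in H,$$ and $\lhd:H_+\otimes H_-\to H_+$ by $$B(x)\lhd \widetilde{B}(y)=S\Big(B\big(S(\widetilde{B}(y_1))\,S_B(x)\,\widetilde{B}(y_2)\big)\Big),\quad \forall\, x,y\in H,$$ where $S_B(x)=S(B(x_1))\,S(x_2)\,B(x_3)$. Then $(H_+,H_-,\rhd,\lhd)$ is a matched pair of Hopf algebras.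
   Context: The base field $\mathbb{K}$ has characteristic $0$. A Hopf algebra is written $(H,\cdot,1,\Delta,\epsilon,S)$, and Sweedler notation $\Delta(x)=x_1\otimes x_2$ (and $x_1\otimes x_2\otimes x_3$, etc., for iterated coproducts) is used. A coalgebra map is a linear map $f$ with $\Delta\circ f=(f\otimes f)\circ\Delta$ and $\epsilon\circ f=\epsilon$. Rota-Baxter Hopf algebra of weight $-1$: a pair $(H,B)$ where $H$ is a cocommutative Hopf algebra and $B:H\to H$ is a coalgebra map with $B(x)B(y)=B\big(B(x_1)\,y\,S(B(x_2))\,x_3\big)$ for all $x,y\in H$. Such a $B$ is called a Rota-Baxter operator of weight $-1$. The operator $\widetilde{B}(x)=x_1B(S(x_2))$ is then also a Rota-Baxter operator of weight $-1$ on $H$, and $\operatorname{Im}B$, $\operatorname{Im}\widetilde{B}$ are Hopf subalgebras of $H$. Matched pair of Hopf algebras: a quadruple $(H,H',\rhd,\lhd)$ of Hopf algebras $H,H'$, a left action $\rhd:H\otimes H'\to H'$ making $H'$ a left $H$-module coalgebra, and a right action $\lhd:H\otimes H'\to H$ making $H$ a right $H'$-module coalgebra, such that for all $x,y\in H$, $a,b\in H'$: $x\rhd 1_{H'}=\epsilon_H(x)1_{H'}$; $1_H\lhd a=\epsilon_{H'}(a)1_H$; $x\rhd(ab)=(x_1\rhd a_1)\big((x_2\lhd a_2)\rhd b\big)$; $(xy)\lhd a=\big(x\lhd(y_1\rhd a_1)\big)(y_2\lhd a_2)$. *)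

theory Defs
  imports Complex_Main "HOL-Library.Function_Algebras"
begin

section \<open>Tensor products of vector spaces\<close>

text \<open>
  Vector spaces are subspaces \<open>C\<close> of an ambient type of class \<open>ab_group_add\<close> with an explicit
  scalar multiplication, in the style of \<^locale>\<open>vector_space\<close>.
\<close>

definition linear_on ::
  "('k::field \<Rightarrow> 'a::ab_group_add \<Rightarrow> 'a) \<Rightarrow> ('k \<Rightarrow> 'b::ab_group_add \<Rightarrow> 'b) \<Rightarrow> 'a set \<Rightarrow> ('a \<Rightarrow> 'b) \<Rightarrow> bool"
  where "linear_on s1 s2 C f \<longleftrightarrow>
    (\<forall>x\<in>C. \<forall>y\<in>C. f (x + y) = f x + f y) \<and> (\<forall>c. \<forall>x\<in>C. f (s1 c x) = s2 c (f x))"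

definition bilinear_on ::
  "('k::field \<Rightarrow> 'a::ab_group_add \<Rightarrow> 'a) \<Rightarrow> ('k \<Rightarrow> 'b::ab_group_add \<Rightarrow> 'b) \<Rightarrow>
   ('k \<Rightarrow> 'c::ab_group_add \<Rightarrow> 'c) \<Rightarrow> 'a set \<Rightarrow> 'b set \<Rightarrow> ('a \<Rightarrow> 'b \<Rightarrow> 'c) \<Rightarrow> bool"
  where "bilinear_on s1 s2 s3 C D f \<longleftrightarrow>
    (\<forall>y\<in>D. linear_on s1 s3 C (\<lambda>x. f x y)) \<and> (\<forall>x\<in>C. linear_on s2 s3 D (f x))"

text \<open>
  Concrete model of the tensor product over a field: \<open>V \<otimes> W\<close> embeds into the dual of the space of
  bilinear forms on \<open>V \<times> W\<close>, the pure tensor \<open>x \<otimes> y\<close> being evaluation at \<open>(x, y)\<close> (extended by 0 to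
  functions that are not bilinear forms). For subspaces \<open>C\<close>, \<open>D\<close> the tensor product \<open>C \<otimes> D\<close> is the
  set of finite sums of pure tensors inside the tensor product of the ambient spaces. The universal
  property is lemma \<open>tensor_lift_tensor_sum\<close> below.
\<close>

type_synonym ('k, 'a, 'b) tensor = "('a \<Rightarrow> 'b \<Rightarrow> 'k) \<Rightarrow> 'k"

definition tens ::
  "('k::field \<Rightarrow> 'a::ab_group_add \<Rightarrow> 'a) \<Rightarrow> ('k \<Rightarrow> 'b::ab_group_add \<Rightarrow> 'b) \<Rightarrow> 'a \<Rightarrow> 'b \<Rightarrow> ('k, 'a, 'b) tensor"
  where "tens s1 s2 x y = (\<lambda>\<beta>. if bilinear_on s1 s2 (*) UNIV UNIV \<beta> then \<beta> x y else 0)"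

definition tscale :: "'k::field \<Rightarrow> ('k, 'a, 'b) tensor \<Rightarrow> ('k, 'a, 'b) tensor"
  where "tscale c t = (\<lambda>\<beta>. c * t \<beta>)"

definition tensor_sum ::
  "('k::field \<Rightarrow> 'a::ab_group_add \<Rightarrow> 'a) \<Rightarrow> ('k \<Rightarrow> 'b::ab_group_add \<Rightarrow> 'b) \<Rightarrow> ('a \<times> 'b) list \<Rightarrow>
   ('k, 'a, 'b) tensor"
  where "tensor_sum s1 s2 ps = (\<Sum>(x, y)\<leftarrow>ps. tens s1 s2 x y)"

definition tensor_space ::
  "('k::field \<Rightarrow> 'a::ab_group_add \<Rightarrow> 'a) \<Rightarrow> ('k \<Rightarrow> 'b::ab_group_add \<Rightarrow> 'b) \<Rightarrow> 'a set \<Rightarrow> 'b set \<Rightarrow>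
   ('k, 'a, 'b) tensor set"
  where "tensor_space s1 s2 C D = {tensor_sum s1 s2 ps | ps. set ps \<subseteq> C \<times> D}"

text \<open>
  The linear map on \<open>C \<otimes> D\<close> induced by a bilinear map \<open>f\<close> on \<open>C \<times> D\<close>. It is meaningful only for
  bilinear \<open>f\<close>, where the value does not depend on the representation of the tensor.
\<close>

definition tensor_lift ::
  "('k::field \<Rightarrow> 'a::ab_group_add \<Rightarrow> 'a) \<Rightarrow> ('k \<Rightarrow> 'b::ab_group_add \<Rightarrow> 'b) \<Rightarrow> 'a set \<Rightarrow> 'b set \<Rightarrow>
   ('a \<Rightarrow> 'b \<Rightarrow> 'c::ab_group_add) \<Rightarrow> ('k, 'a, 'b) tensor \<Rightarrow> 'c"
  where "tensor_lift s1 s2 C D f t =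
    (THE u. \<exists>ps. set ps \<subseteq> C \<times> D \<and> t = tensor_sum s1 s2 ps \<and> u = (\<Sum>(x, y)\<leftarrow>ps. f x y))"

lemma bilinear_tens:
  fixes s1 :: "'k::field \<Rightarrow> 'a::ab_group_add \<Rightarrow> 'a" and s2 :: "'k \<Rightarrow> 'b::ab_group_add \<Rightarrow> 'b"
  shows "bilinear_on s1 s2 tscale UNIV UNIV (tens s1 s2)"
  by (auto simp: bilinear_on_def linear_on_def tens_def tscale_def fun_eq_iff)

lemma vector_space_tscale: "vector_space (tscale :: 'k::field \<Rightarrow> ('k, 'a, 'b) tensor \<Rightarrow> _)"
  by unfold_locales (auto simp: tscale_def fun_eq_iff algebra_simps)

lemma tensor_sum_apply:
  fixes s1 :: "'k::field \<Rightarrow> 'a::ab_group_add \<Rightarrow> 'a" and s2 :: "'k \<Rightarrow> 'b::ab_group_add \<Rightarrow> 'b"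
  assumes "bilinear_on s1 s2 (*) UNIV UNIV \<beta>"
  shows "tensor_sum s1 s2 ps \<beta> = (\<Sum>(x, y)\<leftarrow>ps. \<beta> x y)"
  using assms by (induction ps) (auto simp: tensor_sum_def tens_def)

lemma tensor_sum_eq_imp:
  fixes s1 :: "'k::field \<Rightarrow> 'a::ab_group_add \<Rightarrow> 'a" and s2 :: "'k \<Rightarrow> 'b::ab_group_add \<Rightarrow> 'b"
    and s3 :: "'k \<Rightarrow> 'c::ab_group_add \<Rightarrow> 'c"
  assumes vs: "vector_space s1" "vector_space s2" "vector_space s3"
    and sub: "module.subspace s1 C" "module.subspace s2 D"
    and bil: "bilinear_on s1 s2 s3 C D f"
    and ps: "set ps \<subseteq> C \<times> D" and qs: "set qs \<subseteq> C \<times> D"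
    and eq: "tensor_sum s1 s2 ps = tensor_sum s1 s2 qs"
  shows "(\<Sum>(x, y)\<leftarrow>ps. f x y) = (\<Sum>(x, y)\<leftarrow>qs. f x y)"
proof (rule ccontr)
  assume ne: "\<not> ?thesis"
  interpret v1: vector_space s1 by fact
  interpret v2: vector_space s2 by fact
  interpret v3: vector_space s3 by fact
  interpret k: vector_space "(*) :: 'k \<Rightarrow> 'k \<Rightarrow> 'k"
    by unfold_locales (auto simp: algebra_simps)
  interpret p1: vector_space_pair s1 s1 by unfold_locales
  interpret p2: vector_space_pair s2 s2 by unfold_locales
  interpret p3: vector_space_pair s3 "(*) :: 'k \<Rightarrow> 'k \<Rightarrow> 'k" by unfold_locales
  obtain p where p: "range p \<subseteq> C" "Vector_Spaces.linear s1 s1 p" "\<And>v. v \<in> C \<Longrightarrow> p v = v"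
    using p1.linear_exists_left_inverse_on[of id C] sub(1) v1.linear_id by auto
  obtain q where q: "range q \<subseteq> D" "Vector_Spaces.linear s2 s2 q" "\<And>v. v \<in> D \<Longrightarrow> q v = v"
    using p2.linear_exists_left_inverse_on[of id D] sub(2) v2.linear_id by auto
  define d where "d = (\<Sum>(x, y)\<leftarrow>ps. f x y) - (\<Sum>(x, y)\<leftarrow>qs. f x y)"
  have "d \<noteq> 0" using ne by (simp add: d_def)
  then have "v3.independent {d}" by simp
  then obtain g where g: "Vector_Spaces.linear s3 (*) g" "g d = 1"
    using p3.linear_independent_extend[of "{d}" "\<lambda>_. 1"] by auto
  interpret g: Vector_Spaces.linear s3 "(*)" g by fact
  interpret p: Vector_Spaces.linear s1 s1 p by fact
  interpret q: Vector_Spaces.linear s2 s2 q by fact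
  define \<beta> where "\<beta> = (\<lambda>x y. g (f (p x) (q y)))"
  have pq: "p x \<in> C" "q y \<in> D" for x y using p(1) q(1) by auto
  have b: "bilinear_on s1 s2 (*) UNIV UNIV \<beta>"
    using bil pq unfolding bilinear_on_def linear_on_def \<beta>_def
    by (simp add: p.add q.add p.scale q.scale g.add g.scale)
  have ev: "tensor_sum s1 s2 rs \<beta> = g (\<Sum>(x, y)\<leftarrow>rs. f x y)" if "set rs \<subseteq> C \<times> D" for rs
    unfolding tensor_sum_apply[OF b] using that
    by (induction rs) (auto simp: g.add g.zero \<beta>_def p(3) q(3))
  have "g d = 0"
    unfolding d_def g.diff using ev[OF ps] ev[OF qs] eq by simp
  with g(2) show False by simp
qed

lemma tensor_lift_tensor_sum:
  fixes s1 :: "'k::field \<Rightarrow> 'a::ab_group_add \<Rightarrow> 'a" and s2 :: "'k \<Rightarrow> 'b::ab_group_add \<Rightarrow> 'b"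
    and s3 :: "'k \<Rightarrow> 'c::ab_group_add \<Rightarrow> 'c"
  assumes vs: "vector_space s1" "vector_space s2" "vector_space s3"
    and sub: "module.subspace s1 C" "module.subspace s2 D"
    and bil: "bilinear_on s1 s2 s3 C D f"
    and ps: "set ps \<subseteq> C \<times> D"
  shows "tensor_lift s1 s2 C D f (tensor_sum s1 s2 ps) = (\<Sum>(x, y)\<leftarrow>ps. f x y)"
  unfolding tensor_lift_def
proof (rule the_equality)
  show "\<exists>qs. set qs \<subseteq> C \<times> D \<and> tensor_sum s1 s2 ps = tensor_sum s1 s2 qs \<and>
      (\<Sum>(x, y)\<leftarrow>ps. f x y) = (\<Sum>(x, y)\<leftarrow>qs. f x y)"
    using ps by (intro exI[of _ ps]) simp
next
  fix u
  assume "\<exists>qs. set qs \<subseteq> C \<times> D \<and> tensor_sum s1 s2 ps = tensor_sum s1 s2 qs \<and>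
      u = (\<Sum>(x, y)\<leftarrow>qs. f x y)"
  then obtain qs where qs: "set qs \<subseteq> C \<times> D" "tensor_sum s1 s2 ps = tensor_sum s1 s2 qs"
    and u: "u = (\<Sum>(x, y)\<leftarrow>qs. f x y)"
    by (elim exE conjE)
  show "u = (\<Sum>(x, y)\<leftarrow>ps. f x y)"
    unfolding u by (rule tensor_sum_eq_imp[OF vs sub bil ps qs, symmetric])
qed


section \<open>Hopf algebras and matched pairs\<close>

text \<open>
  The underlying algebra of a Hopf algebra is a unital subalgebra \<^term>\<open>carrier H\<close> of an ambient
  algebra whose addition, multiplication and unit come from the class \<open>ring_1\<close>; thus a Hopf
  subalgebra is obtained by shrinking the carrier. The Hopf algebra is the whole type when the
  carrier is \<^term>\<open>UNIV\<close>.
\<close>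

record ('k, 'a) hopf =
  carrier :: "'a set"
  smul :: "'k \<Rightarrow> 'a \<Rightarrow> 'a"
  comul :: "'a \<Rightarrow> ('k, 'a, 'a) tensor"
  counit :: "'a \<Rightarrow> 'k"
  antipode :: "'a \<Rightarrow> 'a"

abbreviation pure_tensor :: "('k::field, 'a::ring_1) hopf \<Rightarrow> 'a \<Rightarrow> 'a \<Rightarrow> ('k, 'a, 'a) tensor"
  where "pure_tensor H \<equiv> tens (smul H) (smul H)"

text \<open>
  Sweedler notation: \<open>sweedler H x f\<close> is \<open>f(x\<^sub>1, x\<^sub>2)\<close>, the image of \<open>\<Delta>(x)\<close> under the linear map
  induced by the bilinear map \<open>f\<close>; \<open>sweedler3 H x f\<close> is \<open>f(x\<^sub>1, x\<^sub>2, x\<^sub>3)\<close>, where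
  \<open>x\<^sub>1 \<otimes> x\<^sub>2 \<otimes> x\<^sub>3 = (\<Delta> \<otimes> id)(\<Delta>(x))\<close>.
\<close>

definition sweedler ::
  "('k::field, 'a::ring_1) hopf \<Rightarrow> 'a \<Rightarrow> ('a \<Rightarrow> 'a \<Rightarrow> 'c::ab_group_add) \<Rightarrow> 'c"
  where "sweedler H x f =
    tensor_lift (smul H) (smul H) (carrier H) (carrier H) f (comul H x)"

definition sweedler3 ::
  "('k::field, 'a::ring_1) hopf \<Rightarrow> 'a \<Rightarrow> ('a \<Rightarrow> 'a \<Rightarrow> 'a \<Rightarrow> 'c::ab_group_add) \<Rightarrow> 'c"
  where "sweedler3 H x f = sweedler H x (\<lambda>u x3. sweedler H u (\<lambda>x1 x2. f x1 x2 x3))"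

text \<open>
  Coassociativity is stated in \<open>H \<otimes> (H \<otimes> H)\<close>: the left-hand side is \<open>(\<Delta> \<otimes> id)(\<Delta>(x))\<close> followed by
  the associator, the right-hand side is \<open>(id \<otimes> \<Delta>)(\<Delta>(x))\<close>.
\<close>

locale hopf_algebra =
  fixes H :: "('k::field, 'a::ring_1) hopf"
  assumes vector_space_smul: "vector_space (smul H)"
    and smul_mult_left: "smul H c x * y = smul H c (x * y)"
    and smul_mult_right: "x * smul H c y = smul H c (x * y)"
    and subspace_carrier: "module.subspace (smul H) (carrier H)"
    and one_closed: "1 \<in> carrier H"
    and mult_closed: "\<lbrakk>x \<in> carrier H; y \<in> carrier H\<rbrakk> \<Longrightarrow> x * y \<in> carrier H"
    and comul_closed:
      "x \<in> carrier H \<Longrightarrow> comul H x \<in> tensor_space (smul H) (smul H) (carrier H) (carrier H)"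
    and antipode_closed: "x \<in> carrier H \<Longrightarrow> antipode H x \<in> carrier H"
    and comul_linear: "linear_on (smul H) tscale (carrier H) (comul H)"
    and counit_linear: "linear_on (smul H) (*) (carrier H) (counit H)"
    and antipode_linear: "linear_on (smul H) (smul H) (carrier H) (antipode H)"
    and coassoc: "x \<in> carrier H \<Longrightarrow>
      sweedler3 H x (\<lambda>x1 x2 x3. tens (smul H) tscale x1 (pure_tensor H x2 x3)) =
      sweedler H x (\<lambda>x1 v. tens (smul H) tscale x1 (comul H v))"
    and counit_left: "x \<in> carrier H \<Longrightarrow> sweedler H x (\<lambda>x1 x2. smul H (counit H x1) x2) = x"
    and counit_right: "x \<in> carrier H \<Longrightarrow> sweedler H x (\<lambda>x1 x2. smul H (counit H x2) x1) = x"
    and comul_one: "comul H 1 = pure_tensor H 1 1"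
    and comul_mult: "\<lbrakk>x \<in> carrier H; y \<in> carrier H\<rbrakk> \<Longrightarrow>
      comul H (x * y) =
      sweedler H x (\<lambda>x1 x2. sweedler H y (\<lambda>y1 y2. pure_tensor H (x1 * y1) (x2 * y2)))"
    and counit_one: "counit H 1 = 1"
    and counit_mult: "\<lbrakk>x \<in> carrier H; y \<in> carrier H\<rbrakk> \<Longrightarrow>
      counit H (x * y) = counit H x * counit H y"
    and antipode_left: "x \<in> carrier H \<Longrightarrow>
      sweedler H x (\<lambda>x1 x2. antipode H x1 * x2) = smul H (counit H x) 1"
    and antipode_right: "x \<in> carrier H \<Longrightarrow>
      sweedler H x (\<lambda>x1 x2. x1 * antipode H x2) = smul H (counit H x) 1"

definition cocommutative :: "('k::field, 'a::ring_1) hopf \<Rightarrow> bool"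
  where "cocommutative H \<longleftrightarrow>
    (\<forall>x\<in>carrier H. sweedler H x (\<lambda>x1 x2. pure_tensor H x2 x1) = comul H x)"

definition coalgebra_map ::
  "('k::field, 'a::ring_1) hopf \<Rightarrow> ('k, 'b::ring_1) hopf \<Rightarrow> ('a \<Rightarrow> 'b) \<Rightarrow> bool"
  where "coalgebra_map H H' f \<longleftrightarrow>
    f ` carrier H \<subseteq> carrier H' \<and>
    linear_on (smul H) (smul H') (carrier H) f \<and>
    (\<forall>x\<in>carrier H. comul H' (f x) = sweedler H x (\<lambda>x1 x2. pure_tensor H' (f x1) (f x2))) \<and>
    (\<forall>x\<in>carrier H. counit H' (f x) = counit H x)"

text \<open>
  Actions \<open>H \<otimes> M \<rightarrow> M\<close> and \<open>M \<otimes> H \<rightarrow> M\<close> are given as bilinear maps. The last two conditions in the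
  next two definitions say that the action is a coalgebra map for the tensor product coalgebra
  structure on its domain.
\<close>

definition left_module_coalgebra ::
  "('k::field, 'a::ring_1) hopf \<Rightarrow> ('k, 'b::ring_1) hopf \<Rightarrow> ('a \<Rightarrow> 'b \<Rightarrow> 'b) \<Rightarrow> bool"
  where "left_module_coalgebra H M act \<longleftrightarrow>
    (\<forall>x\<in>carrier H. \<forall>a\<in>carrier M. act x a \<in> carrier M) \<and>
    bilinear_on (smul H) (smul M) (smul M) (carrier H) (carrier M) act \<and>
    (\<forall>a\<in>carrier M. act 1 a = a) \<and>
    (\<forall>x\<in>carrier H. \<forall>y\<in>carrier H. \<forall>a\<in>carrier M. act (x * y) a = act x (act y a)) \<and>
    (\<forall>x\<in>carrier H. \<forall>a\<in>carrier M. comul M (act x a) =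
      sweedler H x (\<lambda>x1 x2. sweedler M a (\<lambda>a1 a2. pure_tensor M (act x1 a1) (act x2 a2)))) \<and>
    (\<forall>x\<in>carrier H. \<forall>a\<in>carrier M. counit M (act x a) = counit H x * counit M a)"

definition right_module_coalgebra ::
  "('k::field, 'a::ring_1) hopf \<Rightarrow> ('k, 'b::ring_1) hopf \<Rightarrow> ('b \<Rightarrow> 'a \<Rightarrow> 'b) \<Rightarrow> bool"
  where "right_module_coalgebra H M act \<longleftrightarrow>
    (\<forall>m\<in>carrier M. \<forall>a\<in>carrier H. act m a \<in> carrier M) \<and>
    bilinear_on (smul M) (smul H) (smul M) (carrier M) (carrier H) act \<and>
    (\<forall>m\<in>carrier M. act m 1 = m) \<and>
    (\<forall>m\<in>carrier M. \<forall>a\<in>carrier H. \<forall>b\<in>carrier H. act m (a * b) = act (act m a) b) \<and>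
    (\<forall>m\<in>carrier M. \<forall>a\<in>carrier H. comul M (act m a) =
      sweedler M m (\<lambda>m1 m2. sweedler H a (\<lambda>a1 a2. pure_tensor M (act m1 a1) (act m2 a2)))) \<and>
    (\<forall>m\<in>carrier M. \<forall>a\<in>carrier H. counit M (act m a) = counit M m * counit H a)"

text \<open>Below, \<open>lact x a\<close> is \<open>x \<rhd> a\<close> and \<open>ract x a\<close> is \<open>x \<lhd> a\<close>.\<close>

definition matched_pair ::
  "('k::field, 'a::ring_1) hopf \<Rightarrow> ('k, 'b::ring_1) hopf \<Rightarrow>
   ('a \<Rightarrow> 'b \<Rightarrow> 'b) \<Rightarrow> ('a \<Rightarrow> 'b \<Rightarrow> 'a) \<Rightarrow> bool"
  where "matched_pair H H' lact ract \<longleftrightarrow>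
    hopf_algebra H \<and> hopf_algebra H' \<and>
    left_module_coalgebra H H' lact \<and>
    right_module_coalgebra H' H ract \<and>
    (\<forall>x\<in>carrier H. lact x 1 = smul H' (counit H x) 1) \<and>
    (\<forall>a\<in>carrier H'. ract 1 a = smul H (counit H' a) 1) \<and>
    (\<forall>x\<in>carrier H. \<forall>a\<in>carrier H'. \<forall>b\<in>carrier H'. lact x (a * b) =
      sweedler H x (\<lambda>x1 x2. sweedler H' a (\<lambda>a1 a2. lact x1 a1 * lact (ract x2 a2) b))) \<and>
    (\<forall>x\<in>carrier H. \<forall>y\<in>carrier H. \<forall>a\<in>carrier H'. ract (x * y) a =
      sweedler H y (\<lambda>y1 y2. sweedler H' a (\<lambda>a1 a2. ract x (lact y1 a1) * ract y2 a2)))"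


section \<open>Rota-Baxter Hopf algebras of weight -1\<close>

definition rota_baxter_hopf_algebra :: "('k::field, 'a::ring_1) hopf \<Rightarrow> ('a \<Rightarrow> 'a) \<Rightarrow> bool"
  where "rota_baxter_hopf_algebra H B \<longleftrightarrow>
    hopf_algebra H \<and> cocommutative H \<and> coalgebra_map H H B \<and>
    (\<forall>x\<in>carrier H. \<forall>y\<in>carrier H.
      B x * B y = B (sweedler3 H x (\<lambda>x1 x2 x3. B x1 * y * antipode H (B x2) * x3)))"

definition rb_tilde :: "('k::field, 'a::ring_1) hopf \<Rightarrow> ('a \<Rightarrow> 'a) \<Rightarrow> 'a \<Rightarrow> 'a"
  where "rb_tilde H B x = sweedler H x (\<lambda>x1 x2. x1 * B (antipode H x2))"

definition rb_antipode :: "('k::field, 'a::ring_1) hopf \<Rightarrow> ('a \<Rightarrow> 'a) \<Rightarrow> 'a \<Rightarrow> 'a"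
  where "rb_antipode H B x =
    sweedler3 H x (\<lambda>x1 x2 x3. antipode H (B x1) * antipode H x2 * B x3)"

definition image_hopf :: "('k, 'a) hopf \<Rightarrow> ('a \<Rightarrow> 'a) \<Rightarrow> ('k, 'a) hopf"
  where "image_hopf H f = H\<lparr>carrier := f ` carrier H\<rparr>"

end

theory Submission
  imports Defs
begin

text \<open>
  Coalgebra maps from a cocommutative coalgebra \<open>D\<close> into the cocommutative Hopf algebra \<open>H\<close> form a
  group under convolution, and composition with \<open>B\<close> makes it a Rota-Baxter group. Every identity
  between coalgebra maps \<open>H \<otimes> \<dots> \<otimes> H \<rightarrow> H\<close> is an identity between the projections in such a group, so
  the matched pair axioms reduce to computations in Rota-Baxter groups.

  With \<open>C(x) = S(x\<^sub>1)B(x\<^sub>2)\<close>, both \<open>B\<close> and \<open>C\<close> are homomorphisms from the descendent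
  product \<open>B(x\<^sub>1) y S(B(x\<^sub>2)) x\<^sub>3\<close> to the product of \<open>H\<close>. Writing a product \<open>zx\<close> as a descendent product
  in two ways shows that \<open>ker C\<close> is a right ideal and \<open>ker B\<close> a left ideal of \<open>H\<close>; this is what makes
  \<open>\<rhd>\<close> and \<open>\<lhd>\<close> well defined on the images.
\<close>

section \<open>Rota-Baxter groups of weight -1\<close>

text \<open>An equality \<open>T y = T y'\<close> between elements of \<open>H\<close> is not an
  equality of coalgebra maps, so an implication proved in Rota-Baxter groups would not make the
  actions well defined on the images. The group lemmas \<open>T_lam\<close> and
  \<open>B_rho'\<close> therefore give closed formulas in which \<open>y\<close> occurs only as
  \<open>T y\<close>, respectively \<open>x\<close> only as \<open>B x\<close>. Read in Sweedler
  notation, they hold for all elements of \<open>H\<close> and yield well-definedness directly. The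
  map \<open>C\<close> is the group counterpart of \<open>B - id\<close>, which for a Rota-Baxter
  operator of weight -1 on a Lie algebra is, like \<open>B\<close>, a homomorphism from the
  descendent bracket; \<open>T\<close> is \<open>C\<close> after inversion. Each element of
  \<open>H\<close> is a value of some coalgebra map at an index. Independent arguments are given
  independent factors of a product coalgebra, so a group identity in two or three elements becomes a
  multilinear identity in \<open>H\<close>.\<close>

locale rota_baxter_group =
  fixes G :: "'g set" and mult :: "'g \<Rightarrow> 'g \<Rightarrow> 'g" (infixl "\<odot>" 70)
    and one :: 'g ("\<e>") and inv :: "'g \<Rightarrow> 'g" and B :: "'g \<Rightarrow> 'g"
  assumes mult_closed [simp]: "x \<in> G \<Longrightarrow> y \<in> G \<Longrightarrow> x \<odot> y \<in> G"
    and one_closed [simp]: "\<e> \<in> G"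
    and inv_closed [simp]: "x \<in> G \<Longrightarrow> inv x \<in> G"
    and B_closed [simp]: "x \<in> G \<Longrightarrow> B x \<in> G"
    and assoc: "x \<in> G \<Longrightarrow> y \<in> G \<Longrightarrow> z \<in> G \<Longrightarrow> x \<odot> y \<odot> z = x \<odot> (y \<odot> z)"
    and one_left [simp]: "x \<in> G \<Longrightarrow> \<e> \<odot> x = x"
    and one_right [simp]: "x \<in> G \<Longrightarrow> x \<odot> \<e> = x"
    and inv_left [simp]: "x \<in> G \<Longrightarrow> inv x \<odot> x = \<e>"
    and inv_right [simp]: "x \<in> G \<Longrightarrow> x \<odot> inv x = \<e>"
    and B_mult_B: "x \<in> G \<Longrightarrow> y \<in> G \<Longrightarrow> B x \<odot> B y = B (B x \<odot> y \<odot> inv (B x) \<odot> x)"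
begin

lemma inv_mult_cancel [simp]: "x \<in> G \<Longrightarrow> y \<in> G \<Longrightarrow> inv x \<odot> (x \<odot> y) = y"
  by (simp flip: assoc)

lemma mult_inv_cancel [simp]: "x \<in> G \<Longrightarrow> y \<in> G \<Longrightarrow> x \<odot> (inv x \<odot> y) = y"
  by (simp flip: assoc)

lemma inv_unique: "x \<in> G \<Longrightarrow> y \<in> G \<Longrightarrow> x \<odot> y = \<e> \<Longrightarrow> inv x = y"
  by (metis inv_mult_cancel one_right inv_closed)

lemma inv_inv [simp]: "x \<in> G \<Longrightarrow> inv (inv x) = x"
  by (simp add: inv_unique)

lemma inv_one [simp]: "inv \<e> = \<e>"
  by (simp add: inv_unique)

lemma inv_mult: "x \<in> G \<Longrightarrow> y \<in> G \<Longrightarrow> inv (x \<odot> y) = inv y \<odot> inv x"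
  by (rule inv_unique) (simp_all add: assoc)

lemma left_cancel: "x \<in> G \<Longrightarrow> y \<in> G \<Longrightarrow> z \<in> G \<Longrightarrow> x \<odot> y = x \<odot> z \<longleftrightarrow> y = z"
  by (metis inv_mult_cancel)

text \<open>
  \<open>desc_mult\<close> and \<open>desc_inv\<close> are product and inverse of the descendent group, \<open>tilde_mult\<close> is the
  transport of its product along inversion. In terms of \<open>lam\<close> and \<open>rho\<close> the two actions are
  \<open>B x \<rhd> T y = T (lam x y)\<close> and \<open>B x \<lhd> T y = B (rho x y)\<close>.
\<close>

definition T where "T x = x \<odot> B (inv x)"
definition C where "C x = inv x \<odot> B x"
definition desc_mult where "desc_mult x y = B x \<odot> y \<odot> inv (B x) \<odot> x"
definition desc_inv where "desc_inv x = inv (B x) \<odot> inv x \<odot> B x"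
definition tilde_mult where "tilde_mult x y = inv (desc_mult (inv x) (inv y))"
definition lam where "lam x y = B x \<odot> y \<odot> inv (B x)"
definition rho where "rho x y = desc_inv (inv (T y) \<odot> desc_inv x \<odot> T y)"

lemma closed [simp]:
  "x \<in> G \<Longrightarrow> T x \<in> G" "x \<in> G \<Longrightarrow> C x \<in> G" "x \<in> G \<Longrightarrow> desc_inv x \<in> G"
  "x \<in> G \<Longrightarrow> y \<in> G \<Longrightarrow> desc_mult x y \<in> G" "x \<in> G \<Longrightarrow> y \<in> G \<Longrightarrow> tilde_mult x y \<in> G"
  "x \<in> G \<Longrightarrow> y \<in> G \<Longrightarrow> lam x y \<in> G" "x \<in> G \<Longrightarrow> y \<in> G \<Longrightarrow> rho x y \<in> G"
  by (simp_all add: T_def C_def desc_mult_def desc_inv_def tilde_mult_def lam_def rho_def)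

lemma T_eq_C: "x \<in> G \<Longrightarrow> T x = C (inv x)"
  by (simp add: T_def C_def)

lemma B_desc_mult: "x \<in> G \<Longrightarrow> y \<in> G \<Longrightarrow> B (desc_mult x y) = B x \<odot> B y"
  by (simp add: desc_mult_def B_mult_B)

lemma C_desc_mult: "x \<in> G \<Longrightarrow> y \<in> G \<Longrightarrow> C (desc_mult x y) = C x \<odot> C y"
  by (simp add: C_def B_desc_mult) (simp add: desc_mult_def inv_mult assoc)

lemma B_one [simp]: "B \<e> = \<e>"
proof -
  have "B \<e> \<odot> B \<e> = B \<e> \<odot> \<e>" by (simp add: B_mult_B)
  then show ?thesis by (subst (asm) left_cancel) auto
qed

lemma B_desc_inv: assumes "x \<in> G" shows "B (desc_inv x) = inv (B x)"
proof -
  have "desc_mult x (desc_inv x) = \<e>" using assms by (simp add: desc_mult_def desc_inv_def assoc)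
  then have "B x \<odot> B (desc_inv x) = \<e>" using assms B_desc_mult[of x "desc_inv x"] by simp
  then show ?thesis using assms by (intro inv_unique[symmetric]) auto
qed

lemma desc_inv_desc_inv [simp]: "x \<in> G \<Longrightarrow> desc_inv (desc_inv x) = x"
  by (subst desc_inv_def) (simp add: B_desc_inv, simp add: desc_inv_def inv_mult assoc)

lemma C_desc_inv: assumes "x \<in> G" shows "C (desc_inv x) = inv (C x)"
  using assms by (simp add: C_def B_desc_inv) (simp add: desc_inv_def inv_mult assoc)

lemma T_tilde_mult: "x \<in> G \<Longrightarrow> y \<in> G \<Longrightarrow> T (tilde_mult x y) = T x \<odot> T y"
  by (simp add: T_eq_C tilde_mult_def C_desc_mult)

text \<open>The argument on the right is the inverse of \<open>x\<close> for
  \<open>tilde_mult\<close>. This keeps the values of \<open>T\<close> closed under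
  inversion.\<close>

lemma inv_T: "x \<in> G \<Longrightarrow> inv (T x) = T (inv (desc_inv (inv x)))"
  by (simp add: T_eq_C C_desc_inv)

text \<open>Under \<open>C\<close>, the right-hand side sees \<open>z\<close> only through
  \<open>C z\<close>.\<close>

lemma mult_eq_desc_mult: "x \<in> G \<Longrightarrow> z \<in> G \<Longrightarrow> z \<odot> x = desc_mult z (inv (C z) \<odot> x \<odot> C z)"
  by (simp add: desc_mult_def C_def inv_mult assoc)

text \<open>Under \<open>B\<close>, the right-hand side sees \<open>x\<close> only through
  \<open>B x\<close>.\<close>

lemma mult_eq_desc_mult': "x \<in> G \<Longrightarrow> z \<in> G \<Longrightarrow> z \<odot> x = desc_mult x (inv (B x) \<odot> z \<odot> B x)"
  by (simp add: desc_mult_def assoc)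

text \<open>The right-hand side depends on \<open>y\<close> only through \<open>T y\<close>.\<close>

lemma T_lam:
  assumes "x \<in> G" "y \<in> G"
  defines "k \<equiv> T (inv x) \<odot> T y"
  shows "T (lam x y) = k \<odot> T (inv k \<odot> x \<odot> k)"
proof -
  \<comment> \<open>\<open>w\<close> is the inverse of \<open>lam x y\<close>, so
    \<open>T (lam x y) = C w\<close>. Multiplied by \<open>x\<close> on the right it becomes the
    descendent product of \<open>x\<close> and \<open>inv y\<close>, whose value under
    \<open>C\<close> is \<open>k\<close>.\<close>
  define w where "w = lam x (inv y)"
  have k: "k = C (w \<odot> x)"
    using assms by (simp add: T_eq_C w_def C_desc_mult[symmetric]) (simp add: desc_mult_def lam_def)
  have w: "w \<in> G" using assms by (simp add: w_def)
  have [simp]: "k \<in> G" using assms by simp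
  have "T (lam x y) = C w" using assms by (simp add: T_eq_C w_def lam_def inv_mult assoc)
  also have "w = (w \<odot> x) \<odot> inv x" using assms w by (simp add: assoc)
  also have "\<dots> = desc_mult (w \<odot> x) (inv k \<odot> inv x \<odot> k)"
    using assms w by (subst mult_eq_desc_mult) (simp_all add: k)
  also have "C \<dots> = k \<odot> C (inv k \<odot> inv x \<odot> k)"
    using assms w by (simp add: C_desc_mult k)
  finally show ?thesis using assms by (simp add: T_eq_C inv_mult assoc)
qed

lemma B_rho: "x \<in> G \<Longrightarrow> y \<in> G \<Longrightarrow> B (rho x y) = inv (B (inv (T y) \<odot> desc_inv x \<odot> T y))"
  by (simp add: rho_def B_desc_inv)

text \<open>The right-hand side depends on \<open>x\<close> only through \<open>B x\<close>.\<close>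

lemma B_rho':
  assumes "x \<in> G" "y \<in> G"
  shows "B (rho x y) = inv (B (B x \<odot> inv y \<odot> inv (B x))) \<odot> B x \<odot> B (inv y)"
proof -
  define b where "b = B (inv (T y) \<odot> desc_inv x \<odot> T y)"
  have b: "b \<in> G" using assms by (simp add: b_def)
  \<comment> \<open>The two chains evaluate \<open>B\<close> at
    \<open>inv y \<odot> desc_inv x\<close>, split as a descendent product headed by
    \<open>inv y\<close> or by \<open>desc_inv x\<close>.\<close>
  have "B (inv y) \<odot> b = B (inv y \<odot> desc_inv x)"
    using assms by (subst mult_eq_desc_mult) (simp_all add: B_desc_mult b_def T_eq_C)
  also have "\<dots> = inv (B x) \<odot> B (B x \<odot> inv y \<odot> inv (B x))"
    using assms by (subst mult_eq_desc_mult') (simp_all add: B_desc_mult B_desc_inv)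
  finally have "inv (B (inv y)) \<odot> (B (inv y) \<odot> b) = inv (B (inv y)) \<odot> (inv (B x) \<odot> B (B x \<odot> inv y \<odot> inv (B x)))"
    by simp
  then have "b = inv (B (inv y)) \<odot> (inv (B x) \<odot> B (B x \<odot> inv y \<odot> inv (B x)))"
    using assms b by simp
  then show ?thesis using assms by (simp add: B_rho b_def[symmetric]) (simp add: inv_mult assoc)
qed

text \<open>\<open>lam\<close> sees its first argument only through \<open>B\<close>, so by
  \<open>B_rho'\<close> the map \<open>lam (rho x y)\<close> is conjugation by
  \<open>inv (B (inv (lam x y))) \<odot> B x \<odot> B (inv y)\<close>. The outer factors match
  those that \<open>tilde_mult\<close> introduces.\<close>

lemma lam_tilde_mult: 
  assumes "x \<in> G" "y \<in> G" "z \<in> G"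
  shows "lam x (tilde_mult y z) = tilde_mult (lam x y) (lam (rho x y) z)"
  using assms
  by (simp add: lam_def tilde_mult_def desc_mult_def B_rho' inv_mult assoc)

text \<open>With \<open>b y = B (inv y)\<close>, the formula of \<open>B_rho'\<close> reads
  \<open>inv (b (lam x y)) \<odot> B x \<odot> b y\<close>. In the product on the right the two
  occurrences of \<open>b (lam y z)\<close> in the middle cancel.\<close>

lemma B_rho_desc_mult:
  assumes "x \<in> G" "y \<in> G" "z \<in> G"
  shows "B (rho (desc_mult x y) z) = B (rho x (lam y z)) \<odot> B (rho y z)"
  using assms
  by (simp add: lam_def B_rho' B_desc_mult inv_mult assoc)
end

section \<open>Cocommutative coalgebras with a basis\<close>

text \<open>
  A coalgebra is given by the structure constants of its comultiplication in a basis indexed by \<open>'i\<close>: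
  an entry \<open>(c, j, k)\<close> of \<open>\<delta> i\<close> stands for the summand \<open>c j \<otimes> k\<close> of \<open>\<Delta>(i)\<close>. A linear map on it is then
  an arbitrary function on \<open>'i\<close>, so identities between such sums carry no linearity side conditions.
\<close>

definition cosum ::
  "('k \<Rightarrow> 'v \<Rightarrow> 'v::ab_group_add) \<Rightarrow> ('i \<Rightarrow> ('k \<times> 'i \<times> 'i) list) \<Rightarrow> 'i \<Rightarrow> ('i \<Rightarrow> 'i \<Rightarrow> 'v) \<Rightarrow> 'v"
  where "cosum s \<delta> i F = (\<Sum>(c, j, k)\<leftarrow>\<delta> i. s c (F j k))"

lemma vector_space_mult: "vector_space ((*) :: 'k::field \<Rightarrow> 'k \<Rightarrow> 'k)"
  by unfold_locales (auto simp: algebra_simps)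

lemma linear_on_sum_list:
  fixes s :: "'k::field \<Rightarrow> 'a::ab_group_add \<Rightarrow> 'a" and s' :: "'k \<Rightarrow> 'b::ab_group_add \<Rightarrow> 'b"
  assumes "module s" "module s'" "linear_on s s' E g" "module.subspace s E" "\<And>x. x \<in> set xs \<Longrightarrow> f x \<in> E"
  shows "g (\<Sum>x\<leftarrow>xs. f x) = (\<Sum>x\<leftarrow>xs. g (f x)) \<and> (\<Sum>x\<leftarrow>xs. f x) \<in> E"
proof -
  interpret m: module s by fact
  interpret m': module s' by fact
  have "g (s 0 0) = s' 0 (g 0)"
    using assms m.subspace_0 unfolding linear_on_def by blast
  then have "g 0 = 0" by simp
  then show ?thesis using assms(3,5)
    by (induction xs) (auto simp: linear_on_def m.subspace_0[OF assms(4)] intro: m.subspace_add[OF assms(4)])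
qed

lemma cosum_mem:
  fixes s :: "'k::field \<Rightarrow> 'a::ab_group_add \<Rightarrow> 'a"
  assumes "module s" "module.subspace s E" "\<And>j k. F j k \<in> E"
  shows "cosum s \<delta> i F \<in> E"
  unfolding cosum_def
  using linear_on_sum_list[of s s E "\<lambda>x. x" "\<delta> i" "\<lambda>(c, j, k). s c (F j k)"] assms
  by (auto simp: linear_on_def module.subspace_scale)

lemma cosum_hom:
  fixes s :: "'k::field \<Rightarrow> 'a::ab_group_add \<Rightarrow> 'a" and s' :: "'k \<Rightarrow> 'b::ab_group_add \<Rightarrow> 'b"
  assumes "module s" "module s'" "linear_on s s' E g" "module.subspace s E" "\<And>j k. F j k \<in> E"
  shows "g (cosum s \<delta> i F) = cosum s' \<delta> i (\<lambda>j k. g (F j k))"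
proof -
  have "g (cosum s \<delta> i F) = (\<Sum>x\<leftarrow>\<delta> i. g ((\<lambda>(c, j, k). s c (F j k)) x))"
    unfolding cosum_def
    using linear_on_sum_list[OF assms(1-4), of "\<delta> i" "\<lambda>(c, j, k). s c (F j k)"] assms
    by (auto simp: module.subspace_scale)
  also have "\<dots> = cosum s' \<delta> i (\<lambda>j k. g (F j k))"
    unfolding cosum_def
    by (intro arg_cong[of _ _ sum_list] map_cong refl) (use assms in \<open>auto simp: linear_on_def\<close>)
  finally show ?thesis .
qed

lemma cosum_swap:
  assumes "module s"
  shows "cosum s \<delta> i (\<lambda>j k. cosum s \<gamma> i' (\<lambda>l m. F j k l m)) =
    cosum s \<gamma> i' (\<lambda>l m. cosum s \<delta> i (\<lambda>j k. F j k l m))"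
proof -
  interpret module s by fact
  have "(\<Sum>(c, j, k)\<leftarrow>xs. s c (\<Sum>(d, l, m)\<leftarrow>ys. s d (F j k l m))) =
      (\<Sum>(d, l, m)\<leftarrow>ys. s d (\<Sum>(c, j, k)\<leftarrow>xs. s c (F j k l m)))" for xs ys
  proof (induction xs)
    case Nil
    show ?case by (induction ys) auto
  next
    case (Cons x xs)
    obtain c j k where x: "x = (c, j, k)" by (cases x) auto
    have "s c (\<Sum>(d, l, m)\<leftarrow>ys. s d (F j k l m)) + (\<Sum>(d, l, m)\<leftarrow>ys. s d (\<Sum>(c, j, k)\<leftarrow>xs. s c (F j k l m)))
      = (\<Sum>(d, l, m)\<leftarrow>ys. s d (s c (F j k l m) + (\<Sum>(c, j, k)\<leftarrow>xs. s c (F j k l m))))"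
      by (induction ys) (auto simp: scale_right_distrib algebra_simps scale_left_commute)
    then show ?case by (simp add: Cons x)
  qed
  then show ?thesis by (simp add: cosum_def)
qed

text \<open>Grouping equal indices shows that a formal sum depends only on the total coefficient of
  each index, which \<open>of_bool\<close> extracts. This carries identities for scalar functions
  over to functions \<open>F\<close> into any module.\<close>

lemma sum_list_coeff_eq:
  fixes s :: "'k::field \<Rightarrow> 'v::ab_group_add \<Rightarrow> 'v"
  assumes "module s"
    and eq: "\<And>t. (\<Sum>(c, t')\<leftarrow>L. c * of_bool (t' = t)) = (\<Sum>(c, t')\<leftarrow>L'. c * of_bool (t' = t))"
  shows "(\<Sum>(c, t)\<leftarrow>L. s c (F t)) = (\<Sum>(c, t)\<leftarrow>L'. s c (F t))"
proof -
  interpret module s by fact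
  define A where "A = snd ` set L \<union> snd ` set L'"
  have A: "finite A" by (simp add: A_def)
  have *: "(\<Sum>(c, t)\<leftarrow>M. s c (F t)) = (\<Sum>t\<in>A. s (\<Sum>(c, t')\<leftarrow>M. c * of_bool (t' = t)) (F t))"
    if "snd ` set M \<subseteq> A" for M using that
  proof (induction M)
    case (Cons x M)
    obtain c t where x: "x = (c, t)" by (cases x) auto
    have "(\<Sum>u\<in>A. s (c * of_bool (t = u)) (F u)) = (\<Sum>u\<in>A. if t = u then s c (F u) else 0)"
      by (intro sum.cong) auto
    also have "\<dots> = s c (F t)" using Cons.prems A by (simp add: x)
    finally show ?case using Cons by (simp add: x scale_left_distrib sum.distrib)
  qed simp
  show ?thesis by (subst (1 2) *) (auto simp: A_def eq)
qed

lemma scale_sum_list: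
  assumes "module s"
  shows "s c (\<Sum>x\<leftarrow>xs. f x) = (\<Sum>x\<leftarrow>xs. s c (f x))"
proof -
  interpret module s by fact
  show ?thesis by (induction xs) (auto simp: scale_right_distrib)
qed

lemma scale_cosum:
  assumes "module s"
  shows "s c (cosum s \<delta> i F) = cosum s \<delta> i (\<lambda>j k. s c (F j k))"
  by (simp add: cosum_def scale_sum_list[OF assms] case_prod_unfold module.scale_left_commute[OF assms, of c])

text \<open>The iterated coproduct is flattened into one list of coefficients and triples, the form
  to which \<open>sum_list_coeff_eq\<close> applies.\<close>

lemma cosum_nested_left:
  assumes "module s"
  shows "cosum s \<delta> i (\<lambda>j k. cosum s \<delta> j (\<lambda>l m. F l m k)) =
    (\<Sum>(c, l, m, k)\<leftarrow>[(c * c', l, m, k). (c, j, k) \<leftarrow> \<delta> i, (c', l, m) \<leftarrow> \<delta> j]. s c (F l m k))"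
proof -
  interpret module s by fact
  have "(\<Sum>(c, j, k)\<leftarrow>xs. s c (\<Sum>(c', l, m)\<leftarrow>\<delta> j. s c' (F l m k))) =
    (\<Sum>(c, l, m, k)\<leftarrow>[(c * c', l, m, k). (c, j, k) \<leftarrow> xs, (c', l, m) \<leftarrow> \<delta> j]. s c (F l m k))" for xs
    by (induction xs) (auto simp: scale_sum_list[OF assms] comp_def case_prod_unfold)
  then show ?thesis by (simp add: cosum_def)
qed

lemma cosum_nested_right:
  assumes "module s"
  shows "cosum s \<delta> i (\<lambda>j k. cosum s \<delta> k (\<lambda>l m. F j l m)) =
    (\<Sum>(c, j, l, m)\<leftarrow>[(c * c', j, l, m). (c, j, k) \<leftarrow> \<delta> i, (c', l, m) \<leftarrow> \<delta> k]. s c (F j l m))"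
proof -
  interpret module s by fact
  have "(\<Sum>(c, j, k)\<leftarrow>xs. s c (\<Sum>(c', l, m)\<leftarrow>\<delta> k. s c' (F j l m))) =
    (\<Sum>(c, j, l, m)\<leftarrow>[(c * c', j, l, m). (c, j, k) \<leftarrow> xs, (c', l, m) \<leftarrow> \<delta> k]. s c (F j l m))" for xs
    by (induction xs) (auto simp: scale_sum_list[OF assms] comp_def case_prod_unfold)
  then show ?thesis by (simp add: cosum_def)
qed

text \<open>
  The axioms only mention products of scalar functions; since these include products of
  indicator functions, they determine all structure constants.
\<close>

locale based_coalgebra =
  fixes \<delta> :: "'i \<Rightarrow> ('k::field \<times> 'i \<times> 'i) list" and \<epsilon> :: "'i \<Rightarrow> 'k"
  assumes coassoc_coeff:
      "cosum (*) \<delta> i (\<lambda>j k. cosum (*) \<delta> j (\<lambda>l m. f l * g m * h k)) =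
       cosum (*) \<delta> i (\<lambda>j k. cosum (*) \<delta> k (\<lambda>l m. f j * g l * h m))"
    and counit_coeff: "cosum (*) \<delta> i (\<lambda>j k. \<epsilon> j * f k) = f i"
    and cocomm_coeff: "cosum (*) \<delta> i (\<lambda>j k. f j * g k) = cosum (*) \<delta> i (\<lambda>j k. f k * g j)"
begin

lemma coassoc:
  assumes "module s"
  shows "cosum s \<delta> i (\<lambda>j k. cosum s \<delta> j (\<lambda>l m. F l m k)) =
    cosum s \<delta> i (\<lambda>j k. cosum s \<delta> k (\<lambda>l m. F j l m))"
proof -
  have k: "module ((*) :: 'k \<Rightarrow> 'k \<Rightarrow> 'k)"
    using vector_space_mult module_iff_vector_space by blast
  have del: "of_bool ((l, m, k) = t) =
    of_bool (l = fst t) * of_bool (m = fst (snd t)) * (of_bool (k = snd (snd t)) :: 'k)" for l m k t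
    by (cases t) auto
  have "(\<Sum>(c, t)\<leftarrow>[(c * c', l, m, k). (c, j, k) \<leftarrow> \<delta> i, (c', l, m) \<leftarrow> \<delta> j]. s c ((\<lambda>(l, m, k). F l m k) t)) =
    (\<Sum>(c, t)\<leftarrow>[(c * c', j, l, m). (c, j, k) \<leftarrow> \<delta> i, (c', l, m) \<leftarrow> \<delta> k]. s c ((\<lambda>(l, m, k). F l m k) t))"
  proof (rule sum_list_coeff_eq[OF assms])
    fix t
    show "(\<Sum>(c, t')\<leftarrow>[(c * c', l, m, k). (c, j, k) \<leftarrow> \<delta> i, (c', l, m) \<leftarrow> \<delta> j]. c * of_bool (t' = t)) =
    (\<Sum>(c, t')\<leftarrow>[(c * c', j, l, m). (c, j, k) \<leftarrow> \<delta> i, (c', l, m) \<leftarrow> \<delta> k]. c * of_bool (t' = t))"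
      using coassoc_coeff[of i "\<lambda>x. of_bool (x = fst t)" "\<lambda>x. of_bool (x = fst (snd t))" "\<lambda>x. of_bool (x = snd (snd t))"]
      unfolding cosum_nested_left[OF k] cosum_nested_right[OF k] del[symmetric]
      by (simp add: case_prod_unfold)
  qed
  then show ?thesis
    unfolding cosum_nested_left[OF assms] cosum_nested_right[OF assms]
    by (simp add: case_prod_unfold)
qed

lemma counit:
  assumes "module s"
  shows "cosum s \<delta> i (\<lambda>j k. s (\<epsilon> j) (F k)) = F i"
proof -
  interpret module s by fact
  have "(\<Sum>(c, t)\<leftarrow>[(c * \<epsilon> j, k). (c, j, k) \<leftarrow> \<delta> i]. s c (F t)) = (\<Sum>(c, t)\<leftarrow>[(1, i)]. s c (F t))"
    by (rule sum_list_coeff_eq[OF assms])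
      (use counit_coeff[of i "\<lambda>x. of_bool (x = t)" for t] in
        \<open>simp add: cosum_def case_prod_unfold comp_def mult.assoc\<close>)
  then show ?thesis by (simp add: cosum_def case_prod_unfold comp_def)
qed

lemma cocomm:
  assumes "module s"
  shows "cosum s \<delta> i (\<lambda>j k. F j k) = cosum s \<delta> i (\<lambda>j k. F k j)"
proof -
  have del: "of_bool ((l, m) = t) = of_bool (l = fst t) * (of_bool (m = snd t) :: 'k)" for l m t
    by (cases t) auto
  have "(\<Sum>(c, t)\<leftarrow>\<delta> i. s c (case_prod F t)) = (\<Sum>(c, t)\<leftarrow>[(c, k, j). (c, j, k) \<leftarrow> \<delta> i]. s c (case_prod F t))"
    by (rule sum_list_coeff_eq[OF assms])
      (use cocomm_coeff[of i "\<lambda>x. of_bool (x = fst t)" "\<lambda>x. of_bool (x = snd t)" for t] in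
        \<open>simp add: cosum_def case_prod_unfold comp_def del[symmetric]\<close>)
  then show ?thesis by (simp add: cosum_def case_prod_unfold comp_def)
qed

lemma counit':
  assumes "module s"
  shows "cosum s \<delta> i (\<lambda>j k. s (\<epsilon> k) (F j)) = F i"
  by (subst cocomm[OF assms]) (rule counit[OF assms])

lemma swap_left:
  assumes "module s"
  shows "cosum s \<delta> i (\<lambda>a r. cosum s \<delta> r (\<lambda>b t. F a b t)) = cosum s \<delta> i (\<lambda>a r. cosum s \<delta> r (\<lambda>b t. F b a t))"
  by (subst (1 2) coassoc[OF assms, symmetric], subst (2) cocomm[OF assms]) (rule refl)

text \<open>Middle-four interchange: after reassociation the two inner factors come from a single
  coproduct, where cocommutativity swaps them.\<close>

lemma interchange:
  assumes s: "module s"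
  shows "cosum s \<delta> i (\<lambda>j k. cosum s \<delta> j (\<lambda>a b. cosum s \<delta> k (\<lambda>c d. F a b c d))) =
    cosum s \<delta> i (\<lambda>j k. cosum s \<delta> j (\<lambda>a b. cosum s \<delta> k (\<lambda>c d. F a c b d)))"
proof -
  have "cosum s \<delta> i (\<lambda>j k. cosum s \<delta> j (\<lambda>a b. cosum s \<delta> k (\<lambda>c d. G a b c d))) =
    cosum s \<delta> i (\<lambda>a j. cosum s \<delta> j (\<lambda>k d. cosum s \<delta> k (\<lambda>b c. G a b c d)))" for G
    by (subst coassoc[OF s], subst (2) coassoc[OF s, symmetric]) simp
  note eq = this
  show ?thesis by (subst (1 2) eq, subst (3) cocomm[OF s]) simp
qed

end

definition prod_comul ::
  "('i \<Rightarrow> ('k::field \<times> 'i \<times> 'i) list) \<Rightarrow> ('j \<Rightarrow> ('k \<times> 'j \<times> 'j) list) \<Rightarrow>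
   'i \<times> 'j \<Rightarrow> ('k \<times> ('i \<times> 'j) \<times> ('i \<times> 'j)) list"
  where "prod_comul \<delta> \<gamma> p =
    [(c * d, (i\<^sub>1, j\<^sub>1), (i\<^sub>2, j\<^sub>2)). (c, i\<^sub>1, i\<^sub>2) \<leftarrow> \<delta> (fst p), (d, j\<^sub>1, j\<^sub>2) \<leftarrow> \<gamma> (snd p)]"

definition prod_counit :: "('i \<Rightarrow> 'k::field) \<Rightarrow> ('j \<Rightarrow> 'k) \<Rightarrow> 'i \<times> 'j \<Rightarrow> 'k"
  where "prod_counit \<epsilon> \<eta> p = \<epsilon> (fst p) * \<eta> (snd p)"

lemma cosum_prod_comul:
  assumes "module s"
  shows "cosum s (prod_comul \<delta> \<gamma>) p F =
    cosum s \<delta> (fst p) (\<lambda>i\<^sub>1 i\<^sub>2. cosum s \<gamma> (snd p) (\<lambda>j\<^sub>1 j\<^sub>2. F (i\<^sub>1, j\<^sub>1) (i\<^sub>2, j\<^sub>2)))"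
proof -
  interpret module s by fact
  have "(\<Sum>(c, j, k)\<leftarrow>[(c * d, (i\<^sub>1, j\<^sub>1), (i\<^sub>2, j\<^sub>2)). (c, i\<^sub>1, i\<^sub>2) \<leftarrow> xs, (d, j\<^sub>1, j\<^sub>2) \<leftarrow> ys]. s c (F j k)) =
    (\<Sum>(c, i\<^sub>1, i\<^sub>2)\<leftarrow>xs. s c (\<Sum>(d, j\<^sub>1, j\<^sub>2)\<leftarrow>ys. s d (F (i\<^sub>1, j\<^sub>1) (i\<^sub>2, j\<^sub>2))))" for xs ys
    by (induction xs) (auto simp: scale_sum_list[OF assms] comp_def case_prod_unfold)
  then show ?thesis by (simp add: cosum_def prod_comul_def)
qed

lemma based_coalgebra_prod:
  fixes \<delta> :: "'i \<Rightarrow> ('k::field \<times> 'i \<times> 'i) list" and \<gamma> :: "'j \<Rightarrow> ('k \<times> 'j \<times> 'j) list"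
  assumes "based_coalgebra \<delta> \<epsilon>" "based_coalgebra \<gamma> \<eta>"
  shows "based_coalgebra (prod_comul \<delta> \<gamma>) (prod_counit \<epsilon> \<eta>)"
proof -
  interpret d: based_coalgebra \<delta> \<epsilon> by fact
  interpret g: based_coalgebra \<gamma> \<eta> by fact
  have k: "module ((*) :: 'k \<Rightarrow> 'k \<Rightarrow> 'k)"
    using vector_space_mult module_iff_vector_space by blast
  note simps = cosum_prod_comul[OF k] prod_counit_def fst_conv snd_conv
  show ?thesis
  proof
    fix f g h :: "'i \<times> 'j \<Rightarrow> 'k" and p
    have "cosum (*) (prod_comul \<delta> \<gamma>) p (\<lambda>j k. cosum (*) (prod_comul \<delta> \<gamma>) j (\<lambda>l m. f l * g m * h k)) =
      cosum (*) \<delta> (fst p) (\<lambda>i\<^sub>1 i\<^sub>2. cosum (*) \<delta> i\<^sub>1 (\<lambda>a b. cosum (*) \<gamma> (snd p) (\<lambda>j\<^sub>1 j\<^sub>2. cosum (*) \<gamma> j\<^sub>1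
       (\<lambda>c d. f (a, c) * g (b, d) * h (i\<^sub>2, j\<^sub>2)))))"
      unfolding simps by (subst cosum_swap[OF k]) (rule refl)
    also have "\<dots> = cosum (*) \<delta> (fst p) (\<lambda>a i. cosum (*) \<delta> i (\<lambda>b i\<^sub>2. cosum (*) \<gamma> (snd p) (\<lambda>c j. cosum (*) \<gamma> j
       (\<lambda>d j\<^sub>2. f (a, c) * g (b, d) * h (i\<^sub>2, j\<^sub>2)))))"
      by (subst g.coassoc[OF k]) (rule d.coassoc[OF k])
    also have "\<dots> = cosum (*) (prod_comul \<delta> \<gamma>) p (\<lambda>j k. cosum (*) (prod_comul \<delta> \<gamma>) k (\<lambda>l m. f j * g l * h m))"
      unfolding simps by (subst cosum_swap[OF k]) (rule refl)
    finally show "cosum (*) (prod_comul \<delta> \<gamma>) p (\<lambda>j k. cosum (*) (prod_comul \<delta> \<gamma>) j (\<lambda>l m. f l * g m * h k)) = \<dots>" .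
    show "cosum (*) (prod_comul \<delta> \<gamma>) p (\<lambda>j k. prod_counit \<epsilon> \<eta> j * f k) = f p"
    proof -
      have "cosum (*) \<gamma> (snd p) (\<lambda>j\<^sub>1 j\<^sub>2. \<epsilon> i\<^sub>1 * \<eta> j\<^sub>1 * f (i\<^sub>2, j\<^sub>2)) = \<epsilon> i\<^sub>1 * f (i\<^sub>2, snd p)" for i\<^sub>1 i\<^sub>2
        using g.counit[OF k, of "snd p" "\<lambda>j. \<epsilon> i\<^sub>1 * f (i\<^sub>2, j)"] by (simp add: ac_simps)
      then show ?thesis unfolding simps using d.counit[OF k, of "fst p" "\<lambda>i. f (i, snd p)"] by simp
    qed
    show "cosum (*) (prod_comul \<delta> \<gamma>) p (\<lambda>j k. f j * g k) = cosum (*) (prod_comul \<delta> \<gamma>) p (\<lambda>j k. f k * g j)"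
      unfolding simps by (subst g.cocomm[OF k]) (rule d.cocomm[OF k])
  qed
qed

section \<open>Coalgebra maps into a Hopf algebra\<close>

text \<open>Coalgebra maps into \<open>H\<close>, recorded by their values on the basis. They are
  the points of \<open>H\<close> with values in the coalgebra; a cocommutative \<open>H\<close> is a
  group object among cocommutative coalgebras.\<close>

definition points ::
  "('k::field, 'a::ring_1) hopf \<Rightarrow> ('i \<Rightarrow> ('k \<times> 'i \<times> 'i) list) \<Rightarrow> ('i \<Rightarrow> 'k) \<Rightarrow> ('i \<Rightarrow> 'a) set"
  where "points H \<delta> \<epsilon> = {f. \<forall>i. f i \<in> carrier H \<and>
    comul H (f i) = cosum tscale \<delta> i (\<lambda>j k. pure_tensor H (f j) (f k)) \<and> counit H (f i) = \<epsilon> i}"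

lemma cosum_tensor_apply: "cosum tscale \<delta> i F \<beta> = cosum (*) \<delta> i (\<lambda>j k. F j k \<beta>)"
proof -
  have "(\<Sum>(c, j, k)\<leftarrow>xs. tscale c (F j k)) \<beta> = (\<Sum>(c, j, k)\<leftarrow>xs. c * F j k \<beta>)" for xs
    by (induction xs) (auto simp: tscale_def)
  then show ?thesis by (simp add: cosum_def)
qed

lemma module_tscale: "module (tscale :: 'k::field \<Rightarrow> ('k, 'a, 'b) tensor \<Rightarrow> _)"
  using vector_space_tscale module_iff_vector_space by blast

lemma tensor_sum_append: "tensor_sum s1 s2 (ps @ qs) = tensor_sum s1 s2 ps + tensor_sum s1 s2 qs"
  by (simp add: tensor_sum_def)

lemma tscale_tensor_sum:
  fixes s1 :: "'k::field \<Rightarrow> 'a::ab_group_add \<Rightarrow> 'a" and s2 :: "'k \<Rightarrow> 'b::ab_group_add \<Rightarrow> 'b"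
  shows "tscale c (tensor_sum s1 s2 ps) = tensor_sum s1 s2 (map (\<lambda>(x, y). (s1 c x, y)) ps)"
proof -
  have "tscale c (tens s1 s2 x y) = tens s1 s2 (s1 c x) y" for x y
    using bilinear_tens[of s1 s2] by (simp add: bilinear_on_def linear_on_def)
  then show ?thesis
    unfolding tensor_sum_def
    by (simp add: scale_sum_list[OF module_tscale] comp_def case_prod_unfold)
qed

section \<open>Sweedler sums: linearity, and their values at coalgebra maps\<close>

context hopf_algebra
begin

lemma module_smul: "module (smul H)"
  using vector_space_smul module_iff_vector_space by blast

sublocale vs: vector_space "smul H"
  by (rule vector_space_smul)

lemma carrier_subspace: "vs.subspace (carrier H)"
  using subspace_carrier .

lemma carrier_ops [simp]:
  "0 \<in> carrier H" "1 \<in> carrier H"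
  "x \<in> carrier H \<Longrightarrow> y \<in> carrier H \<Longrightarrow> x + y \<in> carrier H"
  "x \<in> carrier H \<Longrightarrow> y \<in> carrier H \<Longrightarrow> x * y \<in> carrier H"
  "x \<in> carrier H \<Longrightarrow> smul H c x \<in> carrier H"
  "x \<in> carrier H \<Longrightarrow> antipode H x \<in> carrier H"
  by (auto intro: vs.subspace_0[OF carrier_subspace] vs.subspace_add[OF carrier_subspace]
      vs.subspace_scale[OF carrier_subspace] one_closed mult_closed antipode_closed)

lemma antipode_add [simp]:
  "x \<in> carrier H \<Longrightarrow> y \<in> carrier H \<Longrightarrow> antipode H (x + y) = antipode H x + antipode H y"
  and antipode_smul [simp]: "x \<in> carrier H \<Longrightarrow> antipode H (smul H c x) = smul H c (antipode H x)"
  using antipode_linear by (auto simp: linear_on_def)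

lemma counit_add [simp]:
  "x \<in> carrier H \<Longrightarrow> y \<in> carrier H \<Longrightarrow> counit H (x + y) = counit H x + counit H y"
  and counit_smul [simp]: "x \<in> carrier H \<Longrightarrow> counit H (smul H c x) = c * counit H x"
  using counit_linear by (auto simp: linear_on_def)

lemma tens_add_left: "pure_tensor H (x + y) z = pure_tensor H x z + pure_tensor H y z"
  and tens_add_right: "pure_tensor H z (x + y) = pure_tensor H z x + pure_tensor H z y"
  and tens_smul_left: "pure_tensor H (smul H c x) z = tscale c (pure_tensor H x z)"
  and tens_smul_right: "pure_tensor H z (smul H c x) = tscale c (pure_tensor H z x)"
  using bilinear_tens[of "smul H" "smul H"] by (simp_all add: bilinear_on_def linear_on_def)

lemma tens_0: "pure_tensor H 0 x = 0" "pure_tensor H x 0 = 0"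
  using tens_smul_left[of 0 0 x] tens_smul_right[of x 0 0]
  by (simp_all add: module.scale_zero_left[OF module_tscale])

lemmas bilinear_simps = bilinear_on_def linear_on_def smul_mult_left smul_mult_right
  distrib_left distrib_right vs.scale_right_distrib vs.scale_left_distrib
  tens_add_left tens_add_right tens_smul_left tens_smul_right vs.scale_left_commute

abbreviation bilinear_form ::
  "('k \<Rightarrow> 'v::ab_group_add \<Rightarrow> 'v) \<Rightarrow> ('a \<Rightarrow> 'a \<Rightarrow> 'v) \<Rightarrow> bool"
  where "bilinear_form s F \<equiv> bilinear_on (smul H) (smul H) s (carrier H) (carrier H) F"

text \<open>A subspace \<open>C\<close> replaces the carrier so that Sweedler sums in the image Hopf
  algebras are computed in the same way.\<close>

lemma sweedler_tensor_sum:
  assumes "vector_space s" "vs.subspace C" "bilinear_on (smul H) (smul H) s C C F"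
    and "comul H x = tensor_sum (smul H) (smul H) ps" "set ps \<subseteq> C \<times> C"
  shows "sweedler (H\<lparr>carrier := C\<rparr>) x F = (\<Sum>(y, z)\<leftarrow>ps. F y z)"
  using tensor_lift_tensor_sum[OF vector_space_smul vector_space_smul assms(1,2,2,3,5)]
  by (simp add: sweedler_def assms(4))

lemma update_carrier_self [simp]: "H\<lparr>carrier := carrier H\<rparr> = H"
  by simp

lemmas sweedler_tensor_sum' =
  sweedler_tensor_sum[OF _ carrier_subspace, unfolded update_carrier_self]

lemma comul_list:
  assumes "x \<in> carrier H"
  obtains ps where "comul H x = tensor_sum (smul H) (smul H) ps" "set ps \<subseteq> carrier H \<times> carrier H"
  using comul_closed[OF assms] by (auto simp: tensor_space_def)

lemma sweedler_cong:
  assumes "\<And>y z. y \<in> carrier H \<Longrightarrow> z \<in> carrier H \<Longrightarrow> F y z = G y z"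
  shows "sweedler H x F = sweedler H x G"
proof -
  have "(\<Sum>(y, z)\<leftarrow>ps. F y z) = (\<Sum>(y, z)\<leftarrow>ps. G y z)" if "set ps \<subseteq> carrier H \<times> carrier H" for ps
    by (intro arg_cong[of _ _ sum_list] map_cong refl) (use that assms in auto)
  then have "(set ps \<subseteq> carrier H \<times> carrier H \<and> t = tensor_sum (smul H) (smul H) ps \<and> u = (\<Sum>(y, z)\<leftarrow>ps. F y z)) \<longleftrightarrow>
      (set ps \<subseteq> carrier H \<times> carrier H \<and> t = tensor_sum (smul H) (smul H) ps \<and> u = (\<Sum>(y, z)\<leftarrow>ps. G y z))"
    for ps t u by auto
  then show ?thesis
    unfolding sweedler_def tensor_lift_def by simp
qed

lemma linear_on_sweedler:
  assumes "vector_space s" "bilinear_form s F"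
  shows "linear_on (smul H) s (carrier H) (\<lambda>x. sweedler H x F)"
proof -
  interpret s: vector_space s by fact
  have add: "sweedler H (x + y) F = sweedler H x F + sweedler H y F"
    if xy: "x \<in> carrier H" "y \<in> carrier H" for x y
  proof -
    obtain ps qs where ps: "comul H x = tensor_sum (smul H) (smul H) ps" "set ps \<subseteq> carrier H \<times> carrier H"
      and qs: "comul H y = tensor_sum (smul H) (smul H) qs" "set qs \<subseteq> carrier H \<times> carrier H"
      using xy comul_list by metis
    have "comul H (x + y) = tensor_sum (smul H) (smul H) (ps @ qs)"
      using comul_linear xy by (simp add: linear_on_def ps qs tensor_sum_append)
    from sweedler_tensor_sum'[OF assms this] show ?thesis
      using ps qs by (simp add: sweedler_tensor_sum'[OF assms ps] sweedler_tensor_sum'[OF assms qs])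
  qed
  have scale: "sweedler H (smul H c x) F = s c (sweedler H x F)" if x: "x \<in> carrier H" for c x
  proof -
    obtain ps where ps: "comul H x = tensor_sum (smul H) (smul H) ps" "set ps \<subseteq> carrier H \<times> carrier H"
      using x comul_list by metis
    have *: "comul H (smul H c x) = tensor_sum (smul H) (smul H) (map (\<lambda>(x, y). (smul H c x, y)) ps)"
      using comul_linear x by (simp add: linear_on_def ps tscale_tensor_sum)
    have "s c (F y z) = F (smul H c y) z" if "y \<in> carrier H" "z \<in> carrier H" for y z
      using assms(2) that by (simp add: bilinear_on_def linear_on_def)
    then have "(\<Sum>(y, z)\<leftarrow>map (\<lambda>(x, y). (smul H c x, y)) ps. F y z) = s c (\<Sum>(y, z)\<leftarrow>ps. F y z)"
      unfolding scale_sum_list[OF s.module_axioms] map_map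
      by (intro arg_cong[of _ _ sum_list] map_cong refl) (use ps(2) in auto)
    moreover have "set (map (\<lambda>(x, y). (smul H c x, y)) ps) \<subseteq> carrier H \<times> carrier H"
      using ps(2) by auto
    ultimately show ?thesis
      by (simp only: sweedler_tensor_sum'[OF assms *] sweedler_tensor_sum'[OF assms ps])
  qed
  show ?thesis using add scale by (simp add: linear_on_def)
qed

text \<open>One list representing the coproduct of \<open>u\<close> serves for every value of the
  parameter \<open>z\<close>, so linearity in \<open>z\<close> is inherited termwise. Nested
  Sweedler sums get their bilinearity from this.\<close>

lemma linear_on_sweedler_param:
  fixes s\<^sub>0 :: "'k \<Rightarrow> 'w::ab_group_add \<Rightarrow> 'w"
  assumes "vector_space s" "vector_space s\<^sub>0" "module.subspace s\<^sub>0 E" "u \<in> carrier H"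
    and F: "\<And>z. z \<in> E \<Longrightarrow> bilinear_form s (\<lambda>x y. F x y z)"
    and lin: "\<And>x y. x \<in> carrier H \<Longrightarrow> y \<in> carrier H \<Longrightarrow> linear_on s\<^sub>0 s E (\<lambda>z. F x y z)"
  shows "linear_on s\<^sub>0 s E (\<lambda>z. sweedler H u (\<lambda>x y. F x y z))"
proof -
  interpret s: vector_space s by fact
  interpret s0: vector_space s\<^sub>0 by fact
  obtain ps where ps: "comul H u = tensor_sum (smul H) (smul H) ps" "set ps \<subseteq> carrier H \<times> carrier H"
    using assms(4) comul_list by metis
  have *: "sweedler H u (\<lambda>x y. F x y z) = (\<Sum>(x, y)\<leftarrow>ps. F x y z)" if "z \<in> E" for z
    by (rule sweedler_tensor_sum'[OF assms(1) F[OF that] ps])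
  have l: "linear_on s\<^sub>0 s E (\<lambda>z. (\<Sum>(x, y)\<leftarrow>ps. F x y z))"
    using ps(2)
  proof (induction ps)
    case Nil
    then show ?case by (simp add: linear_on_def)
  next
    case (Cons p ps)
    then show ?case using lin[of "fst p" "snd p"]
      by (auto simp: linear_on_def s.scale_right_distrib case_prod_unfold add_ac)
  qed
  show ?thesis
    using l * s0.subspace_add[OF assms(3)] s0.subspace_scale[OF assms(3)]
    by (simp add: linear_on_def)
qed

lemma bilinear_sweedler_left:
  assumes "vector_space s"
    and "\<And>z. z \<in> carrier H \<Longrightarrow> bilinear_form s (\<lambda>x y. F x y z)"
    and "\<And>x y. x \<in> carrier H \<Longrightarrow> y \<in> carrier H \<Longrightarrow> linear_on (smul H) s (carrier H) (\<lambda>z. F x y z)"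
  shows "bilinear_form s (\<lambda>u z. sweedler H u (\<lambda>x y. F x y z))"
  unfolding bilinear_on_def
proof (intro conjI ballI)
  show "linear_on (smul H) s (carrier H) (\<lambda>u. sweedler H u (\<lambda>x y. F x y z))" if "z \<in> carrier H" for z
    by (rule linear_on_sweedler[OF assms(1) assms(2)[OF that]])
  show "linear_on (smul H) s (carrier H) (\<lambda>z. sweedler H u (\<lambda>x y. F x y z))" if "u \<in> carrier H" for u
    by (rule linear_on_sweedler_param[OF assms(1) vector_space_smul carrier_subspace that assms(2,3)])
qed

text \<open>Because \<open>f\<close> is a coalgebra map, the structure constants of its source give
  a list representing the coproduct of \<open>f i\<close>. This is the passage from Sweedler
  notation to convolution.\<close>

lemma sweedler_points_sub:
  assumes f: "f \<in> points H \<delta> \<epsilon>" and C: "vs.subspace C" "\<And>i. f i \<in> C"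
    and s: "vector_space s" and F: "bilinear_on (smul H) (smul H) s C C F"
  shows "sweedler (H\<lparr>carrier := C\<rparr>) (f i) F = cosum s \<delta> i (\<lambda>j k. F (f j) (f k))"
proof -
  define ps where "ps = map (\<lambda>(c, j, k). (smul H c (f j), f k)) (\<delta> i)"
  have "comul H (f i) = tensor_sum (smul H) (smul H) ps"
    using f by (simp add: points_def cosum_def ps_def tensor_sum_def case_prod_unfold comp_def
        tens_smul_left)
  moreover have "set ps \<subseteq> C \<times> C"
    using C by (auto simp: ps_def vs.subspace_scale)
  ultimately have "sweedler (H\<lparr>carrier := C\<rparr>) (f i) F = (\<Sum>(y, z)\<leftarrow>ps. F y z)"
    by (rule sweedler_tensor_sum[OF s C(1) F])
  also have "\<dots> = cosum s \<delta> i (\<lambda>j k. F (f j) (f k))"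
    using F C(2) by (simp add: ps_def cosum_def case_prod_unfold comp_def bilinear_on_def linear_on_def)
  finally show ?thesis .
qed

lemma points_carrier: "f \<in> points H \<delta> \<epsilon> \<Longrightarrow> f i \<in> carrier H"
  by (simp add: points_def)

lemma counit_points: "f \<in> points H \<delta> \<epsilon> \<Longrightarrow> counit H (f i) = \<epsilon> i"
  by (simp add: points_def)

lemma comul_points:
  "f \<in> points H \<delta> \<epsilon> \<Longrightarrow> comul H (f i) = cosum tscale \<delta> i (\<lambda>j k. pure_tensor H (f j) (f k))"
  by (simp add: points_def)

lemma sweedler_points:
  assumes "f \<in> points H \<delta> \<epsilon>" "vector_space s" "bilinear_form s F"
  shows "sweedler H (f i) F = cosum s \<delta> i (\<lambda>j k. F (f j) (f k))"
  using sweedler_points_sub[OF assms(1) carrier_subspace points_carrier[OF assms(1)] assms(2,3)]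
  unfolding update_carrier_self .

section \<open>A coalgebra map through every element of a cocommutative Hopf algebra\<close>

lemma span_list:
  assumes "x \<in> vs.span S"
  shows "\<exists>l. set l \<subseteq> UNIV \<times> S \<and> x = (\<Sum>(c, b)\<leftarrow>l. smul H c b)"
  using assms
proof (induction rule: vs.span_induct_alt)
  case base
  show ?case by (rule exI[of _ "[]"]) simp
next
  case (step c b y)
  then obtain l where "set l \<subseteq> UNIV \<times> S" "y = (\<Sum>(c, b)\<leftarrow>l. smul H c b)" by auto
  then show ?case using step by (intro exI[of _ "(c, b) # l"]) simp
qed

text \<open>For a basis \<open>S\<close>, the entries of \<open>l\<close> serve as the structure
  constants at \<open>x\<close>.\<close>

lemma comul_span_list:
  assumes "x \<in> carrier H" and S: "carrier H \<subseteq> vs.span S"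
  shows "\<exists>l. set l \<subseteq> UNIV \<times> S \<times> S \<and> comul H x = (\<Sum>(c, y, z)\<leftarrow>l. tscale c (pure_tensor H y z))"
proof -
  interpret t: module tscale by (rule module_tscale)
  obtain ps where ps: "comul H x = tensor_sum (smul H) (smul H) ps" "set ps \<subseteq> carrier H \<times> carrier H"
    using assms comul_list by metis
  have "\<exists>l. set l \<subseteq> UNIV \<times> S \<times> S \<and> tensor_sum (smul H) (smul H) ps = (\<Sum>(c, y, z)\<leftarrow>l. tscale c (pure_tensor H y z))"
    using ps(2)
  proof (induction ps)
    case Nil
    show ?case by (rule exI[of _ "[]"]) (simp add: tensor_sum_def)
  next
    case (Cons p ps)
    obtain y z where p: "p = (y, z)" by (cases p)
    obtain l where l: "set l \<subseteq> UNIV \<times> S \<times> S"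
        "tensor_sum (smul H) (smul H) ps = (\<Sum>(c, y, z)\<leftarrow>l. tscale c (pure_tensor H y z))"
      using Cons by auto
    obtain ly where ly: "set ly \<subseteq> UNIV \<times> S" "y = (\<Sum>(c, b)\<leftarrow>ly. smul H c b)"
      using span_list[of y S] Cons.prems S p by auto
    obtain lz where lz: "set lz \<subseteq> UNIV \<times> S" "z = (\<Sum>(c, b)\<leftarrow>lz. smul H c b)"
      using span_list[of z S] Cons.prems S p by auto
    have 1: "pure_tensor H b (\<Sum>(d, b')\<leftarrow>lz. smul H d b') = (\<Sum>(d, b')\<leftarrow>lz. tscale d (pure_tensor H b b'))" for b lz
      by (induction lz) (auto simp: tens_0 tens_add_right tens_smul_right)
    have 2: "pure_tensor H (\<Sum>(c, b)\<leftarrow>ly. smul H c b) z = (\<Sum>(c, b)\<leftarrow>ly. tscale c (pure_tensor H b z))" for ly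
      by (induction ly) (auto simp: tens_0 tens_add_left tens_smul_left)
    have 3: "(\<Sum>(c, b)\<leftarrow>ly. tscale c (pure_tensor H b z)) =
        (\<Sum>(c, y, z)\<leftarrow>[(c * d, b, b'). (c, b) \<leftarrow> ly, (d, b') \<leftarrow> lz]. tscale c (pure_tensor H y z))" for ly
      unfolding lz(2) 1
      by (induction ly) (auto simp: scale_sum_list[OF module_tscale] comp_def case_prod_unfold)
    have "pure_tensor H y z = (\<Sum>(c, y, z)\<leftarrow>[(c * d, b, b'). (c, b) \<leftarrow> ly, (d, b') \<leftarrow> lz]. tscale c (pure_tensor H y z))"
      by (subst ly(2)) (simp only: 2 3)
    moreover have "set [(c * d, b, b'). (c, b) \<leftarrow> ly, (d, b') \<leftarrow> lz] \<subseteq> UNIV \<times> S \<times> S"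
      using ly lz by auto
    ultimately show ?case using l
      by (intro exI[of _ "[(c * d, b, b'). (c, b) \<leftarrow> ly, (d, b') \<leftarrow> lz] @ l"]) (simp add: tensor_sum_def p)
  qed
  then show ?thesis by (simp add: ps)
qed

text \<open>
  Tensors are functionals on bilinear forms, so coassociativity in \<open>H \<otimes> (H \<otimes> H)\<close> can be evaluated
  directly at the form \<open>\<gamma>\<close> built from \<open>F\<close>, \<open>G\<close> and \<open>K\<close>.
\<close>

lemma coassoc_points:
  fixes F G K :: "'a \<Rightarrow> 'k"
  assumes p: "p \<in> points H \<delta> \<epsilon>"
    and lin: "linear_on (smul H) (*) UNIV F" "linear_on (smul H) (*) UNIV G" "linear_on (smul H) (*) UNIV K"
  shows "cosum (*) \<delta> i (\<lambda>j k. cosum (*) \<delta> j (\<lambda>l m. F (p l) * G (p m) * K (p k))) =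
    cosum (*) \<delta> i (\<lambda>j k. cosum (*) \<delta> k (\<lambda>l m. F (p j) * G (p l) * K (p m)))"
proof -
  note [simp] = points_carrier[OF p]
  define \<beta> where "\<beta> = (\<lambda>x y. G x * K y)"
  define \<gamma> :: "'a \<Rightarrow> ('k, 'a, 'a) tensor \<Rightarrow> 'k" where "\<gamma> = (\<lambda>x t. F x * t \<beta>)"
  have \<beta>: "bilinear_on (smul H) (smul H) (*) UNIV UNIV \<beta>"
    using lin(2,3) by (auto simp: bilinear_on_def linear_on_def \<beta>_def algebra_simps)
  have \<gamma>: "bilinear_on (smul H) tscale (*) UNIV UNIV \<gamma>"
    using lin(1) by (auto simp: bilinear_on_def linear_on_def \<gamma>_def algebra_simps tscale_def)
  have t: "vector_space (tscale :: 'k \<Rightarrow> ('k, 'a, ('k, 'a, 'a) tensor) tensor \<Rightarrow> _)"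
    by (rule vector_space_tscale)
  have b: "bilinear_on (smul H) tscale tscale UNIV UNIV
      (tens (smul H) tscale :: 'a \<Rightarrow> ('k, 'a, 'a) tensor \<Rightarrow> ('k, 'a, ('k, 'a, 'a) tensor) tensor)"
    by (rule bilinear_tens)
  have 1: "bilinear_form tscale (\<lambda>x y. tens (smul H) tscale x (pure_tensor H y z))" for z
    using b by (simp add: bilinear_on_def linear_on_def tens_add_left tens_smul_left)
  have 2: "linear_on (smul H) tscale (carrier H) (\<lambda>z. tens (smul H) tscale x (pure_tensor H y z))" for x y
    using b by (simp add: bilinear_on_def linear_on_def tens_add_right tens_smul_right)
  have 3: "bilinear_form tscale (\<lambda>x v. tens (smul H) tscale x (comul H v))"
    using b comul_linear by (simp add: bilinear_on_def linear_on_def)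
  have 4: "bilinear_form tscale (\<lambda>u z. sweedler H u (\<lambda>x y. tens (smul H) tscale x (pure_tensor H y z)))"
    by (rule bilinear_sweedler_left[OF t 1 2])
  have "cosum tscale \<delta> i (\<lambda>j k. cosum tscale \<delta> j (\<lambda>l m. tens (smul H) tscale (p l) (pure_tensor H (p m) (p k))))
      = sweedler3 H (p i) (\<lambda>x y z. tens (smul H) tscale x (pure_tensor H y z))"
    unfolding sweedler3_def sweedler_points[OF p t 4] by (simp add: sweedler_points[OF p t 1])
  also have "\<dots> = cosum tscale \<delta> i (\<lambda>j k. tens (smul H) tscale (p j) (comul H (p k)))"
    by (simp add: coassoc sweedler_points[OF p t 3])
  finally have "cosum tscale \<delta> i (\<lambda>j k. cosum tscale \<delta> j (\<lambda>l m. tens (smul H) tscale (p l) (pure_tensor H (p m) (p k)))) \<gamma>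
      = cosum tscale \<delta> i (\<lambda>j k. tens (smul H) tscale (p j) (comul H (p k))) \<gamma>"
    by simp
  then have "cosum (*) \<delta> i (\<lambda>j k. cosum (*) \<delta> j (\<lambda>l m. F (p l) * (G (p m) * K (p k)))) =
    cosum (*) \<delta> i (\<lambda>j k. F (p j) * cosum (*) \<delta> k (\<lambda>l m. G (p l) * K (p m)))"
    by (simp add: cosum_tensor_apply tens_def \<gamma>) (simp add: \<gamma>_def comul_points[OF p] cosum_tensor_apply tens_def \<beta>, simp add: \<beta>_def)
  moreover have "a * cosum (*) \<delta> k f = cosum (*) \<delta> k (\<lambda>l m. a * f l m)" for a :: 'k and k f
    using cosum_hom[of "(*)" "(*)" UNIV "\<lambda>x. a * x" f \<delta> k] vector_space_mult[where 'k='k]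
    by (simp add: module_iff_vector_space linear_on_def algebra_simps module.subspace_UNIV)
  ultimately show ?thesis by (simp add: mult.assoc)
qed

lemma linear_form_extension:
  assumes "vs.independent S"
  shows "\<exists>g. linear_on (smul H) (*) UNIV g \<and> (\<forall>y\<in>S. g y = f y)"
proof -
  interpret vp: vector_space_pair "smul H" "(*) :: 'k \<Rightarrow> 'k \<Rightarrow> 'k"
    by (rule vector_space_pair.intro[OF vector_space_smul vector_space_mult])
  interpret l: Vector_Spaces.linear "smul H" "(*)" "vp.construct S f"
    by (rule vp.linear_construct[OF assms])
  show ?thesis
    by (rule exI[of _ "vp.construct S f"]) (simp add: linear_on_def l.add l.scale vp.construct_basis[OF assms])
qed

text \<open>
  The coalgebra is \<open>H\<close> itself, in a basis containing \<open>x\<close> if \<open>x \<noteq> 0\<close>. To have a total index type,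
  a grouplike index \<open>None\<close> is added and indices outside the basis are made primitive over it and
  mapped to 0; this also covers \<open>x = 0\<close>.
\<close>

lemma exists_point:
  assumes "cocommutative H" and "x \<in> carrier H"
  shows "\<exists>(\<delta> :: 'a option \<Rightarrow> _) \<epsilon> p i. based_coalgebra \<delta> \<epsilon> \<and> p \<in> points H \<delta> \<epsilon> \<and> p i = x"
proof -
  obtain S where S: "(if x = 0 then {} else {x}) \<subseteq> S" "S \<subseteq> carrier H" "vs.independent S" "carrier H \<subseteq> vs.span S"
  proof (rule vs.maximal_independent_subset_extend[of "if x = 0 then {} else {x}" "carrier H"])
    show "(if x = 0 then {} else {x}) \<subseteq> carrier H" "vs.independent (if x = 0 then {} else {x})"
      using assms vs.independent_empty by auto
  qed auto
  have "\<forall>y\<in>S. \<exists>l. set l \<subseteq> UNIV \<times> S \<times> S \<and> comul H y = (\<Sum>(c, y, z)\<leftarrow>l. tscale c (pure_tensor H y z))"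
    using comul_span_list S by blast
  then obtain l where l: "\<And>y. y \<in> S \<Longrightarrow> set (l y) \<subseteq> UNIV \<times> S \<times> S"
      "\<And>y. y \<in> S \<Longrightarrow> comul H y = (\<Sum>(c, y, z)\<leftarrow>l y. tscale c (pure_tensor H y z))"
    by metis
  define \<delta> where "\<delta> i = (case i of None \<Rightarrow> [(1, None, None)] | Some y \<Rightarrow>
     if y \<in> S then map (\<lambda>(c, y, z). (c, Some y, Some z)) (l y)
     else [(1, None, Some y), (1, Some y, None)])" for i
  define \<epsilon> where "\<epsilon> i = (case i of None \<Rightarrow> 1 | Some y \<Rightarrow> if y \<in> S then counit H y else 0)" for i
  define p where "p i = (case i of None \<Rightarrow> 1 | Some y \<Rightarrow> if y \<in> S then y else 0)" for i
  have c0: "comul H 0 = 0" "counit H 0 = 0"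
  proof -
    have "comul H (smul H 0 0) = tscale 0 (comul H 0)" "counit H (smul H 0 0) = 0 * counit H 0"
      using comul_linear carrier_ops(1) by (auto simp only: linear_on_def counit_smul)
    then show "comul H 0 = 0" "counit H 0 = 0"
      by (simp_all add: module.scale_zero_left[OF module_tscale])
  qed
  have t1: "tscale 1 t = t" "tscale c 0 = 0" for t :: "('k, 'a, 'a) tensor" and c
    by (auto simp: tscale_def fun_eq_iff)
  have [simp]: "\<delta> None = [(1, None, None)]" "\<epsilon> None = 1"
    "y \<notin> S \<Longrightarrow> \<delta> (Some y) = [(1, None, Some y), (1, Some y, None)]" "y \<notin> S \<Longrightarrow> \<epsilon> (Some y) = 0" for y
    by (simp_all add: \<delta>_def \<epsilon>_def)
  have point: "p \<in> points H \<delta> \<epsilon>"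
    unfolding points_def
  proof (intro CollectI allI conjI)
    fix i
    show "p i \<in> carrier H" using S by (auto simp: p_def split: option.split)
    show "counit H (p i) = \<epsilon> i" by (auto simp: p_def \<epsilon>_def c0 counit_one split: option.split)
    show "comul H (p i) = cosum tscale \<delta> i (\<lambda>j k. pure_tensor H (p j) (p k))"
    proof (cases "\<exists>y\<in>S. i = Some y")
      case True
      then obtain y where y: "y \<in> S" "i = Some y" by auto
      have "(\<Sum>(c, y, z)\<leftarrow>l y. tscale c (pure_tensor H y z)) =
        (\<Sum>(c, a, b)\<leftarrow>l y. tscale c (pure_tensor H (p (Some a)) (p (Some b))))"
        by (intro arg_cong[of _ _ sum_list] map_cong refl) (use l(1)[of y] y in \<open>auto simp: p_def\<close>)
      then show ?thesis using y
        by (simp add: cosum_def \<delta>_def comp_def case_prod_unfold) (simp add: p_def l(2) case_prod_unfold)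
    next
      case False
      then show ?thesis
        by (auto simp: p_def \<delta>_def cosum_def comul_one tens_0 c0 t1 split: option.split)
    qed
  qed
  \<comment> \<open>At an index from \<open>S\<close> the coproduct involves only indices from
    \<open>S\<close>. There an arbitrary function \<open>f\<close> on indices agrees with the linear
    form \<open>lext f\<close> after \<open>p\<close>, and the Hopf algebra axioms can be evaluated
    at linear forms.\<close>
  obtain lext :: "('a option \<Rightarrow> 'k) \<Rightarrow> 'a \<Rightarrow> 'k" where
    lext_lin: "\<And>f. linear_on (smul H) (*) UNIV (lext f)" and lext: "\<And>f y. y \<in> S \<Longrightarrow> lext f y = f (Some y)"
    using linear_form_extension[OF S(3), of "\<lambda>y. f (Some y)" for f] by metis
  have lext_p: "lext f (p (Some y)) = f (Some y)" if "y \<in> S" for f y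
    using lext that by (simp add: p_def)
  have cong: "cosum (*) \<delta> (Some y) F = cosum (*) \<delta> (Some y) G"
    if "y \<in> S" "\<And>a b. a \<in> S \<Longrightarrow> b \<in> S \<Longrightarrow> F (Some a) (Some b) = G (Some a) (Some b)"
    for y and F G :: "'a option \<Rightarrow> 'a option \<Rightarrow> 'k"
    unfolding cosum_def
    by (intro arg_cong[of _ _ sum_list] map_cong refl) (use that l(1)[of y] in \<open>auto simp: \<delta>_def\<close>)
  have None: "cosum (*) \<delta> None F = F None None"
    and Some: "y \<notin> S \<Longrightarrow> cosum (*) \<delta> (Some y) F = F None (Some y) + F (Some y) None"
    for y and F :: "'a option \<Rightarrow> 'a option \<Rightarrow> 'k"
    by (simp_all add: cosum_def)
  have "based_coalgebra \<delta> \<epsilon>"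
  proof
    fix i and f g h :: "'a option \<Rightarrow> 'k"
    show "cosum (*) \<delta> i (\<lambda>j k. cosum (*) \<delta> j (\<lambda>l m. f l * g m * h k)) =
       cosum (*) \<delta> i (\<lambda>j k. cosum (*) \<delta> k (\<lambda>l m. f j * g l * h m))"
    proof (cases "\<exists>y\<in>S. i = Some y")
      case True
      then obtain y where y: "y \<in> S" "i = Some y" by auto
      have "cosum (*) \<delta> i (\<lambda>j k. cosum (*) \<delta> j (\<lambda>l m. f l * g m * h k)) =
        cosum (*) \<delta> i (\<lambda>j k. cosum (*) \<delta> j (\<lambda>l m. lext f (p l) * lext g (p m) * lext h (p k)))"
        unfolding y by (intro cong y(1)) (simp_all add: lext_p)
      also have "\<dots> = cosum (*) \<delta> i (\<lambda>j k. cosum (*) \<delta> k (\<lambda>l m. lext f (p j) * lext g (p l) * lext h (p m)))"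
        by (intro coassoc_points[OF point] lext_lin)
      also have "\<dots> = cosum (*) \<delta> i (\<lambda>j k. cosum (*) \<delta> k (\<lambda>l m. f j * g l * h m))"
        unfolding y by (intro cong y(1)) (simp_all add: lext_p)
      finally show ?thesis .
    qed (cases i; auto simp: None Some algebra_simps)
    show "cosum (*) \<delta> i (\<lambda>j k. \<epsilon> j * f k) = f i"
    proof (cases "\<exists>y\<in>S. i = Some y")
      case True
      then obtain y where y: "y \<in> S" "i = Some y" by auto
      have b': "bilinear_form (smul H) (\<lambda>u v. smul H (counit H u) v)"
        by (simp add: bilinear_on_def linear_on_def vs.scale_left_distrib vs.scale_right_distrib mult.commute)
      have "cosum (*) \<delta> i (\<lambda>j k. \<epsilon> j * f k) = cosum (*) \<delta> i (\<lambda>j k. lext f (smul H (\<epsilon> j) (p k)))"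
        unfolding y using lext_lin[of f] by (intro cong y(1)) (simp_all add: lext_p linear_on_def)
      also have "\<dots> = lext f (cosum (smul H) \<delta> i (\<lambda>j k. smul H (\<epsilon> j) (p k)))"
        by (subst cosum_hom[OF module_smul _ lext_lin])
          (use vector_space_mult[where 'k='k] in \<open>auto simp: module_iff_vector_space\<close>)
      also have "cosum (smul H) \<delta> i (\<lambda>j k. smul H (\<epsilon> j) (p k)) = p i"
        using counit_left[of "p i"]
        unfolding sweedler_points[OF point vector_space_smul b']
        by (simp add: points_carrier[OF point] counit_points[OF point])
      finally show ?thesis using y by (simp add: lext_p)
    qed (cases i; auto simp: None Some)
    show "cosum (*) \<delta> i (\<lambda>j k. f j * g k) = cosum (*) \<delta> i (\<lambda>j k. f k * g j)"
    proof (cases "\<exists>y\<in>S. i = Some y")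
      case True
      then obtain y where y: "y \<in> S" "i = Some y" by auto
      define \<beta> where "\<beta> = (\<lambda>u v. lext f u * lext g v)"
      have \<beta>: "bilinear_on (smul H) (smul H) (*) UNIV UNIV \<beta>"
        using lext_lin by (auto simp: bilinear_on_def linear_on_def \<beta>_def algebra_simps)
      have b: "bilinear_form tscale (\<lambda>u v. pure_tensor H v u)"
        by (simp add: bilinear_simps)
      have "cosum tscale \<delta> i (\<lambda>j k. pure_tensor H (p k) (p j)) = comul H (p i)"
        using assms(1) sweedler_points[OF point vector_space_tscale b, of i] points_carrier[OF point, of i]
        by (simp add: cocommutative_def)
      also have "\<dots> = cosum tscale \<delta> i (\<lambda>j k. pure_tensor H (p j) (p k))"
        by (rule comul_points[OF point])
      finally have "cosum tscale \<delta> i (\<lambda>j k. pure_tensor H (p k) (p j)) \<beta> = cosum tscale \<delta> i (\<lambda>j k. pure_tensor H (p j) (p k)) \<beta>"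
        by simp
      then have eq: "cosum (*) \<delta> i (\<lambda>j k. lext f (p k) * lext g (p j)) = cosum (*) \<delta> i (\<lambda>j k. lext f (p j) * lext g (p k))"
        by (simp add: cosum_tensor_apply tens_def \<beta>) (simp add: \<beta>_def)
      have "cosum (*) \<delta> i (\<lambda>j k. f k * g j) = cosum (*) \<delta> i (\<lambda>j k. lext f (p k) * lext g (p j))"
        unfolding y by (intro cong y(1)) (simp_all add: lext_p)
      also note eq
      also have "cosum (*) \<delta> i (\<lambda>j k. lext f (p j) * lext g (p k)) = cosum (*) \<delta> i (\<lambda>j k. f j * g k)"
        unfolding y by (intro cong y(1)) (simp_all add: lext_p)
      finally show ?thesis by simp
    qed (cases i; auto simp: None Some algebra_simps)
  qed
  moreover have "p (Some x) = x"
    using S(1) by (auto simp: p_def split: if_splits)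
  ultimately show ?thesis using point by blast
qed

end

section \<open>The convolution group\<close>

definition conv ::
  "('k::field, 'a::ring_1) hopf \<Rightarrow> ('i \<Rightarrow> ('k \<times> 'i \<times> 'i) list) \<Rightarrow> ('i \<Rightarrow> 'a) \<Rightarrow> ('i \<Rightarrow> 'a) \<Rightarrow> 'i \<Rightarrow> 'a"
  where "conv H \<delta> f g i = cosum (smul H) \<delta> i (\<lambda>j k. f j * g k)"

definition conv_one :: "('k::field, 'a::ring_1) hopf \<Rightarrow> ('i \<Rightarrow> 'k) \<Rightarrow> 'i \<Rightarrow> 'a"
  where "conv_one H \<epsilon> i = smul H (\<epsilon> i) 1"

context hopf_algebra
begin

lemma cosum_mult_left: "cosum (smul H) \<delta> i F * x = cosum (smul H) \<delta> i (\<lambda>j k. F j k * x)"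
  and cosum_mult_right: "x * cosum (smul H) \<delta> i F = cosum (smul H) \<delta> i (\<lambda>j k. x * F j k)"
proof -
  have "(\<Sum>(c, j, k)\<leftarrow>xs. smul H c (F j k)) * x = (\<Sum>(c, j, k)\<leftarrow>xs. smul H c (F j k * x))"
    and "x * (\<Sum>(c, j, k)\<leftarrow>xs. smul H c (F j k)) = (\<Sum>(c, j, k)\<leftarrow>xs. smul H c (x * F j k))" for xs
    by (induction xs) (auto simp: distrib_left distrib_right smul_mult_left smul_mult_right)
  then show "cosum (smul H) \<delta> i F * x = cosum (smul H) \<delta> i (\<lambda>j k. F j k * x)"
    "x * cosum (smul H) \<delta> i F = cosum (smul H) \<delta> i (\<lambda>j k. x * F j k)"
    by (simp_all add: cosum_def)
qed

lemma cosum_carrier: "(\<And>j k. F j k \<in> carrier H) \<Longrightarrow> cosum (smul H) \<delta> i F \<in> carrier H"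
  by (rule cosum_mem[OF module_smul carrier_subspace])

lemma sweedler_pure_tensor: "x \<in> carrier H \<Longrightarrow> sweedler H x (pure_tensor H) = comul H x"
proof -
  assume "x \<in> carrier H"
  then obtain ps where ps: "comul H x = tensor_sum (smul H) (smul H) ps" "set ps \<subseteq> carrier H \<times> carrier H"
    using comul_list by metis
  have "bilinear_form tscale (pure_tensor H)" by (simp add: bilinear_simps)
  then show ?thesis
    using sweedler_tensor_sum'[OF vector_space_tscale _ ps] by (simp add: ps(1) tensor_sum_def)
qed

text \<open>The second form leaves the sum over \<open>x\<close> innermost, as needed where the left
  factor of the product acts first, for instance in the right adjoint action.\<close>

lemma sweedler_mult:
  assumes s: "vector_space s" and F: "bilinear_form s F" and x: "x \<in> carrier H" and y: "y \<in> carrier H"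
  shows "sweedler H (x * y) F = sweedler H x (\<lambda>x\<^sub>1 x\<^sub>2. sweedler H y (\<lambda>y\<^sub>1 y\<^sub>2. F (x\<^sub>1 * y\<^sub>1) (x\<^sub>2 * y\<^sub>2)))"
    (is "_ = ?L")
  and "sweedler H (x * y) F = sweedler H y (\<lambda>y\<^sub>1 y\<^sub>2. sweedler H x (\<lambda>x\<^sub>1 x\<^sub>2. F (x\<^sub>1 * y\<^sub>1) (x\<^sub>2 * y\<^sub>2)))"
    (is "_ = ?R")
proof -
  interpret s: vector_space s by fact
  obtain ps where ps: "comul H x = tensor_sum (smul H) (smul H) ps" "set ps \<subseteq> carrier H \<times> carrier H"
    using x comul_list by metis
  obtain qs where qs: "comul H y = tensor_sum (smul H) (smul H) qs" "set qs \<subseteq> carrier H \<times> carrier H"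
    using y comul_list by metis
  \<comment> \<open>The target is generic so that this applies both to \<open>F\<close> and to
    \<open>pure_tensor H\<close>; the latter yields a list representing
    \<open>comul H (x * y)\<close>.\<close>
  have *: "sweedler H x (\<lambda>x\<^sub>1 x\<^sub>2. sweedler H y (\<lambda>y\<^sub>1 y\<^sub>2. G (x\<^sub>1 * y\<^sub>1) (x\<^sub>2 * y\<^sub>2))) =
      (\<Sum>(x\<^sub>1, x\<^sub>2)\<leftarrow>ps. \<Sum>(y\<^sub>1, y\<^sub>2)\<leftarrow>qs. G (x\<^sub>1 * y\<^sub>1) (x\<^sub>2 * y\<^sub>2))"
    "sweedler H y (\<lambda>y\<^sub>1 y\<^sub>2. sweedler H x (\<lambda>x\<^sub>1 x\<^sub>2. G (x\<^sub>1 * y\<^sub>1) (x\<^sub>2 * y\<^sub>2))) =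
      (\<Sum>(y\<^sub>1, y\<^sub>2)\<leftarrow>qs. \<Sum>(x\<^sub>1, x\<^sub>2)\<leftarrow>ps. G (x\<^sub>1 * y\<^sub>1) (x\<^sub>2 * y\<^sub>2))"
    if t: "vector_space t" and G: "bilinear_form t G"
    for t :: "'k \<Rightarrow> 'w::ab_group_add \<Rightarrow> 'w" and G
  proof -
    interpret t: vector_space t by fact
    have 1: "bilinear_form t (\<lambda>y\<^sub>1 y\<^sub>2. G (x\<^sub>1 * y\<^sub>1) (x\<^sub>2 * y\<^sub>2))"
      "bilinear_form t (\<lambda>y\<^sub>1 y\<^sub>2. G (y\<^sub>1 * x\<^sub>1) (y\<^sub>2 * x\<^sub>2))"
      if "x\<^sub>1 \<in> carrier H" "x\<^sub>2 \<in> carrier H" for x\<^sub>1 x\<^sub>2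
      using G that by (simp_all add: bilinear_simps)
    have 2: "bilinear_form t (\<lambda>x\<^sub>1 x\<^sub>2. sweedler H y (\<lambda>y\<^sub>1 y\<^sub>2. G (x\<^sub>1 * y\<^sub>1) (x\<^sub>2 * y\<^sub>2)))"
      unfolding bilinear_on_def using G
      by (intro conjI ballI linear_on_sweedler_param[OF t vector_space_smul carrier_subspace y]) (simp_all add: bilinear_simps)
    have 3: "bilinear_form t (\<lambda>y\<^sub>1 y\<^sub>2. sweedler H x (\<lambda>x\<^sub>1 x\<^sub>2. G (x\<^sub>1 * y\<^sub>1) (x\<^sub>2 * y\<^sub>2)))"
      unfolding bilinear_on_def using G
      by (intro conjI ballI linear_on_sweedler_param[OF t vector_space_smul carrier_subspace x]) (simp_all add: bilinear_simps)
    show "sweedler H x (\<lambda>x\<^sub>1 x\<^sub>2. sweedler H y (\<lambda>y\<^sub>1 y\<^sub>2. G (x\<^sub>1 * y\<^sub>1) (x\<^sub>2 * y\<^sub>2))) =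
      (\<Sum>(x\<^sub>1, x\<^sub>2)\<leftarrow>ps. \<Sum>(y\<^sub>1, y\<^sub>2)\<leftarrow>qs. G (x\<^sub>1 * y\<^sub>1) (x\<^sub>2 * y\<^sub>2))"
      unfolding sweedler_tensor_sum'[OF t 2 ps]
      by (intro arg_cong[of _ _ sum_list] map_cong refl)
        (use ps(2) in \<open>auto intro!: sweedler_tensor_sum'[OF t 1(1) qs]\<close>)
    show "sweedler H y (\<lambda>y\<^sub>1 y\<^sub>2. sweedler H x (\<lambda>x\<^sub>1 x\<^sub>2. G (x\<^sub>1 * y\<^sub>1) (x\<^sub>2 * y\<^sub>2))) =
      (\<Sum>(y\<^sub>1, y\<^sub>2)\<leftarrow>qs. \<Sum>(x\<^sub>1, x\<^sub>2)\<leftarrow>ps. G (x\<^sub>1 * y\<^sub>1) (x\<^sub>2 * y\<^sub>2))"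
      unfolding sweedler_tensor_sum'[OF t 3 qs]
      by (intro arg_cong[of _ _ sum_list] map_cong refl)
        (use qs(2) in \<open>auto intro!: sweedler_tensor_sum'[OF t 1(2) ps]\<close>)
  qed
  define rs where "rs = [(x\<^sub>1 * y\<^sub>1, x\<^sub>2 * y\<^sub>2). (x\<^sub>1, x\<^sub>2) \<leftarrow> ps, (y\<^sub>1, y\<^sub>2) \<leftarrow> qs]"
  have sum_rs: "(\<Sum>(a, b)\<leftarrow>[(x\<^sub>1 * y\<^sub>1, x\<^sub>2 * y\<^sub>2). (x\<^sub>1, x\<^sub>2) \<leftarrow> ps, (y\<^sub>1, y\<^sub>2) \<leftarrow> qs]. G a b) =
      (\<Sum>(x\<^sub>1, x\<^sub>2)\<leftarrow>ps. \<Sum>(y\<^sub>1, y\<^sub>2)\<leftarrow>qs. G (x\<^sub>1 * y\<^sub>1) (x\<^sub>2 * y\<^sub>2))"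
    for G :: "'a \<Rightarrow> 'a \<Rightarrow> 'w::ab_group_add" and ps
    by (induction ps) (auto simp: comp_def case_prod_unfold)
  have b: "bilinear_form tscale (pure_tensor H)" by (simp add: bilinear_simps)
  have rs: "comul H (x * y) = tensor_sum (smul H) (smul H) rs"
    using comul_mult[OF x y] unfolding *(1)[OF vector_space_tscale b]
    by (simp add: tensor_sum_def rs_def sum_rs[of "pure_tensor H"])
  have rs': "set rs \<subseteq> carrier H \<times> carrier H"
    using ps(2) qs(2) by (fastforce simp: rs_def)
  have l: "sweedler H (x * y) F = (\<Sum>(x\<^sub>1, x\<^sub>2)\<leftarrow>ps. \<Sum>(y\<^sub>1, y\<^sub>2)\<leftarrow>qs. F (x\<^sub>1 * y\<^sub>1) (x\<^sub>2 * y\<^sub>2))"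
    unfolding sweedler_tensor_sum'[OF s F rs rs'] by (simp add: rs_def sum_rs)
  show "sweedler H (x * y) F = ?L"
    unfolding *(1)[OF s F] by (rule l)
  have "(\<Sum>(x\<^sub>1, x\<^sub>2)\<leftarrow>ps. \<Sum>(y\<^sub>1, y\<^sub>2)\<leftarrow>qs. F (x\<^sub>1 * y\<^sub>1) (x\<^sub>2 * y\<^sub>2)) =
    (\<Sum>(y\<^sub>1, y\<^sub>2)\<leftarrow>qs. \<Sum>(x\<^sub>1, x\<^sub>2)\<leftarrow>ps. F (x\<^sub>1 * y\<^sub>1) (x\<^sub>2 * y\<^sub>2))" for ps
    by (induction ps) (auto simp: case_prod_unfold sum_list_addf)
  then show "sweedler H (x * y) F = ?R"
    unfolding *(2)[OF s F] using l by simp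
qed

end

locale hopf_points = hopf_algebra H + based_coalgebra \<delta> \<epsilon>
  for H :: "('k::field, 'a::ring_1) hopf" and \<delta> :: "'i \<Rightarrow> ('k \<times> 'i \<times> 'i) list" and \<epsilon>
begin

abbreviation "P \<equiv> points H \<delta> \<epsilon>"
abbreviation cmul (infixl "\<star>" 70) where "f \<star> g \<equiv> conv H \<delta> f g"

lemma conv_assoc: "f \<star> g \<star> h = f \<star> (g \<star> h)"
  by (simp add: fun_eq_iff conv_def cosum_mult_left cosum_mult_right mult.assoc coassoc[OF module_smul])

lemma conv_one_left: "conv_one H \<epsilon> \<star> f = f"
  by (simp add: fun_eq_iff conv_def conv_one_def smul_mult_left counit[OF module_smul])

lemma conv_one_right: "f \<star> conv_one H \<epsilon> = f"
  by (simp add: fun_eq_iff conv_def conv_one_def smul_mult_right counit'[OF module_smul])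

lemma module_mult: "module ((*) :: 'k \<Rightarrow> 'k \<Rightarrow> 'k)"
  using vector_space_mult module_iff_vector_space by blast

text \<open>Cocommutativity of the source enters here: \<open>interchange\<close> regroups the
  coproducts of the two factors into the coproduct of their convolution product.\<close>

lemma conv_closed:
  assumes f: "f \<in> P" and g: "g \<in> P"
  shows "f \<star> g \<in> P"
  unfolding points_def
proof (intro CollectI allI conjI)
  fix i
  note [simp] = points_carrier[OF f] points_carrier[OF g]
  show "(f \<star> g) i \<in> carrier H" by (simp add: conv_def cosum_carrier)
  have "counit H ((f \<star> g) i) = cosum (*) \<delta> i (\<lambda>j k. \<epsilon> j * \<epsilon> k)"
    unfolding conv_def
    by (subst cosum_hom[OF module_smul module_mult counit_linear carrier_subspace])
      (simp_all add: counit_mult counit_points[OF f] counit_points[OF g])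
  then show "counit H ((f \<star> g) i) = \<epsilon> i" by (simp add: counit_coeff)
  have b': "bilinear_form tscale (\<lambda>y\<^sub>1 y\<^sub>2. pure_tensor H (x\<^sub>1 * y\<^sub>1) (x\<^sub>2 * y\<^sub>2))" for x\<^sub>1 x\<^sub>2
    by (simp add: bilinear_simps)
  have b'': "bilinear_form tscale (\<lambda>x\<^sub>1 x\<^sub>2. sweedler H (g k) (\<lambda>y\<^sub>1 y\<^sub>2. pure_tensor H (x\<^sub>1 * y\<^sub>1) (x\<^sub>2 * y\<^sub>2)))" for k
    unfolding bilinear_on_def
    by (intro conjI ballI linear_on_sweedler_param[OF vector_space_tscale vector_space_smul carrier_subspace])
      (simp_all add: bilinear_simps)
  have "comul H ((f \<star> g) i) = cosum tscale \<delta> i (\<lambda>j k. comul H (f j * g k))"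
    unfolding conv_def
    by (subst cosum_hom[OF module_smul module_tscale comul_linear carrier_subspace]) simp_all
  also have "\<dots> = cosum tscale \<delta> i (\<lambda>j k. cosum tscale \<delta> j (\<lambda>a b. cosum tscale \<delta> k (\<lambda>c d.
      pure_tensor H (f a * g c) (f b * g d))))"
    by (simp add: comul_mult sweedler_points[OF f vector_space_tscale b''])
      (simp add: sweedler_points[OF g vector_space_tscale b'])
  also have "\<dots> = cosum tscale \<delta> i (\<lambda>j k. cosum tscale \<delta> j (\<lambda>a b. cosum tscale \<delta> k (\<lambda>c d.
      pure_tensor H (f a * g b) (f c * g d))))"
    by (rule interchange[OF module_tscale])
  also have "\<dots> = cosum tscale \<delta> i (\<lambda>j k. pure_tensor H ((f \<star> g) j) ((f \<star> g) k))"
  proof -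
    have l: "pure_tensor H (cosum (smul H) \<delta> j F) x = cosum tscale \<delta> j (\<lambda>a b. pure_tensor H (F a b) x)" for j F x
      by (rule cosum_hom[OF module_smul module_tscale, of UNIV]; simp add: linear_on_def tens_add_left tens_smul_left)
    have r: "pure_tensor H x (cosum (smul H) \<delta> j F) = cosum tscale \<delta> j (\<lambda>a b. pure_tensor H x (F a b))" for j F x
      by (rule cosum_hom[OF module_smul module_tscale, of UNIV]; simp add: linear_on_def tens_add_right tens_smul_right)
    show ?thesis unfolding conv_def l unfolding r ..
  qed
  finally show "comul H ((f \<star> g) i) = \<dots>" .
qed

lemma conv_one_closed: "conv_one H \<epsilon> \<in> P"
  unfolding points_def
proof (intro CollectI allI conjI)
  fix i
  have "comul H (smul H (\<epsilon> i) 1) = tscale (\<epsilon> i) (pure_tensor H 1 1)"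
    using comul_linear by (simp add: linear_on_def comul_one)
  then show "comul H (conv_one H \<epsilon> i) = cosum tscale \<delta> i (\<lambda>j k. pure_tensor H (conv_one H \<epsilon> j) (conv_one H \<epsilon> k))"
    using counit'[OF module_tscale, of i "\<lambda>j. tscale (\<epsilon> j) (pure_tensor H 1 1)"]
    by (simp add: conv_one_def tens_smul_left tens_smul_right)
qed (simp_all add: conv_one_def counit_one)

lemma antipode_conv_left:
  assumes f: "f \<in> P"
  shows "(antipode H \<circ> f) \<star> f = conv_one H \<epsilon>"
proof
  fix i
  have b: "bilinear_form (smul H) (\<lambda>x y. antipode H x * y)" by (simp add: bilinear_simps)
  show "((antipode H \<circ> f) \<star> f) i = conv_one H \<epsilon> i"
    using antipode_left[OF points_carrier[OF f, of i]] unfolding sweedler_points[OF f vector_space_smul b]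
    by (simp add: conv_def conv_one_def counit_points[OF f])
qed

lemma antipode_conv_right:
  assumes f: "f \<in> P"
  shows "f \<star> (antipode H \<circ> f) = conv_one H \<epsilon>"
proof
  fix i
  have b: "bilinear_form (smul H) (\<lambda>x y. x * antipode H y)" by (simp add: bilinear_simps)
  show "(f \<star> (antipode H \<circ> f)) i = conv_one H \<epsilon> i"
    using antipode_right[OF points_carrier[OF f, of i]] unfolding sweedler_points[OF f vector_space_smul b]
    by (simp add: conv_def conv_one_def counit_points[OF f])
qed

text \<open>
  With \<open>x = f i\<close>, evaluate \<open>\<Delta>(S x\<^sub>1) (x\<^sub>2 \<otimes> x\<^sub>3) (S x\<^sub>4 \<otimes> S x\<^sub>5)\<close> in two ways: by cocommutativity the last two
  factors cancel, and by multiplicativity of \<open>\<Delta>\<close> the first two do. \<open>N\<close> and \<open>Q\<close> express products with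
  \<open>\<Delta>(y)\<close> without a ring structure on \<open>H \<otimes> H\<close>.
\<close>

lemma antipode_points:
  assumes f: "f \<in> P"
  shows "antipode H \<circ> f \<in> P"
  unfolding points_def
proof (intro CollectI allI conjI)
  fix i
  note [simp] = points_carrier[OF f]
  let ?T = "cosum tscale \<delta>"
  show "(antipode H \<circ> f) i \<in> carrier H" by simp
  \<comment> \<open>The counit is applied to a convolution product that equals the neutral element;
    the sum on the right collapses to \<open>counit H (antipode H (f i))\<close>.\<close>
  have "counit H (((antipode H \<circ> f) \<star> f) i) = cosum (*) \<delta> i (\<lambda>j k. counit H (antipode H (f j)) * \<epsilon> k)"
    unfolding conv_def
    by (subst cosum_hom[OF module_smul module_mult counit_linear carrier_subspace])
      (simp_all add: counit_mult counit_points[OF f])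
  then show "counit H ((antipode H \<circ> f) i) = \<epsilon> i"
    using counit'[OF module_mult, of i "\<lambda>j. counit H (antipode H (f j))"]
    by (simp add: antipode_conv_left[OF f] conv_one_def counit_one mult.commute)
  define N where "N j u v = sweedler H (antipode H (f j)) (\<lambda>y y'. pure_tensor H (y * u) (y' * v))" for j u v
  have N: "bilinear_form tscale (N j)" for j
    unfolding N_def bilinear_on_def
    by (intro conjI ballI linear_on_sweedler_param[OF vector_space_tscale vector_space_smul carrier_subspace])
      (simp_all add: bilinear_simps)
  have Nl: "N j (cosum (smul H) \<delta> l F) v = ?T l (\<lambda>a b. N j (F a b) v)"
    if "\<And>a b. F a b \<in> carrier H" "v \<in> carrier H" for j l F v
    by (rule cosum_hom[OF module_smul module_tscale _ carrier_subspace that(1)])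
      (use N that(2) in \<open>simp add: bilinear_on_def\<close>)
  have Nr: "N j v (cosum (smul H) \<delta> l F) = ?T l (\<lambda>a b. N j v (F a b))"
    if "\<And>a b. F a b \<in> carrier H" "v \<in> carrier H" for j l F v
    by (rule cosum_hom[OF module_smul module_tscale _ carrier_subspace that(1)])
      (use N that(2) in \<open>simp add: bilinear_on_def\<close>)
  have N1: "N j (smul H c 1) (smul H d 1) = tscale d (tscale c (comul H (antipode H (f j))))" for j c d
    using N[of j] sweedler_pure_tensor[of "antipode H (f j)"]
    by (simp add: bilinear_on_def linear_on_def) (simp add: N_def)
  define A where "A = ?T i (\<lambda>j k. ?T k (\<lambda>l m. ?T l (\<lambda>a b. ?T m (\<lambda>c d.
     N j (f a * antipode H (f c)) (f b * antipode H (f d))))))"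
  have right: "cosum (smul H) \<delta> l (\<lambda>a b. f a * antipode H (f b)) = smul H (\<epsilon> l) 1" for l
    using fun_cong[OF antipode_conv_right[OF f], of l] by (simp add: conv_def conv_one_def)
  have left: "cosum (smul H) \<delta> l (\<lambda>a b. antipode H (f a) * f b) = smul H (\<epsilon> l) 1" for l
    using fun_cong[OF antipode_conv_left[OF f], of l] by (simp add: conv_def conv_one_def)
  have "A = ?T i (\<lambda>j k. ?T k (\<lambda>l m. ?T l (\<lambda>a b. ?T m (\<lambda>c d.
     N j (f a * antipode H (f b)) (f c * antipode H (f d))))))"
    unfolding A_def by (subst interchange[OF module_tscale]) (rule refl)
  also have "\<dots> = ?T i (\<lambda>j k. ?T k (\<lambda>l m. N j (smul H (\<epsilon> l) 1) (smul H (\<epsilon> m) 1)))"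
    by (simp flip: right add: Nl cosum_carrier) (simp add: Nr)
  also have "\<dots> = comul H (antipode H (f i))"
    by (simp add: N1 counit[OF module_tscale] counit'[OF module_tscale])
  finally have A1: "A = comul H (antipode H (f i))" .
  define Q where "Q u v x = sweedler H x (\<lambda>z z'. pure_tensor H (z * u) (z' * v))" for u v x
  have Q: "?T l (\<lambda>a b. N j (f a * u) (f b * v)) = Q u v (antipode H (f j) * f l)"
    if "u \<in> carrier H" "v \<in> carrier H" for u v j l
  proof -
    have b: "bilinear_form tscale (\<lambda>z z'. pure_tensor H (z * u) (z' * v))" by (simp add: bilinear_simps)
    have b': "bilinear_form tscale (\<lambda>z z'. N j (z * u) (z' * v))"
      using N[of j] that by (simp add: bilinear_simps)
    have "Q u v (antipode H (f j) * f l) = sweedler H (f l) (\<lambda>z z'. N j (z * u) (z' * v))"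
      unfolding Q_def N_def by (subst sweedler_mult(2)[OF vector_space_tscale b]) (simp_all add: mult.assoc)
    then show ?thesis by (simp add: sweedler_points[OF f vector_space_tscale b'])
  qed
  have Qlin: "linear_on (smul H) tscale (carrier H) (Q u v)" for u v
    unfolding Q_def by (rule linear_on_sweedler[OF vector_space_tscale]) (simp add: bilinear_simps)
  have Q1: "Q u v (smul H c 1) = tscale c (pure_tensor H u v)" if "u \<in> carrier H" "v \<in> carrier H" for u v c
  proof -
    have b: "bilinear_form tscale (\<lambda>z z'. pure_tensor H (z * u) (z' * v))" by (simp add: bilinear_simps)
    have "comul H 1 = tensor_sum (smul H) (smul H) [(1, 1)]" by (simp add: comul_one tensor_sum_def)
    then have "Q u v 1 = pure_tensor H u v"
      unfolding Q_def by (subst sweedler_tensor_sum'[OF vector_space_tscale b]) auto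
    then show ?thesis using Qlin[of u v] by (simp add: linear_on_def)
  qed
  have "A = ?T i (\<lambda>j k. ?T k (\<lambda>l m. ?T m (\<lambda>c d. Q (antipode H (f c)) (antipode H (f d)) (antipode H (f j) * f l))))"
    unfolding A_def by (subst cosum_swap[OF module_tscale]) (simp add: Q)
  also have "\<dots> = ?T i (\<lambda>k m. ?T k (\<lambda>j l. ?T m (\<lambda>c d. Q (antipode H (f c)) (antipode H (f d)) (antipode H (f j) * f l))))"
    by (rule coassoc[OF module_tscale, symmetric])
  also have "\<dots> = ?T i (\<lambda>k m. ?T m (\<lambda>c d. Q (antipode H (f c)) (antipode H (f d)) (cosum (smul H) \<delta> k (\<lambda>j l. antipode H (f j) * f l))))"
    by (subst cosum_swap[OF module_tscale])
      (subst cosum_hom[OF module_smul module_tscale Qlin carrier_subspace], simp_all)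
  also have "\<dots> = ?T i (\<lambda>k m. tscale (\<epsilon> k) (?T m (\<lambda>c d. pure_tensor H (antipode H (f c)) (antipode H (f d)))))"
    unfolding left
    by (simp add: Q1 cosum_def scale_sum_list[OF module_tscale] case_prod_unfold module.scale_left_commute[OF module_tscale])
  also have "\<dots> = ?T i (\<lambda>c d. pure_tensor H (antipode H (f c)) (antipode H (f d)))"
    by (rule counit[OF module_tscale])
  finally show "comul H ((antipode H \<circ> f) i) = ?T i (\<lambda>j k. pure_tensor H ((antipode H \<circ> f) j) ((antipode H \<circ> f) k))"
    using A1 by simp
qed

lemma coalgebra_map_points:
  assumes g: "coalgebra_map H H g" and f: "f \<in> P"
  shows "g \<circ> f \<in> P"
  unfolding points_def
proof (intro CollectI allI conjI)
  fix i
  note [simp] = points_carrier[OF f]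
  have l: "linear_on (smul H) (smul H) (carrier H) g" using g by (simp add: coalgebra_map_def)
  have b: "bilinear_form tscale (\<lambda>x y. pure_tensor H (g x) (g y))"
    using l by (simp add: bilinear_simps)
  show "(g \<circ> f) i \<in> carrier H" using g by (auto simp: coalgebra_map_def)
  show "counit H ((g \<circ> f) i) = \<epsilon> i" using g counit_points[OF f] by (simp add: coalgebra_map_def)
  show "comul H ((g \<circ> f) i) = cosum tscale \<delta> i (\<lambda>j k. pure_tensor H ((g \<circ> f) j) ((g \<circ> f) k))"
    using g sweedler_points[OF f vector_space_tscale b] by (simp add: coalgebra_map_def)
qed

end

section \<open>Rota-Baxter operators and tensor products of coalgebras\<close>

text \<open>Pullback of points along a coalgebra map is of this kind. It moves elements between the
  convolution groups of different coalgebras together with all derived operations.\<close>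

locale rota_baxter_group_hom =
  dom: rota_baxter_group G mult one inv B + cod: rota_baxter_group G' mult' one' inv' B'
  for G :: "'g set" and mult one inv B and G' :: "'h set" and mult' one' inv' B' +
  fixes \<phi> :: "'g \<Rightarrow> 'h"
  assumes hom_closed [simp]: "x \<in> G \<Longrightarrow> \<phi> x \<in> G'"
    and hom_mult [simp]: "x \<in> G \<Longrightarrow> y \<in> G \<Longrightarrow> \<phi> (mult x y) = mult' (\<phi> x) (\<phi> y)"
    and hom_inv [simp]: "x \<in> G \<Longrightarrow> \<phi> (inv x) = inv' (\<phi> x)"
    and hom_B [simp]: "x \<in> G \<Longrightarrow> \<phi> (B x) = B' (\<phi> x)"
begin

lemma hom_T [simp]: "x \<in> G \<Longrightarrow> \<phi> (dom.T x) = cod.T (\<phi> x)"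
  by (simp add: dom.T_def cod.T_def)

lemma hom_desc_mult [simp]: "x \<in> G \<Longrightarrow> y \<in> G \<Longrightarrow> \<phi> (dom.desc_mult x y) = cod.desc_mult (\<phi> x) (\<phi> y)"
  by (simp add: dom.desc_mult_def cod.desc_mult_def)

lemma hom_desc_inv [simp]: "x \<in> G \<Longrightarrow> \<phi> (dom.desc_inv x) = cod.desc_inv (\<phi> x)"
  by (simp add: dom.desc_inv_def cod.desc_inv_def)

lemma hom_tilde_mult [simp]: "x \<in> G \<Longrightarrow> y \<in> G \<Longrightarrow> \<phi> (dom.tilde_mult x y) = cod.tilde_mult (\<phi> x) (\<phi> y)"
  by (simp add: dom.tilde_mult_def cod.tilde_mult_def)

lemma hom_lam [simp]: "x \<in> G \<Longrightarrow> y \<in> G \<Longrightarrow> \<phi> (dom.lam x y) = cod.lam (\<phi> x) (\<phi> y)"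
  by (simp add: dom.lam_def cod.lam_def)

lemma hom_rho [simp]: "x \<in> G \<Longrightarrow> y \<in> G \<Longrightarrow> \<phi> (dom.rho x y) = cod.rho (\<phi> x) (\<phi> y)"
  by (simp add: dom.rho_def cod.rho_def)

end

section \<open>Rota-Baxter operators on Hopf algebras as operators on convolution groups\<close>

locale rota_baxter_hopf =
  fixes H :: "('k::field, 'a::ring_1) hopf" and B :: "'a \<Rightarrow> 'a"
  assumes rota_baxter: "rota_baxter_hopf_algebra H B"
begin

sublocale hopf_algebra H
  using rota_baxter by (simp add: rota_baxter_hopf_algebra_def)

lemma cocommutative_H: "cocommutative H"
  and coalgebra_map_B: "coalgebra_map H H B"
  and B_mult_B: "x \<in> carrier H \<Longrightarrow> y \<in> carrier H \<Longrightarrow>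
    B x * B y = B (sweedler3 H x (\<lambda>x1 x2 x3. B x1 * y * antipode H (B x2) * x3))"
  using rota_baxter by (simp_all add: rota_baxter_hopf_algebra_def)

lemma linear_on_B: "linear_on (smul H) (smul H) (carrier H) B"
  using coalgebra_map_B by (simp add: coalgebra_map_def)

lemma B_closed [simp]: "x \<in> carrier H \<Longrightarrow> B x \<in> carrier H"
  using coalgebra_map_B by (auto simp: coalgebra_map_def)

lemma B_add [simp]: "x \<in> carrier H \<Longrightarrow> y \<in> carrier H \<Longrightarrow> B (x + y) = B x + B y"
  and B_smul [simp]: "x \<in> carrier H \<Longrightarrow> B (smul H c x) = smul H c (B x)"
  using linear_on_B by (simp_all add: linear_on_def)

abbreviation T where "T \<equiv> rb_tilde H B"

lemma bilinear_T: "bilinear_form (smul H) (\<lambda>x\<^sub>1 x\<^sub>2. x\<^sub>1 * B (antipode H x\<^sub>2))"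
  by (simp add: bilinear_simps)

lemma linear_on_T: "linear_on (smul H) (smul H) (carrier H) T"
  unfolding rb_tilde_def by (rule linear_on_sweedler[OF vector_space_smul bilinear_T])

lemma T_add [simp]: "x \<in> carrier H \<Longrightarrow> y \<in> carrier H \<Longrightarrow> T (x + y) = T x + T y"
  and T_smul [simp]: "x \<in> carrier H \<Longrightarrow> T (smul H c x) = smul H c (T x)"
  using linear_on_T by (simp_all add: linear_on_def)

end

locale rota_baxter_points = rota_baxter_hopf H B + hopf_points H \<delta> \<epsilon>
  for H :: "('k::field, 'a::ring_1) hopf" and B and \<delta> :: "'i \<Rightarrow> ('k \<times> 'i \<times> 'i) list" and \<epsilon>
begin

lemma B_points: "f \<in> P \<Longrightarrow> B \<circ> f \<in> P"
  by (rule coalgebra_map_points[OF coalgebra_map_B])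

lemma B_conv_B:
  assumes f: "f \<in> P" and g: "g \<in> P"
  shows "(B \<circ> f) \<star> (B \<circ> g) = B \<circ> ((B \<circ> f) \<star> g \<star> (antipode H \<circ> (B \<circ> f)) \<star> f)"
proof
  fix i
  note [simp] = points_carrier[OF f] points_carrier[OF g]
  let ?D = "cosum (smul H) \<delta>"
  let ?F = "\<lambda>x\<^sub>1 y x\<^sub>2 x\<^sub>3. B x\<^sub>1 * y * antipode H (B x\<^sub>2) * x\<^sub>3"
  have b: "bilinear_form (smul H) (\<lambda>x\<^sub>1 x\<^sub>2. ?F x\<^sub>1 y x\<^sub>2 x\<^sub>3)" for y x\<^sub>3
    by (simp add: bilinear_simps)
  have b': "bilinear_form (smul H) (\<lambda>u x\<^sub>3. sweedler H u (\<lambda>x\<^sub>1 x\<^sub>2. ?F x\<^sub>1 y x\<^sub>2 x\<^sub>3))" for y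
    by (intro bilinear_sweedler_left[OF vector_space_smul b]) (simp add: bilinear_simps)
  have sw: "sweedler3 H (f j) (\<lambda>x\<^sub>1 x\<^sub>2 x\<^sub>3. ?F x\<^sub>1 y x\<^sub>2 x\<^sub>3) =
      ?D j (\<lambda>l m. ?D l (\<lambda>a b. ?F (f a) y (f b) (f m)))" for j y
    unfolding sweedler3_def sweedler_points[OF f vector_space_smul b']
    by (simp add: sweedler_points[OF f vector_space_smul b])
  \<comment> \<open>Cocommutativity permutes the last three tensor factors cyclically, which moves
    the factor fed to \<open>g\<close> from the last place to the second.\<close>
  have perm: "?D i (\<lambda>a r. ?D r (\<lambda>b t. ?D t (\<lambda>c d. M a b c d))) =
      ?D i (\<lambda>a r. ?D r (\<lambda>b t. ?D t (\<lambda>c d. M a c d b)))" for M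
    by (subst (2) swap_left[OF module_smul], subst (2) cocomm[OF module_smul]) simp
  have "((B \<circ> f) \<star> (B \<circ> g)) i = ?D i (\<lambda>j k. B (?D j (\<lambda>l m. ?D l (\<lambda>a b. ?F (f a) (g k) (f b) (f m)))))"
    by (simp add: conv_def B_mult_B sw)
  also have "\<dots> = B (?D i (\<lambda>j k. ?D j (\<lambda>l m. ?D l (\<lambda>a b. ?F (f a) (g k) (f b) (f m)))))"
    by (subst cosum_hom[OF module_smul module_smul linear_on_B carrier_subspace])
      (simp_all add: cosum_carrier)
  also have "?D i (\<lambda>j k. ?D j (\<lambda>l m. ?D l (\<lambda>a b. ?F (f a) (g k) (f b) (f m)))) =
      ?D i (\<lambda>a r. ?D r (\<lambda>b t. ?D t (\<lambda>m k. ?F (f a) (g k) (f b) (f m))))"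
    by (simp add: coassoc[OF module_smul])
  also have "\<dots> = ?D i (\<lambda>a r. ?D r (\<lambda>k t. ?D t (\<lambda>b m. ?F (f a) (g k) (f b) (f m))))"
    by (subst perm[symmetric]) (rule refl)
  also have "\<dots> = ((B \<circ> f) \<star> g \<star> (antipode H \<circ> (B \<circ> f)) \<star> f) i"
    unfolding conv_assoc by (simp add: conv_def cosum_mult_right mult.assoc)
  finally show "((B \<circ> f) \<star> (B \<circ> g)) i = (B \<circ> ((B \<circ> f) \<star> g \<star> (antipode H \<circ> (B \<circ> f)) \<star> f)) i"
    by (simp add: comp_def)
qed

sublocale G: rota_baxter_group P "conv H \<delta>" "conv_one H \<epsilon>" "(\<circ>) (antipode H)" "(\<circ>) B"
  by unfold_locales
    (simp_all add: conv_closed conv_one_closed antipode_points B_points conv_assoc conv_one_left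
      conv_one_right antipode_conv_left antipode_conv_right B_conv_B)

lemma T_points:
  assumes f: "f \<in> P"
  shows "T \<circ> f = G.T f"
  unfolding G.T_def
  by (simp add: fun_eq_iff conv_def rb_tilde_def sweedler_points[OF f vector_space_smul bilinear_T])

lemma T_comp_closed: "f \<in> P \<Longrightarrow> T \<circ> f \<in> P"
  by (simp add: T_points)

text \<open>\<open>rb_antipode\<close> is the antipode that belongs to the descendent product; on
  points it becomes inversion in the descendent group.\<close>

lemma rb_antipode_points:
  assumes f: "f \<in> P"
  shows "rb_antipode H B \<circ> f = G.desc_inv f"
proof
  fix i
  note [simp] = points_carrier[OF f]
  have b: "bilinear_form (smul H) (\<lambda>x\<^sub>1 x\<^sub>2. antipode H (B x\<^sub>1) * antipode H x\<^sub>2 * B x\<^sub>3)" for x\<^sub>3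
    by (simp add: bilinear_simps)
  have b': "bilinear_form (smul H) (\<lambda>u x\<^sub>3. sweedler H u (\<lambda>x\<^sub>1 x\<^sub>2. antipode H (B x\<^sub>1) * antipode H x\<^sub>2 * B x\<^sub>3))"
    by (intro bilinear_sweedler_left[OF vector_space_smul b]) (simp add: bilinear_simps)
  show "(rb_antipode H B \<circ> f) i = G.desc_inv f i"
    unfolding comp_apply rb_antipode_def sweedler3_def sweedler_points[OF f vector_space_smul b'] G.desc_inv_def
    by (simp add: sweedler_points[OF f vector_space_smul b] conv_def cosum_mult_left)
qed

end

context rota_baxter_hopf
begin

lemma rota_baxter_points: "based_coalgebra \<delta> \<epsilon> \<Longrightarrow> rota_baxter_points H B \<delta> \<epsilon>"
  by (intro rota_baxter_points.intro hopf_points.intro rota_baxter_hopf_axioms hopf_algebra_axioms)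

text \<open>Reduces a statement about an element to one about the value of a coalgebra map at an
  index, where group identities can be evaluated.\<close>

lemma pointE:
  assumes "x \<in> carrier H"
  obtains \<delta> :: "'a option \<Rightarrow> ('k \<times> 'a option \<times> 'a option) list" and \<epsilon> p i
  where "rota_baxter_points H B \<delta> \<epsilon>" "p \<in> points H \<delta> \<epsilon>" "p i = x"
  using exists_point[OF cocommutative_H assms] rota_baxter_points by metis

lemma T_closed [simp]: "x \<in> carrier H \<Longrightarrow> T x \<in> carrier H"
proof (erule pointE)
  fix \<delta> :: "'a option \<Rightarrow> ('k \<times> 'a option \<times> 'a option) list" and \<epsilon> p i
  assume "rota_baxter_points H B \<delta> \<epsilon>" and p: "p \<in> points H \<delta> \<epsilon>" and x: "p i = x"
  then interpret rota_baxter_points H B \<delta> \<epsilon> by simp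
  show "T x \<in> carrier H"
    using points_carrier[OF T_comp_closed[OF p], of i] by (simp add: x)
qed

lemma rb_antipode_closed [simp]: "x \<in> carrier H \<Longrightarrow> rb_antipode H B x \<in> carrier H"
  and B_rb_antipode: "x \<in> carrier H \<Longrightarrow> B (rb_antipode H B x) = antipode H (B x)"
  and rb_antipode_rb_antipode: "x \<in> carrier H \<Longrightarrow> rb_antipode H B (rb_antipode H B x) = x"
  and antipode_antipode [simp]: "x \<in> carrier H \<Longrightarrow> antipode H (antipode H x) = x"
  and antipode_T: "x \<in> carrier H \<Longrightarrow> antipode H (T x) \<in> T ` carrier H"
  and counit_T [simp]: "x \<in> carrier H \<Longrightarrow> counit H (T x) = counit H x"
proof -
  assume "x \<in> carrier H"
  then obtain \<delta> :: "'a option \<Rightarrow> ('k \<times> 'a option \<times> 'a option) list" and \<epsilon> p i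
    where D: "rota_baxter_points H B \<delta> \<epsilon>" and p: "p \<in> points H \<delta> \<epsilon>" and x: "p i = x"
    by (rule pointE)
  interpret rota_baxter_points H B \<delta> \<epsilon> by fact
  note * = fun_cong[OF rb_antipode_points[OF p], of i] fun_cong[OF rb_antipode_points[of "G.desc_inv p"], of i]
  show "rb_antipode H B x \<in> carrier H"
    using *(1) points_carrier[of "G.desc_inv p" \<delta> \<epsilon> i] p by (simp add: x)
  show "B (rb_antipode H B x) = antipode H (B x)"
    using *(1) fun_cong[OF G.B_desc_inv[OF p], of i] by (simp add: x)
  show "rb_antipode H B (rb_antipode H B x) = x"
    using * p by (simp add: x)
  show "antipode H (antipode H x) = x"
    using fun_cong[OF G.inv_inv[OF p], of i] by (simp add: x)
  have "antipode H (T x) = T ((antipode H \<circ> G.desc_inv (antipode H \<circ> p)) i)"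
    using fun_cong[OF G.inv_T[OF p], of i] fun_cong[OF T_points[OF p], of i] p
      fun_cong[OF T_points[of "antipode H \<circ> G.desc_inv (antipode H \<circ> p)"], of i] by (simp add: x)
  then show "antipode H (T x) \<in> T ` carrier H"
    using points_carrier[of "antipode H \<circ> G.desc_inv (antipode H \<circ> p)" \<delta> \<epsilon> i] p by auto
  show "counit H (T x) = counit H x"
    using counit_points[OF p, of i] counit_points[OF T_comp_closed[OF p], of i] by (simp add: x)
qed

end

text \<open>Pullbacks along the coalgebra maps \<open>id \<otimes> \<epsilon>\<close>, \<open>\<epsilon> \<otimes> id\<close> and the associator.\<close>

definition pull\<^sub>1 :: "('k::field, 'a::ring_1) hopf \<Rightarrow> ('j \<Rightarrow> 'k) \<Rightarrow> ('i \<Rightarrow> 'a) \<Rightarrow> 'i \<times> 'j \<Rightarrow> 'a"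
  where "pull\<^sub>1 H \<eta> f p = smul H (\<eta> (snd p)) (f (fst p))"

definition pull\<^sub>2 :: "('k::field, 'a::ring_1) hopf \<Rightarrow> ('i \<Rightarrow> 'k) \<Rightarrow> ('j \<Rightarrow> 'a) \<Rightarrow> 'i \<times> 'j \<Rightarrow> 'a"
  where "pull\<^sub>2 H \<epsilon> f p = smul H (\<epsilon> (fst p)) (f (snd p))"

definition reassoc :: "('i \<times> ('j \<times> 'l) \<Rightarrow> 'a) \<Rightarrow> ('i \<times> 'j) \<times> 'l \<Rightarrow> 'a"
  where "reassoc f p = f (fst (fst p), snd (fst p), snd p)"

context rota_baxter_hopf
begin

text \<open>The coalgebra map in question sends the basis element \<open>i\<close> to
  \<open>w i\<close> times the basis element \<open>m i\<close>. Its compatibility with coproducts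
  is assumed for two modules: \<open>comul_smul\<close> makes pullback respect convolution,
  \<open>comul_tscale\<close> makes the pullback of a point comultiplicative.\<close>

lemma points_pullback:
  fixes \<delta> :: "'i \<Rightarrow> ('k \<times> 'i \<times> 'i) list" and \<gamma> :: "'j \<Rightarrow> ('k \<times> 'j \<times> 'j) list"
  assumes D: "rota_baxter_points H B \<delta> \<epsilon>" and E: "rota_baxter_points H B \<gamma> \<eta>"
    and counit: "\<And>i. \<epsilon> i = w i * \<eta> (m i)"
    and comul_smul: "\<And>i F. cosum (smul H) \<delta> i (\<lambda>a b. smul H (w a) (smul H (w b) (F (m a) (m b)))) =
      smul H (w i) (cosum (smul H) \<gamma> (m i) F)"
    and comul_tscale: "\<And>i (F :: 'j \<Rightarrow> 'j \<Rightarrow> ('k, 'a, 'a) tensor).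
      cosum tscale \<delta> i (\<lambda>a b. tscale (w a) (tscale (w b) (F (m a) (m b)))) =
      tscale (w i) (cosum tscale \<gamma> (m i) F)"
  shows "rota_baxter_group_hom (points H \<gamma> \<eta>) (conv H \<gamma>) (conv_one H \<eta>) ((\<circ>) (antipode H)) ((\<circ>) B)
    (points H \<delta> \<epsilon>) (conv H \<delta>) (conv_one H \<epsilon>) ((\<circ>) (antipode H)) ((\<circ>) B)
    (\<lambda>f i. smul H (w i) (f (m i)))"
proof -
  interpret D: rota_baxter_points H B \<delta> \<epsilon> by fact
  interpret E: rota_baxter_points H B \<gamma> \<eta> by fact
  show ?thesis
  proof
    fix f assume f: "f \<in> points H \<gamma> \<eta>"
    show "(\<lambda>i. smul H (w i) (f (m i))) \<in> points H \<delta> \<epsilon>"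
      unfolding points_def
    proof (intro CollectI allI conjI)
      fix i
      show "smul H (w i) (f (m i)) \<in> carrier H" by (simp add: points_carrier[OF f])
      show "counit H (smul H (w i) (f (m i))) = \<epsilon> i"
        by (simp add: points_carrier[OF f] counit_points[OF f] counit)
      have "comul H (smul H (w i) (f (m i))) = tscale (w i) (comul H (f (m i)))"
        using comul_linear points_carrier[OF f] by (simp add: linear_on_def)
      also have "\<dots> = cosum tscale \<delta> i (\<lambda>a b. tscale (w a) (tscale (w b) (pure_tensor H (f (m a)) (f (m b)))))"
        by (simp only: comul_points[OF f] comul_tscale[of _ "\<lambda>x y. pure_tensor H (f x) (f y)"])
      finally show "comul H (smul H (w i) (f (m i))) =
          cosum tscale \<delta> i (\<lambda>a b. pure_tensor H (smul H (w a) (f (m a))) (smul H (w b) (f (m b))))"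
        by (simp add: tens_smul_left tens_smul_right module.scale_left_commute[OF module_tscale])
    qed
    show "(\<lambda>i. smul H (w i) ((antipode H \<circ> f) (m i))) = antipode H \<circ> (\<lambda>i. smul H (w i) (f (m i)))"
      "(\<lambda>i. smul H (w i) ((B \<circ> f) (m i))) = B \<circ> (\<lambda>i. smul H (w i) (f (m i)))"
      by (simp_all add: fun_eq_iff points_carrier[OF f])
  next
    fix f g
    show "(\<lambda>i. smul H (w i) (conv H \<gamma> f g (m i))) =
        conv H \<delta> (\<lambda>i. smul H (w i) (f (m i))) (\<lambda>i. smul H (w i) (g (m i)))"
      unfolding conv_def comul_smul[symmetric]
      by (simp add: smul_mult_left smul_mult_right vs.scale_left_commute mult.commute)
  qed
qed

end

section \<open>Adjoint actions of a Hopf algebra on itself\<close>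

context hopf_algebra
begin

lemma sweedler_closed:
  assumes "x \<in> carrier H" "bilinear_form (smul H) F"
    and "\<And>y z. y \<in> carrier H \<Longrightarrow> z \<in> carrier H \<Longrightarrow> F y z \<in> carrier H"
  shows "sweedler H x F \<in> carrier H"
proof -
  obtain ps where ps: "comul H x = tensor_sum (smul H) (smul H) ps" "set ps \<subseteq> carrier H \<times> carrier H"
    using comul_list[OF assms(1)] by metis
  have "(\<Sum>(y, z)\<leftarrow>ps. F y z) \<in> carrier H"
    using ps(2) by (induction ps) (auto simp: assms(3))
  then show ?thesis
    by (simp add: sweedler_tensor_sum'[OF vector_space_smul assms(2) ps])
qed

text \<open>\<open>adj\<close> and \<open>coadj\<close> are the left and right adjoint actions.
  Written with them, \<open>B x \<rhd> T y\<close> visibly depends on \<open>x\<close> only through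
  \<open>B x\<close>, and \<open>B x \<lhd> T y\<close> on \<open>y\<close> only through
  \<open>T y\<close>; the two remaining dependences need proof.\<close>

definition adj :: "'a \<Rightarrow> 'a \<Rightarrow> 'a"
  where "adj h y = sweedler H h (\<lambda>h\<^sub>1 h\<^sub>2. h\<^sub>1 * y * antipode H h\<^sub>2)"

definition coadj :: "'a \<Rightarrow> 'a \<Rightarrow> 'a"
  where "coadj c y = sweedler H c (\<lambda>c\<^sub>1 c\<^sub>2. antipode H c\<^sub>1 * y * c\<^sub>2)"

lemma bilinear_adj: "bilinear_form (smul H) (\<lambda>h\<^sub>1 h\<^sub>2. h\<^sub>1 * y * antipode H h\<^sub>2)"
  by (simp add: bilinear_simps)

lemma bilinear_coadj: "bilinear_form (smul H) (\<lambda>c\<^sub>1 c\<^sub>2. antipode H c\<^sub>1 * y * c\<^sub>2)"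
  by (simp add: bilinear_simps)

lemma adj_closed [simp]: "h \<in> carrier H \<Longrightarrow> y \<in> carrier H \<Longrightarrow> adj h y \<in> carrier H"
  unfolding adj_def by (intro sweedler_closed bilinear_adj) simp_all

lemma coadj_closed [simp]: "h \<in> carrier H \<Longrightarrow> y \<in> carrier H \<Longrightarrow> coadj h y \<in> carrier H"
  unfolding coadj_def by (intro sweedler_closed bilinear_coadj) simp_all

lemma bilinear_on_adj: "bilinear_form (smul H) adj"
  unfolding bilinear_on_def adj_def
  by (intro conjI ballI linear_on_sweedler linear_on_sweedler_param vector_space_smul carrier_subspace bilinear_adj)
    (simp_all add: bilinear_simps)

lemma bilinear_on_coadj: "bilinear_form (smul H) coadj"
  unfolding bilinear_on_def coadj_def
  by (intro conjI ballI linear_on_sweedler linear_on_sweedler_param vector_space_smul carrier_subspace bilinear_coadj)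
    (simp_all add: bilinear_simps)

lemma adj_linear [simp]:
  assumes "h \<in> carrier H" "y \<in> carrier H"
  shows "h' \<in> carrier H \<Longrightarrow> adj (h + h') y = adj h y + adj h' y" "adj (smul H c h) y = smul H c (adj h y)"
    "y' \<in> carrier H \<Longrightarrow> adj h (y + y') = adj h y + adj h y'" "adj h (smul H c y) = smul H c (adj h y)"
  using bilinear_on_adj assms by (simp_all add: bilinear_on_def linear_on_def)

lemma coadj_linear [simp]:
  assumes "h \<in> carrier H" "y \<in> carrier H"
  shows "h' \<in> carrier H \<Longrightarrow> coadj (h + h') y = coadj h y + coadj h' y" "coadj (smul H c h) y = smul H c (coadj h y)"
    "y' \<in> carrier H \<Longrightarrow> coadj h (y + y') = coadj h y + coadj h y'" "coadj h (smul H c y) = smul H c (coadj h y)"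
  using bilinear_on_coadj assms by (simp_all add: bilinear_on_def linear_on_def)

end

text \<open>The pullbacks \<open>\<pi>\<^sub>1 f\<close> and \<open>\<pi>\<^sub>2 g\<close> lie in
  one convolution group, and evaluation at \<open>(i, j)\<close> makes \<open>f i\<close> and
  \<open>g j\<close> independent arguments. Group identities in two elements thus become bilinear
  identities in \<open>H\<close>.\<close>

locale rota_baxter_points_pair = rota_baxter_hopf H B +
    I: based_coalgebra \<delta> \<epsilon> + J: based_coalgebra \<gamma> \<eta>
  for H :: "('k::field, 'a::ring_1) hopf" and B
    and \<delta> :: "'i \<Rightarrow> ('k \<times> 'i \<times> 'i) list" and \<epsilon>
    and \<gamma> :: "'j \<Rightarrow> ('k \<times> 'j \<times> 'j) list" and \<eta>
begin

sublocale P1: rota_baxter_points H B \<delta> \<epsilon>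
  by (rule rota_baxter_points) unfold_locales

sublocale P2: rota_baxter_points H B \<gamma> \<eta>
  by (rule rota_baxter_points) unfold_locales

sublocale P12: rota_baxter_points H B "prod_comul \<delta> \<gamma>" "prod_counit \<epsilon> \<eta>"
  by (rule rota_baxter_points, rule based_coalgebra_prod) unfold_locales

abbreviation "\<pi>\<^sub>1 \<equiv> pull\<^sub>1 H \<eta>"
abbreviation "\<pi>\<^sub>2 \<equiv> pull\<^sub>2 H \<epsilon>"

lemma cosum_prod_fst:
  assumes "module s"
  shows "cosum s (prod_comul \<delta> \<gamma>) p (\<lambda>a b. s (\<eta> (snd a)) (s (\<eta> (snd b)) (F (fst a) (fst b)))) =
    s (\<eta> (snd p)) (cosum s \<delta> (fst p) F)"
  by (simp add: cosum_prod_comul[OF assms] J.counit[OF assms] scale_cosum[OF assms])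

lemma cosum_prod_snd:
  assumes "module s"
  shows "cosum s (prod_comul \<delta> \<gamma>) p (\<lambda>a b. s (\<epsilon> (fst a)) (s (\<epsilon> (fst b)) (F (snd a) (snd b)))) =
    s (\<epsilon> (fst p)) (cosum s \<gamma> (snd p) F)"
  by (simp add: cosum_prod_comul[OF assms], subst cosum_swap[OF assms])
    (simp add: I.counit[OF assms] scale_cosum[OF assms])

sublocale pi1: rota_baxter_group_hom P1.P "conv H \<delta>" "conv_one H \<epsilon>" "(\<circ>) (antipode H)" "(\<circ>) B"
  P12.P "conv H (prod_comul \<delta> \<gamma>)" "conv_one H (prod_counit \<epsilon> \<eta>)" "(\<circ>) (antipode H)" "(\<circ>) B" "\<pi>\<^sub>1"
  unfolding pull\<^sub>1_def[abs_def]
  by (rule points_pullback[where w = "\<lambda>p. \<eta> (snd p)" and m = fst,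
        OF P12.rota_baxter_points_axioms P1.rota_baxter_points_axioms])
    (simp add: prod_counit_def, rule cosum_prod_fst[OF module_smul], rule cosum_prod_fst[OF module_tscale])

sublocale pi2: rota_baxter_group_hom P2.P "conv H \<gamma>" "conv_one H \<eta>" "(\<circ>) (antipode H)" "(\<circ>) B"
  P12.P "conv H (prod_comul \<delta> \<gamma>)" "conv_one H (prod_counit \<epsilon> \<eta>)" "(\<circ>) (antipode H)" "(\<circ>) B" "\<pi>\<^sub>2"
  unfolding pull\<^sub>2_def[abs_def]
  by (rule points_pullback[where w = "\<lambda>p. \<epsilon> (fst p)" and m = snd,
        OF P12.rota_baxter_points_axioms P2.rota_baxter_points_axioms])
    (simp add: prod_counit_def, rule cosum_prod_snd[OF module_smul], rule cosum_prod_snd[OF module_tscale])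

text \<open>The counit contained in \<open>\<pi>\<^sub>1 f\<close> absorbs the coproduct of the
  second index, so only the first index is comultiplied.\<close>

lemma conv_pull1:
  "conv H (prod_comul \<delta> \<gamma>) (\<pi>\<^sub>1 f) h (i, j) = cosum (smul H) \<delta> i (\<lambda>i\<^sub>1 i\<^sub>2. f i\<^sub>1 * h (i\<^sub>2, j))"
  by (simp add: conv_def cosum_prod_comul[OF module_smul] pull\<^sub>1_def smul_mult_left J.counit[OF module_smul])

lemma conv_pull2:
  "conv H (prod_comul \<delta> \<gamma>) (\<pi>\<^sub>2 f) h (i, j) = cosum (smul H) \<gamma> j (\<lambda>j\<^sub>1 j\<^sub>2. f j\<^sub>1 * h (i, j\<^sub>2))"
  by (simp add: conv_def cosum_prod_comul[OF module_smul] pull\<^sub>2_def smul_mult_left, subst cosum_swap[OF module_smul])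
    (simp add: I.counit[OF module_smul])

lemma conv_pull2_right:
  "conv H (prod_comul \<delta> \<gamma>) h (\<pi>\<^sub>2 f) (i, j) = cosum (smul H) \<gamma> j (\<lambda>j\<^sub>1 j\<^sub>2. h (i, j\<^sub>1) * f j\<^sub>2)"
  by (simp add: conv_def cosum_prod_comul[OF module_smul] pull\<^sub>2_def smul_mult_right, subst cosum_swap[OF module_smul])
    (simp add: I.counit'[OF module_smul])

lemma conv_pull1_pull2: "conv H (prod_comul \<delta> \<gamma>) (\<pi>\<^sub>1 f) (\<pi>\<^sub>2 g) (i, j) = f i * g j"
  by (simp add: conv_pull1 pull\<^sub>2_def smul_mult_right I.counit'[OF module_smul])

lemma mult_pull1_right: "cosum (smul H) \<gamma> j (\<lambda>j\<^sub>1 j\<^sub>2. g j\<^sub>1 * \<pi>\<^sub>1 f (i, j\<^sub>2)) = g j * f i"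
  by (simp add: pull\<^sub>1_def smul_mult_right J.counit'[OF module_smul])

text \<open>Group inversion is composition with the antipode, so conjugation in the convolution
  group is the left adjoint action in \<open>H\<close>.\<close>

lemma conj_points:
  assumes f: "f \<in> P1.P" and g: "g \<in> P2.P"
  shows "P12.cmul (P12.cmul (\<pi>\<^sub>1 f) (\<pi>\<^sub>2 g)) (antipode H \<circ> \<pi>\<^sub>1 f) (i, j) = adj (f i) (g j)"
proof -
  have "antipode H \<circ> \<pi>\<^sub>1 f = \<pi>\<^sub>1 (antipode H \<circ> f)" using f by simp
  then show ?thesis
    unfolding adj_def sweedler_points[OF f vector_space_smul bilinear_adj]
    by (simp only: P12.conv_assoc conv_pull1 conv_pull2 mult_pull1_right) (simp add: mult.assoc)
qed

lemma lam_points: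
  assumes f: "f \<in> P1.P" and g: "g \<in> P2.P"
  shows "P12.G.lam (\<pi>\<^sub>1 f) (\<pi>\<^sub>2 g) (i, j) = adj (B (f i)) (g j)"
proof -
  have "B \<circ> \<pi>\<^sub>1 f = \<pi>\<^sub>1 (B \<circ> f)" using f by simp
  then show ?thesis
    using conj_points[OF P1.B_points[OF f] g] by (simp only: P12.G.lam_def comp_apply)
qed

lemma coadj_points:
  assumes "g \<in> P2.P"
  shows "P12.cmul (\<pi>\<^sub>2 (antipode H \<circ> g)) (P12.cmul (\<pi>\<^sub>1 f) (\<pi>\<^sub>2 g)) (i, j) = coadj (g j) (f i)"
  unfolding coadj_def sweedler_points[OF assms vector_space_smul bilinear_coadj]
  by (simp add: conv_pull2 conv_pull1_pull2 mult.assoc)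

text \<open>Matches the group operation \<open>rho\<close> with the formula that prescribes the
  right action.\<close>

lemma B_rho_points:
  assumes f: "f \<in> P1.P" and g: "g \<in> P2.P"
  shows "B (P12.G.rho (\<pi>\<^sub>1 f) (\<pi>\<^sub>2 g) (i, j)) = antipode H (B (coadj (T (g j)) (rb_antipode H B (f i))))"
proof -
  have 1: "antipode H \<circ> \<pi>\<^sub>2 (T \<circ> g) = \<pi>\<^sub>2 (antipode H \<circ> (T \<circ> g))"
    "P12.G.T (\<pi>\<^sub>2 g) = \<pi>\<^sub>2 (T \<circ> g)" "P12.G.desc_inv (\<pi>\<^sub>1 f) = \<pi>\<^sub>1 (rb_antipode H B \<circ> f)"
    using f g by (simp_all add: P2.T_points P1.rb_antipode_points)
  have "B \<circ> P12.G.rho (\<pi>\<^sub>1 f) (\<pi>\<^sub>2 g) =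
    antipode H \<circ> (B \<circ> P12.cmul (P12.cmul (antipode H \<circ> P12.G.T (\<pi>\<^sub>2 g)) (P12.G.desc_inv (\<pi>\<^sub>1 f))) (P12.G.T (\<pi>\<^sub>2 g)))"
    using f g by (simp add: P12.G.B_rho)
  from fun_cong[OF this, of "(i, j)"] show ?thesis
    unfolding 1 P12.conv_assoc by (simp add: coadj_points[OF P2.T_comp_closed[OF g]])
qed

text \<open>Hopf form of the group identity \<open>B_rho'\<close>: the right-hand side involves
  \<open>f i\<close> only through \<open>B (f i)\<close>.\<close>

lemma B_rho_points':
  assumes f: "f \<in> P1.P" and g: "g \<in> P2.P"
  shows "B (P12.G.rho (\<pi>\<^sub>1 f) (\<pi>\<^sub>2 g) (i, j)) =
    sweedler H (B (f i)) (\<lambda>h\<^sub>1 h\<^sub>2. sweedler H (g j) (\<lambda>y\<^sub>1 y\<^sub>2.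
      antipode H (B (adj h\<^sub>1 (antipode H y\<^sub>1))) * (h\<^sub>2 * B (antipode H y\<^sub>2))))"
proof -
  have b: "bilinear_form (smul H) (\<lambda>y\<^sub>1 y\<^sub>2. antipode H (B (adj h\<^sub>1 (antipode H y\<^sub>1))) * (h\<^sub>2 * B (antipode H y\<^sub>2)))"
    if "h\<^sub>1 \<in> carrier H" for h\<^sub>1 h\<^sub>2
    using that by (simp add: bilinear_simps)
  have b': "bilinear_form (smul H) (\<lambda>h\<^sub>1 h\<^sub>2. sweedler H (g j) (\<lambda>y\<^sub>1 y\<^sub>2.
      antipode H (B (adj h\<^sub>1 (antipode H y\<^sub>1))) * (h\<^sub>2 * B (antipode H y\<^sub>2))))"
    unfolding bilinear_on_def
    by (intro conjI ballI linear_on_sweedler_param[OF vector_space_smul vector_space_smul carrier_subspace])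
      (simp_all add: b points_carrier[OF g], simp_all add: bilinear_simps)
  define L where "L = P12.cmul (P12.cmul (\<pi>\<^sub>1 (B \<circ> f)) (\<pi>\<^sub>2 (antipode H \<circ> g))) (antipode H \<circ> \<pi>\<^sub>1 (B \<circ> f))"
  have L: "L (i, j) = adj (B (f i)) (antipode H (g j))" for i j
    using conj_points[OF P1.B_points[OF f] P2.antipode_points[OF g], of i j] by (simp add: L_def)
  have "P12.cmul (P12.cmul (B \<circ> \<pi>\<^sub>1 f) (antipode H \<circ> \<pi>\<^sub>2 g)) (antipode H \<circ> (B \<circ> \<pi>\<^sub>1 f)) = L"
    using f g by (simp add: L_def)
  moreover have "B \<circ> P12.G.rho (\<pi>\<^sub>1 f) (\<pi>\<^sub>2 g) = P12.cmul (P12.cmul (antipode H \<circ> (B \<circ>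
      P12.cmul (P12.cmul (B \<circ> \<pi>\<^sub>1 f) (antipode H \<circ> \<pi>\<^sub>2 g)) (antipode H \<circ> (B \<circ> \<pi>\<^sub>1 f))))
      (B \<circ> \<pi>\<^sub>1 f)) (B \<circ> (antipode H \<circ> \<pi>\<^sub>2 g))"
    using f g by (intro P12.G.B_rho') simp_all
  moreover have "B \<circ> \<pi>\<^sub>1 f = \<pi>\<^sub>1 (B \<circ> f)" "B \<circ> (antipode H \<circ> \<pi>\<^sub>2 g) = \<pi>\<^sub>2 (B \<circ> (antipode H \<circ> g))"
    using f g by simp_all
  ultimately have "B (P12.G.rho (\<pi>\<^sub>1 f) (\<pi>\<^sub>2 g) (i, j)) =
      P12.cmul (antipode H \<circ> (B \<circ> L)) (P12.cmul (\<pi>\<^sub>1 (B \<circ> f)) (\<pi>\<^sub>2 (B \<circ> (antipode H \<circ> g)))) (i, j)"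
    by (metis P12.conv_assoc comp_apply)
  also have "\<dots> = cosum (smul H) \<delta> i (\<lambda>i\<^sub>1 i\<^sub>2. cosum (smul H) \<gamma> j (\<lambda>j\<^sub>1 j\<^sub>2.
      antipode H (B (adj (B (f i\<^sub>1)) (antipode H (g j\<^sub>1)))) * (B (f i\<^sub>2) * B (antipode H (g j\<^sub>2)))))"
    by (simp add: L conv_def[of H "prod_comul \<delta> \<gamma>" "antipode H \<circ> (B \<circ> L)"]
        cosum_prod_comul[OF module_smul] conv_pull1_pull2)
  also have "\<dots> = sweedler H ((B \<circ> f) i) (\<lambda>h\<^sub>1 h\<^sub>2. sweedler H (g j) (\<lambda>y\<^sub>1 y\<^sub>2.
      antipode H (B (adj h\<^sub>1 (antipode H y\<^sub>1))) * (h\<^sub>2 * B (antipode H y\<^sub>2))))"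
    unfolding sweedler_points[OF P1.B_points[OF f] vector_space_smul b']
    by (simp add: sweedler_points[OF g vector_space_smul b] points_carrier[OF f])
  finally show ?thesis by simp
qed

text \<open>Hopf form of the group identity \<open>T_lam\<close>: the right-hand side involves
  \<open>g j\<close> only through \<open>T (g j)\<close>, at the price of further occurrences of
  \<open>f i\<close>.\<close>

lemma T_lam_points:
  assumes f: "f \<in> P1.P" and g: "g \<in> P2.P"
  shows "T (P12.G.lam (\<pi>\<^sub>1 f) (\<pi>\<^sub>2 g) (i, j)) = sweedler H (f i) (\<lambda>x\<^sub>1 x\<^sub>2.
    sweedler H (T (antipode H x\<^sub>1) * T (g j)) (\<lambda>k\<^sub>1 k\<^sub>2. k\<^sub>1 * T (coadj k\<^sub>2 x\<^sub>2)))"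
proof -
  define k where "k = P12.cmul (\<pi>\<^sub>1 (T \<circ> (antipode H \<circ> f))) (\<pi>\<^sub>2 (T \<circ> g))"
  have k: "k \<in> P12.P"
    using f g by (simp add: k_def P1.T_comp_closed P2.T_comp_closed)
  note [simp] = points_carrier[OF k] points_carrier[OF f] points_carrier[OF g]
  have k_eq: "k (i, j) = T (antipode H (f i)) * T (g j)" for i j
    by (simp add: k_def conv_pull1_pull2)
  let ?D = "cosum (smul H) (prod_comul \<delta> \<gamma>)"
  have b: "bilinear_form (smul H) (\<lambda>k\<^sub>1 k\<^sub>2. k\<^sub>1 * T (coadj k\<^sub>2 x))" if "x \<in> carrier H" for x
    using that by (simp add: bilinear_simps)
  have lin: "linear_on (smul H) (smul H) (carrier H) (\<lambda>x. sweedler H c (\<lambda>k\<^sub>1 k\<^sub>2. k\<^sub>1 * T (coadj k\<^sub>2 x)))"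
    if "c \<in> carrier H" for c
    by (intro linear_on_sweedler_param[OF vector_space_smul vector_space_smul carrier_subspace that b])
      (simp_all add: bilinear_simps)
  have b': "bilinear_form (smul H) (\<lambda>x\<^sub>1 x\<^sub>2. sweedler H (T (antipode H x\<^sub>1) * T (g j)) (\<lambda>k\<^sub>1 k\<^sub>2. k\<^sub>1 * T (coadj k\<^sub>2 x\<^sub>2)))"
    unfolding bilinear_on_def
    using lin linear_on_sweedler[OF vector_space_smul b]
    by (simp add: linear_on_def distrib_right smul_mult_left)
  define N where "N a b c d = k a * T (antipode H (k b) * \<pi>\<^sub>1 f c * k d)" for a b c d
  have pi_f: "\<pi>\<^sub>1 f c \<in> carrier H" for c by (simp add: pull\<^sub>1_def)
  have "P12.G.T (\<pi>\<^sub>1 (antipode H \<circ> f)) = \<pi>\<^sub>1 (T \<circ> (antipode H \<circ> f))" "P12.G.T (\<pi>\<^sub>2 g) = \<pi>\<^sub>2 (T \<circ> g)"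
    using f g by (simp_all add: P1.T_points P2.T_points)
  then have k': "k = P12.cmul (P12.G.T (antipode H \<circ> \<pi>\<^sub>1 f)) (P12.G.T (\<pi>\<^sub>2 g))"
    using f by (simp add: k_def)
  have "T \<circ> P12.G.lam (\<pi>\<^sub>1 f) (\<pi>\<^sub>2 g) =
      P12.cmul k (T \<circ> P12.cmul (P12.cmul (antipode H \<circ> k) (\<pi>\<^sub>1 f)) k)"
    using f g k P12.G.T_lam[of "\<pi>\<^sub>1 f" "\<pi>\<^sub>2 g"] by (simp add: P12.T_points flip: k')
  then have "T (P12.G.lam (\<pi>\<^sub>1 f) (\<pi>\<^sub>2 g) (i, j)) =
      ?D (i, j) (\<lambda>a r. k a * T (?D r (\<lambda>b t. ?D t (\<lambda>c d. antipode H (k b) * \<pi>\<^sub>1 f c * k d))))"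
    unfolding P12.conv_assoc fun_eq_iff
    by (simp add: conv_def cosum_mult_right mult.assoc)
  also have "\<dots> = ?D (i, j) (\<lambda>a r. ?D r (\<lambda>b t. ?D t (\<lambda>c d. N a b c d)))"
    by (simp add: N_def cosum_hom[OF module_smul module_smul linear_on_T carrier_subspace] cosum_carrier
        pi_f cosum_mult_right)
  \<comment> \<open>The slot of \<open>\<pi>\<^sub>1 f\<close> is moved to the end, so that the
    three slots of \<open>k\<close> form an iterated coproduct and can be collected into a Sweedler
    sum over \<open>k u\<close>.\<close>
  also have "\<dots> = ?D (i, j) (\<lambda>a r. ?D r (\<lambda>b t. ?D t (\<lambda>d c. N a b c d)))"
    by (subst P12.cocomm[OF module_smul]) (rule refl)
  also have "\<dots> = ?D (i, j) (\<lambda>u c. ?D u (\<lambda>a v. ?D v (\<lambda>b d. N a b c d)))"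
    by (subst (2) P12.coassoc[OF module_smul, symmetric]) (rule P12.coassoc[OF module_smul, symmetric])
  also have "\<dots> = ?D (i, j) (\<lambda>u c. sweedler H (k u) (\<lambda>k\<^sub>1 k\<^sub>2. k\<^sub>1 * T (coadj k\<^sub>2 (\<pi>\<^sub>1 f c))))"
    unfolding sweedler_points[OF k vector_space_smul b[OF pi_f]]
    unfolding coadj_def
    by (simp add: N_def pi_f sweedler_points[OF k vector_space_smul bilinear_coadj]
        cosum_hom[OF module_smul module_smul linear_on_T carrier_subspace] cosum_carrier cosum_mult_right)
  \<comment> \<open>The counit pulled out of \<open>\<pi>\<^sub>1 f\<close> absorbs the second
    component of \<open>c\<close>, which leaves a coproduct of \<open>i\<close> alone.\<close>
  also have "\<dots> = ?D (i, j) (\<lambda>u c. smul H (\<eta> (snd c)) (sweedler H (k u) (\<lambda>k\<^sub>1 k\<^sub>2. k\<^sub>1 * T (coadj k\<^sub>2 (f (fst c))))))"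
    using lin by (simp add: linear_on_def pull\<^sub>1_def)
  also have "\<dots> = cosum (smul H) \<delta> i (\<lambda>i\<^sub>1 i\<^sub>2. sweedler H (k (i\<^sub>1, j)) (\<lambda>k\<^sub>1 k\<^sub>2. k\<^sub>1 * T (coadj k\<^sub>2 (f i\<^sub>2))))"
    by (simp add: cosum_prod_comul[OF module_smul] J.counit'[OF module_smul])
  also have "\<dots> = sweedler H (f i) (\<lambda>x\<^sub>1 x\<^sub>2.
    sweedler H (T (antipode H x\<^sub>1) * T (g j)) (\<lambda>k\<^sub>1 k\<^sub>2. k\<^sub>1 * T (coadj k\<^sub>2 x\<^sub>2)))"
    unfolding sweedler_points[OF f vector_space_smul b'] by (simp add: k_eq)
  finally show ?thesis .
qed

text \<open>Together with \<open>T_mult_points\<close> this gives closure of the two images under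
  multiplication.\<close>

lemma B_mult_points:
  assumes "f \<in> P1.P" "g \<in> P2.P"
  shows "B (f i) * B (g j) = B (P12.G.desc_mult (\<pi>\<^sub>1 f) (\<pi>\<^sub>2 g) (i, j))"
proof -
  have "B \<circ> P12.G.desc_mult (\<pi>\<^sub>1 f) (\<pi>\<^sub>2 g) = P12.cmul (\<pi>\<^sub>1 (B \<circ> f)) (\<pi>\<^sub>2 (B \<circ> g))"
    using assms by (simp add: P12.G.B_desc_mult)
  from fun_cong[OF this, of "(i, j)"] show ?thesis by (simp add: conv_pull1_pull2)
qed

lemma T_mult_points:
  assumes "f \<in> P1.P" "g \<in> P2.P"
  shows "T (f i) * T (g j) = T (P12.G.tilde_mult (\<pi>\<^sub>1 f) (\<pi>\<^sub>2 g) (i, j))"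
proof -
  have "T \<circ> P12.G.tilde_mult (\<pi>\<^sub>1 f) (\<pi>\<^sub>2 g) = P12.cmul (\<pi>\<^sub>1 (T \<circ> f)) (\<pi>\<^sub>2 (T \<circ> g))"
    using assms by (simp add: P12.T_points P1.T_points P2.T_points P12.G.T_tilde_mult)
  from fun_cong[OF this, of "(i, j)"] show ?thesis by (simp add: conv_pull1_pull2)
qed

end

section \<open>The images as Hopf subalgebras\<close>

context hopf_algebra
begin

lemma hopf_algebra_sub:
  assumes C: "C \<subseteq> carrier H" "vs.subspace C" "1 \<in> C"
    and mult: "\<And>x y. x \<in> C \<Longrightarrow> y \<in> C \<Longrightarrow> x * y \<in> C"
    and antipode: "\<And>x. x \<in> C \<Longrightarrow> antipode H x \<in> C"
    and comul: "\<And>x. x \<in> C \<Longrightarrow> comul H x \<in> tensor_space (smul H) (smul H) C C"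
  shows "hopf_algebra (H\<lparr>carrier := C\<rparr>)"
proof -
  note vs.subspace_add[OF C(2), simp] vs.subspace_scale[OF C(2), simp]
  have [simp]: "x \<in> carrier H" if "x \<in> C" for x using that C(1) by auto
  have lin: "linear_on (smul H) s C f" if "linear_on (smul H) s (carrier H) f"
    for s and f :: "'a \<Rightarrow> 'v::ab_group_add"
    using that by (simp add: linear_on_def)
  \<comment> \<open>A list with entries in \<open>C\<close> represents the coproduct of
    \<open>x\<close> in both Hopf algebras. Agreement of \<open>F\<close> and \<open>G\<close> is
    asked only on \<open>C\<close>, because in nested sums \<open>F\<close> is itself a Sweedler sum
    over \<open>C\<close> while \<open>G\<close> is one over \<open>H\<close>.\<close>
  have sub: "sweedler (H\<lparr>carrier := C\<rparr>) x F = sweedler H x G"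
    if x: "x \<in> C" and s: "vector_space s" and G: "bilinear_form s G"
      and FG: "\<And>y z. y \<in> C \<Longrightarrow> z \<in> C \<Longrightarrow> F y z = G y z"
    for x s and F G :: "'a \<Rightarrow> 'a \<Rightarrow> 'v::ab_group_add"
  proof -
    obtain ps where ps: "comul H x = tensor_sum (smul H) (smul H) ps" "set ps \<subseteq> C \<times> C"
      using comul[OF x] by (auto simp: tensor_space_def)
    have F: "bilinear_on (smul H) (smul H) s C C F"
      using G by (simp add: bilinear_on_def linear_on_def FG)
    have ps': "set ps \<subseteq> carrier H \<times> carrier H" using ps(2) C(1) by auto
    show ?thesis
      unfolding sweedler_tensor_sum[OF s C(2) F ps] sweedler_tensor_sum'[OF s G ps(1) ps']
      by (intro arg_cong[of _ _ sum_list] map_cong refl) (use ps(2) FG in auto)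
  qed
  have t: "vector_space (tscale :: 'k \<Rightarrow> ('k, 'a, ('k, 'a, 'a) tensor) tensor \<Rightarrow> _)"
    by (rule vector_space_tscale)
  have b: "bilinear_on (smul H) tscale tscale UNIV UNIV
      (tens (smul H) tscale :: 'a \<Rightarrow> ('k, 'a, 'a) tensor \<Rightarrow> ('k, 'a, ('k, 'a, 'a) tensor) tensor)"
    by (rule bilinear_tens)
  have b1: "bilinear_form tscale (\<lambda>x y. tens (smul H) tscale x (pure_tensor H y z))" for z
    using b by (simp add: bilinear_on_def linear_on_def tens_add_left tens_smul_left)
  have b2: "linear_on (smul H) tscale (carrier H) (\<lambda>z. tens (smul H) tscale x (pure_tensor H y z))" for x y
    using b by (simp add: bilinear_on_def linear_on_def tens_add_right tens_smul_right)
  have b3: "bilinear_form tscale (\<lambda>x v. tens (smul H) tscale x (comul H v))"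
    using b comul_linear by (simp add: bilinear_on_def linear_on_def)
  have b4: "bilinear_form tscale (\<lambda>u z. sweedler H u (\<lambda>x y. tens (smul H) tscale x (pure_tensor H y z)))"
    by (rule bilinear_sweedler_left[OF t b1 b2])
  have c: "bilinear_form (smul H) (\<lambda>x y. smul H (counit H x) y)"
    "bilinear_form (smul H) (\<lambda>x y. smul H (counit H y) x)"
    by (simp_all add: bilinear_on_def linear_on_def vs.scale_left_distrib vs.scale_right_distrib mult.commute)
  have a: "bilinear_form (smul H) (\<lambda>x y. antipode H x * y)" "bilinear_form (smul H) (\<lambda>x y. x * antipode H y)"
    by (simp_all add: bilinear_simps)
  have m: "bilinear_form tscale (\<lambda>y\<^sub>1 y\<^sub>2. pure_tensor H (x\<^sub>1 * y\<^sub>1) (x\<^sub>2 * y\<^sub>2))" for x\<^sub>1 x\<^sub>2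
    by (simp add: bilinear_simps)
  have m': "bilinear_form tscale (\<lambda>x\<^sub>1 x\<^sub>2. sweedler H y (\<lambda>y\<^sub>1 y\<^sub>2. pure_tensor H (x\<^sub>1 * y\<^sub>1) (x\<^sub>2 * y\<^sub>2)))"
    if "y \<in> carrier H" for y
    unfolding bilinear_on_def
    by (intro conjI ballI linear_on_sweedler_param[OF vector_space_tscale vector_space_smul carrier_subspace that])
      (simp_all add: bilinear_simps)
  show ?thesis
  \<comment> \<open>Cases 1 to 4 are the vector space axioms; the remaining ones follow the order of
    the axioms of \<open>hopf_algebra\<close>.\<close>
  proof (unfold_locales, goal_cases)
    case 1 show ?case by simp (rule vs.scale_right_distrib)
  next case 2 show ?case by simp (rule vs.scale_left_distrib)
  next case 3 show ?case by simp
  next case 4 show ?case by simp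
  next case 5 show ?case by (simp add: smul_mult_left)
  next case 6 show ?case by (simp add: smul_mult_right)
  next case 7 show ?case using C(2) by simp
  next case 8 show ?case using C(3) by simp
  next case 9 then show ?case using mult by simp
  next case 10 then show ?case using comul by simp
  next case 11 then show ?case using antipode by simp
  next case 12 show ?case using lin[OF comul_linear] by simp
  next case 13 show ?case using lin[OF counit_linear] by simp
  next case 14 show ?case using lin[OF antipode_linear] by simp
  next case (15 x)
    then have x: "x \<in> C" by simp
    have "sweedler3 (H\<lparr>carrier := C\<rparr>) x (\<lambda>x1 x2 x3. tens (smul H) tscale x1 (pure_tensor H x2 x3)) =
      sweedler3 H x (\<lambda>x1 x2 x3. tens (smul H) tscale x1 (pure_tensor H x2 x3))"
      unfolding sweedler3_def by (rule sub[OF x t b4], rule sub[OF _ t b1]) simp_all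
    also have "\<dots> = sweedler (H\<lparr>carrier := C\<rparr>) x (\<lambda>x1 v. tens (smul H) tscale x1 (comul H v))"
      using x by (simp add: coassoc sub[OF x t b3])
    finally show ?case by simp
  next case (16 x)
    then have x: "x \<in> C" by simp
    show ?case using counit_left[of x] sub[OF x vector_space_smul c(1)] x by simp
  next case (17 x)
    then have x: "x \<in> C" by simp
    show ?case using counit_right[of x] sub[OF x vector_space_smul c(2)] x by simp
  next case 18 show ?case by (simp add: comul_one)
  next case (19 x y)
    then have x: "x \<in> C" and y: "y \<in> C" by simp_all
    have "sweedler (H\<lparr>carrier := C\<rparr>) x (\<lambda>x1 x2. sweedler (H\<lparr>carrier := C\<rparr>) y (\<lambda>y1 y2. pure_tensor H (x1 * y1) (x2 * y2)))
      = sweedler H x (\<lambda>x1 x2. sweedler H y (\<lambda>y1 y2. pure_tensor H (x1 * y1) (x2 * y2)))"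
      by (rule sub[OF x vector_space_tscale m'], use y in simp) (rule sub[OF y vector_space_tscale m], simp)
    then show ?case using x y by (simp add: comul_mult)
  next case 20 show ?case by (simp add: counit_one)
  next case (21 x y) then show ?case by (simp add: counit_mult)
  next case (22 x)
    then have x: "x \<in> C" by simp
    show ?case using antipode_left[of x] sub[OF x vector_space_smul a(1)] x by simp
  next case (23 x)
    then have x: "x \<in> C" by simp
    show ?case using antipode_right[of x] sub[OF x vector_space_smul a(2)] x by simp
  qed
qed

lemma subspace_linear_image:
  assumes "linear_on (smul H) (smul H) (carrier H) g"
  shows "vs.subspace (g ` carrier H)"
proof (rule vs.subspaceI)
  have "g (smul H 0 0) = smul H 0 (g 0)" using assms carrier_ops(1) unfolding linear_on_def by blast
  then have "g 0 = 0" by simp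
  then show "0 \<in> g ` carrier H" by (metis carrier_ops(1) imageI)
next
  fix x y assume "x \<in> g ` carrier H" "y \<in> g ` carrier H"
  then obtain u v where "u \<in> carrier H" "v \<in> carrier H" "x = g u" "y = g v" by auto
  then have "x + y = g (u + v)" "u + v \<in> carrier H" using assms by (simp_all add: linear_on_def)
  then show "x + y \<in> g ` carrier H" by simp
next
  fix c x assume "x \<in> g ` carrier H"
  then obtain u where "u \<in> carrier H" "x = g u" by auto
  then have "smul H c x = g (smul H c u)" "smul H c u \<in> carrier H" using assms by (simp_all add: linear_on_def)
  then show "smul H c x \<in> g ` carrier H" by simp
qed

lemma hopf_algebra_image:
  assumes g: "coalgebra_map H H g" and "1 \<in> g ` carrier H"
    and "\<And>x y. x \<in> g ` carrier H \<Longrightarrow> y \<in> g ` carrier H \<Longrightarrow> x * y \<in> g ` carrier H"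
    and "\<And>x. x \<in> g ` carrier H \<Longrightarrow> antipode H x \<in> g ` carrier H"
  shows "hopf_algebra (image_hopf H g)"
  unfolding image_hopf_def
proof (rule hopf_algebra_sub)
  have l: "linear_on (smul H) (smul H) (carrier H) g" using g by (simp add: coalgebra_map_def)
  then show "vs.subspace (g ` carrier H)" by (rule subspace_linear_image)
  show "g ` carrier H \<subseteq> carrier H" using g by (simp add: coalgebra_map_def)
  fix x assume "x \<in> g ` carrier H"
  then obtain u where u: "u \<in> carrier H" "x = g u" by auto
  obtain ps where ps: "comul H u = tensor_sum (smul H) (smul H) ps" "set ps \<subseteq> carrier H \<times> carrier H"
    using comul_list[OF u(1)] by metis
  have b: "bilinear_form tscale (\<lambda>y z. pure_tensor H (g y) (g z))"
    using l by (simp add: bilinear_simps)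
  have "comul H x = tensor_sum (smul H) (smul H) (map (\<lambda>(y, z). (g y, g z)) ps)"
    using g u sweedler_tensor_sum'[OF vector_space_tscale b ps]
    by (simp add: coalgebra_map_def tensor_sum_def comp_def case_prod_unfold)
  moreover have "set (map (\<lambda>(y, z). (g y, g z)) ps) \<subseteq> g ` carrier H \<times> g ` carrier H"
    using ps(2) by auto
  ultimately show "comul H x \<in> tensor_space (smul H) (smul H) (g ` carrier H) (g ` carrier H)"
    unfolding tensor_space_def by blast
qed (use assms in auto)

lemma antipode_one [simp]: "antipode H 1 = 1"
proof -
  have b: "bilinear_form (smul H) (\<lambda>x y. antipode H x * y)" by (simp add: bilinear_simps)
  have "comul H 1 = tensor_sum (smul H) (smul H) [(1, 1)]" by (simp add: comul_one tensor_sum_def)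
  from sweedler_tensor_sum'[OF vector_space_smul b this] show ?thesis
    using antipode_left[of 1] by (simp add: counit_one)
qed

lemma sweedler_one:
  assumes "vector_space s" "bilinear_form s F"
  shows "sweedler H 1 F = F 1 1"
proof -
  have "comul H 1 = tensor_sum (smul H) (smul H) [(1, 1)]" by (simp add: comul_one tensor_sum_def)
  from sweedler_tensor_sum'[OF assms this] show ?thesis by simp
qed

lemma adj_one_left: "y \<in> carrier H \<Longrightarrow> adj 1 y = y"
  by (simp add: adj_def sweedler_one[OF vector_space_smul bilinear_adj])

lemma coadj_one_left: "y \<in> carrier H \<Longrightarrow> coadj 1 y = y"
  by (simp add: coadj_def sweedler_one[OF vector_space_smul bilinear_coadj])

lemma adj_one_right: "h \<in> carrier H \<Longrightarrow> adj h 1 = smul H (counit H h) 1"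
  by (simp add: adj_def antipode_right)

lemma coadj_one_right: "h \<in> carrier H \<Longrightarrow> coadj h 1 = smul H (counit H h) 1"
  by (simp add: coadj_def antipode_left)

lemma sweedler_mult_both:
  assumes x: "x \<in> carrier H" and F: "bilinear_form (smul H) F"
  shows "sweedler H x (\<lambda>u v. a * F u v * b) = a * sweedler H x F * b"
proof -
  obtain ps where ps: "comul H x = tensor_sum (smul H) (smul H) ps" "set ps \<subseteq> carrier H \<times> carrier H"
    using comul_list[OF x] by metis
  have b: "bilinear_form (smul H) (\<lambda>u v. a * F u v * b)"
    using F by (simp add: bilinear_simps)
  have "(\<Sum>(u, v)\<leftarrow>ps. a * F u v * b) = a * (\<Sum>(u, v)\<leftarrow>ps. F u v) * b" for ps
    by (induction ps) (auto simp: distrib_left distrib_right)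
  then show ?thesis
    by (simp add: sweedler_tensor_sum'[OF vector_space_smul F ps] sweedler_tensor_sum'[OF vector_space_smul b ps])
qed

end

section \<open>Multiplicativity of the adjoint actions, and the two images as Hopf algebras\<close>

context rota_baxter_hopf
begin

lemma rota_baxter_points_pair:
  "rota_baxter_points H B \<delta> \<epsilon> \<Longrightarrow> rota_baxter_points H B \<gamma> \<eta> \<Longrightarrow> rota_baxter_points_pair H B \<delta> \<epsilon> \<gamma> \<eta>"
  by (intro rota_baxter_points_pair.intro rota_baxter_hopf_axioms)
    (auto simp: rota_baxter_points_def hopf_points_def)

lemma pair_pointE:
  assumes "x \<in> carrier H" "y \<in> carrier H"
  obtains \<delta> :: "'a option \<Rightarrow> ('k \<times> 'a option \<times> 'a option) list" and \<epsilon> p i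
    and \<gamma> :: "'a option \<Rightarrow> ('k \<times> 'a option \<times> 'a option) list" and \<eta> q j
  where "rota_baxter_points_pair H B \<delta> \<epsilon> \<gamma> \<eta>" "p \<in> points H \<delta> \<epsilon>" "x = p i" "q \<in> points H \<gamma> \<eta>" "y = q j"
  using pointE[OF assms(1)] pointE[OF assms(2)] rota_baxter_points_pair by metis

text \<open>Inversion reverses products in the convolution group of the product coalgebra; this is
  evaluated at the two pullbacks.\<close>

lemma antipode_mult:
  assumes "x \<in> carrier H" "y \<in> carrier H"
  shows "antipode H (x * y) = antipode H y * antipode H x"
  using assms
proof (rule pair_pointE)
  fix \<delta> \<gamma> :: "'a option \<Rightarrow> ('k \<times> 'a option \<times> 'a option) list" and \<epsilon> \<eta> p q i j
  assume "rota_baxter_points_pair H B \<delta> \<epsilon> \<gamma> \<eta>" and p: "p \<in> points H \<delta> \<epsilon>" "x = p i" and q: "q \<in> points H \<gamma> \<eta>" "y = q j"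
  then interpret rota_baxter_points_pair H B \<delta> \<epsilon> \<gamma> \<eta> by simp
  have "antipode H \<circ> P12.cmul (\<pi>\<^sub>1 p) (\<pi>\<^sub>2 q) = P12.cmul (\<pi>\<^sub>2 (antipode H \<circ> q)) (\<pi>\<^sub>1 (antipode H \<circ> p))"
    using p q by (simp add: P12.G.inv_mult)
  from fun_cong[OF this, of "(i, j)"] show ?thesis
    by (simp add: conv_pull1_pull2 conv_pull2 mult_pull1_right p(2) q(2))
qed

lemma B_image_mult: "x \<in> B ` carrier H \<Longrightarrow> y \<in> B ` carrier H \<Longrightarrow> x * y \<in> B ` carrier H"
  and T_image_mult: "x \<in> T ` carrier H \<Longrightarrow> y \<in> T ` carrier H \<Longrightarrow> x * y \<in> T ` carrier H"
proof -
  have *: "B u * B v \<in> B ` carrier H \<and> T u * T v \<in> T ` carrier H" if "u \<in> carrier H" "v \<in> carrier H" for u v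
    using that
  proof (rule pair_pointE)
    fix \<delta> \<gamma> :: "'a option \<Rightarrow> ('k \<times> 'a option \<times> 'a option) list" and \<epsilon> \<eta> p q i j
    assume "rota_baxter_points_pair H B \<delta> \<epsilon> \<gamma> \<eta>" and p: "p \<in> points H \<delta> \<epsilon>" "u = p i" and q: "q \<in> points H \<gamma> \<eta>" "v = q j"
    then interpret rota_baxter_points_pair H B \<delta> \<epsilon> \<gamma> \<eta> by simp
    have "B u * B v = B (P12.G.desc_mult (\<pi>\<^sub>1 p) (\<pi>\<^sub>2 q) (i, j))" "T u * T v = T (P12.G.tilde_mult (\<pi>\<^sub>1 p) (\<pi>\<^sub>2 q) (i, j))"
      using B_mult_points[OF p(1) q(1), of i j] T_mult_points[OF p(1) q(1), of i j] by (simp_all add: p q)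
    moreover have "P12.G.desc_mult (\<pi>\<^sub>1 p) (\<pi>\<^sub>2 q) (i, j) \<in> carrier H" "P12.G.tilde_mult (\<pi>\<^sub>1 p) (\<pi>\<^sub>2 q) (i, j) \<in> carrier H"
      by (rule points_carrier[OF P12.G.closed(4)[OF pi1.hom_closed[OF p(1)] pi2.hom_closed[OF q(1)]]])
        (rule points_carrier[OF P12.G.closed(5)[OF pi1.hom_closed[OF p(1)] pi2.hom_closed[OF q(1)]]])
    ultimately show ?thesis by auto
  qed
  then show "x \<in> B ` carrier H \<Longrightarrow> y \<in> B ` carrier H \<Longrightarrow> x * y \<in> B ` carrier H"
    "x \<in> T ` carrier H \<Longrightarrow> y \<in> T ` carrier H \<Longrightarrow> x * y \<in> T ` carrier H"
    by auto
qed

lemma adj_mult: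
  assumes "h \<in> carrier H" "k \<in> carrier H" "y \<in> carrier H"
  shows "adj (h * k) y = adj h (adj k y)"
proof -
  have "adj (h * k) y = sweedler H h (\<lambda>h\<^sub>1 h\<^sub>2. sweedler H k (\<lambda>k\<^sub>1 k\<^sub>2. h\<^sub>1 * (k\<^sub>1 * y * antipode H k\<^sub>2) * antipode H h\<^sub>2))"
    unfolding adj_def sweedler_mult(1)[OF vector_space_smul bilinear_adj assms(1,2)]
    by (intro sweedler_cong) (simp add: antipode_mult mult.assoc)
  then show ?thesis
    by (simp add: sweedler_mult_both[OF assms(2) bilinear_adj]) (simp add: adj_def)
qed

lemma coadj_mult:
  assumes "c \<in> carrier H" "d \<in> carrier H" "y \<in> carrier H"
  shows "coadj (c * d) y = coadj d (coadj c y)"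
proof -
  have "coadj (c * d) y = sweedler H d (\<lambda>d\<^sub>1 d\<^sub>2. sweedler H c (\<lambda>c\<^sub>1 c\<^sub>2. antipode H d\<^sub>1 * (antipode H c\<^sub>1 * y * c\<^sub>2) * d\<^sub>2))"
    unfolding coadj_def sweedler_mult(2)[OF vector_space_smul bilinear_coadj assms(1,2)]
    by (intro sweedler_cong) (simp add: antipode_mult mult.assoc)
  then show ?thesis
    by (simp add: sweedler_mult_both[OF assms(1) bilinear_coadj]) (simp add: coadj_def)
qed

lemma B_one [simp]: "B 1 = 1" and rb_antipode_one [simp]: "rb_antipode H B 1 = 1" and T_one [simp]: "T 1 = 1"
proof -
  obtain \<delta> :: "'a option \<Rightarrow> ('k \<times> 'a option \<times> 'a option) list" and \<epsilon> p i
    where D: "rota_baxter_points H B \<delta> \<epsilon>" and p: "p \<in> points H \<delta> \<epsilon>" and x: "p i = 1"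
    by (rule pointE[of 1]) simp_all
  interpret rota_baxter_points H B \<delta> \<epsilon> by fact
  \<comment> \<open>At an index \<open>i\<close> with \<open>p i = 1\<close> the counit is 1, so the
    neutral element of the group also takes the value 1 there.\<close>
  have e: "conv_one H \<epsilon> i = 1" using counit_points[OF p, of i] by (simp add: conv_one_def x counit_one)
  show "B 1 = 1" using fun_cong[OF G.B_one, of i] by (simp only: comp_apply e)
  have "G.desc_inv (conv_one H \<epsilon>) = conv_one H \<epsilon>" by (simp add: G.desc_inv_def)
  then show "rb_antipode H B 1 = 1"
    using fun_cong[OF rb_antipode_points[OF G.one_closed], of i] by (simp add: e)
  have "G.T (conv_one H \<epsilon>) = conv_one H \<epsilon>" by (simp add: G.T_def)
  then show "T 1 = 1"
    using fun_cong[OF T_points[OF G.one_closed], of i] by (simp add: e)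
qed

text \<open>On points, \<open>T\<close> is built from the operations of the convolution group, so it
  sends coalgebra maps to coalgebra maps.\<close>

lemma coalgebra_map_T: "coalgebra_map H H T"
  unfolding coalgebra_map_def
proof (intro conjI ballI linear_on_T)
  fix x assume "x \<in> carrier H"
  then obtain \<delta> :: "'a option \<Rightarrow> ('k \<times> 'a option \<times> 'a option) list" and \<epsilon> p i
    where D: "rota_baxter_points H B \<delta> \<epsilon>" and p: "p \<in> points H \<delta> \<epsilon>" and x: "p i = x"
    by (rule pointE)
  interpret rota_baxter_points H B \<delta> \<epsilon> by fact
  have b: "bilinear_form tscale (\<lambda>x\<^sub>1 x\<^sub>2. pure_tensor H (T x\<^sub>1) (T x\<^sub>2))" by (simp add: bilinear_simps)
  show "comul H (T x) = sweedler H x (\<lambda>x\<^sub>1 x\<^sub>2. pure_tensor H (T x\<^sub>1) (T x\<^sub>2))"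
    using comul_points[OF T_comp_closed[OF p], of i]
    unfolding x[symmetric] sweedler_points[OF p vector_space_tscale b] by simp
qed auto

lemma linear_on_rb_antipode: "linear_on (smul H) (smul H) (carrier H) (rb_antipode H B)"
proof -
  have b: "bilinear_form (smul H) (\<lambda>x\<^sub>1 x\<^sub>2. antipode H (B x\<^sub>1) * antipode H x\<^sub>2 * B x\<^sub>3)" for x\<^sub>3
    by (simp add: bilinear_simps)
  have "bilinear_form (smul H) (\<lambda>u x\<^sub>3. sweedler H u (\<lambda>x\<^sub>1 x\<^sub>2. antipode H (B x\<^sub>1) * antipode H x\<^sub>2 * B x\<^sub>3))"
    by (intro bilinear_sweedler_left[OF vector_space_smul b]) (simp add: bilinear_simps)
  from linear_on_sweedler[OF vector_space_smul this] show ?thesis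
    by (simp add: rb_antipode_def[abs_def] sweedler3_def)
qed

lemma rb_antipode_add: "x \<in> carrier H \<Longrightarrow> y \<in> carrier H \<Longrightarrow> rb_antipode H B (x + y) = rb_antipode H B x + rb_antipode H B y"
  and rb_antipode_smul: "x \<in> carrier H \<Longrightarrow> rb_antipode H B (smul H c x) = smul H c (rb_antipode H B x)"
  using linear_on_rb_antipode by (simp_all add: linear_on_def)

lemma antipode_B: "x \<in> carrier H \<Longrightarrow> antipode H (B x) \<in> B ` carrier H"
  by (simp flip: B_rb_antipode)

lemma hopf_algebra_image_B: "hopf_algebra (image_hopf H B)"
proof (rule hopf_algebra_image[OF coalgebra_map_B])
  show "1 \<in> B ` carrier H" using B_one by (metis carrier_ops(2) imageI)
  show "antipode H x \<in> B ` carrier H" if "x \<in> B ` carrier H" for x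
    using that by (auto simp flip: B_rb_antipode)
qed (rule B_image_mult)

lemma hopf_algebra_image_T: "hopf_algebra (image_hopf H T)"
proof (rule hopf_algebra_image[OF coalgebra_map_T])
  show "1 \<in> T ` carrier H" using T_one by (metis carrier_ops(2) imageI)
qed (use T_image_mult antipode_T in auto)

end

section \<open>The two actions\<close>

context rota_baxter_points
begin

lemma sweedler_image_B:
  assumes "f \<in> P" "vector_space s" "bilinear_on (smul H) (smul H) s (B ` carrier H) (B ` carrier H) F"
  shows "sweedler (image_hopf H B) (B (f i)) F = cosum s \<delta> i (\<lambda>j k. F (B (f j)) (B (f k)))"
  using sweedler_points_sub[OF B_points[OF assms(1)] subspace_linear_image[OF linear_on_B] _ assms(2,3), of i]
    points_carrier[OF assms(1)]
  by (simp add: image_hopf_def)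

lemma sweedler_image_T:
  assumes "f \<in> P" "vector_space s" "bilinear_on (smul H) (smul H) s (T ` carrier H) (T ` carrier H) F"
  shows "sweedler (image_hopf H T) (T (f i)) F = cosum s \<delta> i (\<lambda>j k. F (T (f j)) (T (f k)))"
  using sweedler_points_sub[OF T_comp_closed[OF assms(1)] subspace_linear_image[OF linear_on_T] _ assms(2,3), of i]
    points_carrier[OF assms(1)]
  by (simp add: image_hopf_def)

end

text \<open>Supplies, one variable at a time, the linearity conditions of nested Sweedler sums over
  the two images, where \<open>M\<close> combines two applications of actions.\<close>

lemma bilinear_on_compose:
  assumes M: "bilinear_on s\<^sub>3 s\<^sub>3 s UNIV UNIV M"
    and \<Phi>: "bilinear_on s\<^sub>1 s\<^sub>2 s\<^sub>3 A E \<Phi>" and \<Psi>: "bilinear_on s\<^sub>1 s\<^sub>2 s\<^sub>3 A E \<Psi>"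
  shows "x \<in> A \<Longrightarrow> y \<in> A \<Longrightarrow> bilinear_on s\<^sub>2 s\<^sub>2 s E E (\<lambda>a b. M (\<Phi> x a) (\<Psi> y b))"
    and "y \<in> A \<Longrightarrow> a \<in> E \<Longrightarrow> b \<in> E \<Longrightarrow> linear_on s\<^sub>1 s A (\<lambda>x. M (\<Phi> x a) (\<Psi> y b))"
    and "x \<in> A \<Longrightarrow> a \<in> E \<Longrightarrow> b \<in> E \<Longrightarrow> linear_on s\<^sub>1 s A (\<lambda>y. M (\<Phi> x a) (\<Psi> y b))"
  using assms by (simp_all add: bilinear_on_def linear_on_def)

text \<open>Covers composites such as \<open>lact (ract x a) c\<close>; the next lemma covers those
  such as \<open>ract c (lact x a)\<close>.\<close>

lemma bilinear_on_iterate: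
  assumes "bilinear_on s\<^sub>1 s\<^sub>2 s\<^sub>1 A E \<Phi>" "bilinear_on s\<^sub>1 s\<^sub>2 s\<^sub>3 A E \<Psi>"
    and "\<And>x a. x \<in> A \<Longrightarrow> a \<in> E \<Longrightarrow> \<Phi> x a \<in> A" "c \<in> E"
  shows "bilinear_on s\<^sub>1 s\<^sub>2 s\<^sub>3 A E (\<lambda>x a. \<Psi> (\<Phi> x a) c)"
  using assms by (simp add: bilinear_on_def linear_on_def)

lemma bilinear_on_iterate':
  assumes "bilinear_on s\<^sub>1 s\<^sub>2 s\<^sub>2 A E \<Phi>" "bilinear_on s\<^sub>1 s\<^sub>2 s\<^sub>3 A E \<Psi>"
    and "\<And>x a. x \<in> A \<Longrightarrow> a \<in> E \<Longrightarrow> \<Phi> x a \<in> E" "c \<in> A"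
  shows "bilinear_on s\<^sub>1 s\<^sub>2 s\<^sub>3 A E (\<lambda>x a. \<Psi> c (\<Phi> x a))"
  using assms by (simp add: bilinear_on_def linear_on_def)

context rota_baxter_points_pair
begin

text \<open>Merges a nested sum over both images into one sum over the product coalgebra.
  \<open>M\<close> is \<open>pure_tensor H\<close> when the actions are shown to be coalgebra maps,
  and multiplication in the two matched pair identities.\<close>

lemma sweedler_image_pair:
  assumes f: "f \<in> P1.P" and g: "g \<in> P2.P" and s: "vector_space s"
    and M: "bilinear_on (smul H) (smul H) s UNIV UNIV M"
    and \<Phi>: "bilinear_on (smul H) (smul H) (smul H) (B ` carrier H) (T ` carrier H) \<Phi>"
    and \<Psi>: "bilinear_on (smul H) (smul H) (smul H) (B ` carrier H) (T ` carrier H) \<Psi>"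
  shows "sweedler (image_hopf H B) (B (f i)) (\<lambda>x\<^sub>1 x\<^sub>2. sweedler (image_hopf H T) (T (g j)) (\<lambda>a\<^sub>1 a\<^sub>2. M (\<Phi> x\<^sub>1 a\<^sub>1) (\<Psi> x\<^sub>2 a\<^sub>2)))
    = cosum s (prod_comul \<delta> \<gamma>) (i, j) (\<lambda>d e. M (\<Phi> (B (f (fst d))) (T (g (snd d)))) (\<Psi> (B (f (fst e))) (T (g (snd e)))))"
proof -
  interpret Hm: hopf_algebra "image_hopf H T" by (rule hopf_algebra_image_T)
  have sel: "smul (image_hopf H T) = smul H" "carrier (image_hopf H T) = T ` carrier H"
    by (simp_all add: image_hopf_def)
  have 1: "bilinear_on (smul H) (smul H) s (T ` carrier H) (T ` carrier H) (\<lambda>a\<^sub>1 a\<^sub>2. M (\<Phi> x\<^sub>1 a\<^sub>1) (\<Psi> x\<^sub>2 a\<^sub>2))"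
    if "x\<^sub>1 \<in> B ` carrier H" "x\<^sub>2 \<in> B ` carrier H" for x\<^sub>1 x\<^sub>2
    by (rule bilinear_on_compose(1)[OF M \<Phi> \<Psi> that])
  have g_image: "T (g j) \<in> T ` carrier H" and f_image: "B (f i) \<in> B ` carrier H" for i
    using points_carrier[OF g] points_carrier[OF f] by auto
  have 2: "bilinear_on (smul H) (smul H) s (B ` carrier H) (B ` carrier H)
     (\<lambda>x\<^sub>1 x\<^sub>2. sweedler (image_hopf H T) (T (g j)) (\<lambda>a\<^sub>1 a\<^sub>2. M (\<Phi> x\<^sub>1 a\<^sub>1) (\<Psi> x\<^sub>2 a\<^sub>2)))"
    unfolding bilinear_on_def
  proof (intro conjI ballI)
    fix y assume y: "y \<in> B ` carrier H"
    show "linear_on (smul H) s (B ` carrier H) (\<lambda>x. sweedler (image_hopf H T) (T (g j)) (\<lambda>a\<^sub>1 a\<^sub>2. M (\<Phi> x a\<^sub>1) (\<Psi> y a\<^sub>2)))"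
      by (rule Hm.linear_on_sweedler_param[OF s vector_space_smul subspace_linear_image[OF linear_on_B], unfolded sel];
          blast intro: g_image 1 y bilinear_on_compose(2)[OF M \<Phi> \<Psi>])
    show "linear_on (smul H) s (B ` carrier H) (\<lambda>x. sweedler (image_hopf H T) (T (g j)) (\<lambda>a\<^sub>1 a\<^sub>2. M (\<Phi> y a\<^sub>1) (\<Psi> x a\<^sub>2)))"
      by (rule Hm.linear_on_sweedler_param[OF s vector_space_smul subspace_linear_image[OF linear_on_B], unfolded sel];
          blast intro: g_image 1 y bilinear_on_compose(3)[OF M \<Phi> \<Psi>])
  qed
  show ?thesis
    unfolding P1.sweedler_image_B[OF f s 2]
    by (simp add: P2.sweedler_image_T[OF g s 1] f_image cosum_prod_comul[OF s[folded module_iff_vector_space]])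
qed

end

text \<open>The actions are any functions with the prescribed values. That such functions exist is
  the well-definedness of the actions, shown in \<open>exists_actions\<close>.\<close>

locale rota_baxter_actions = rota_baxter_hopf H B for H :: "('k::field, 'a::ring_1) hopf" and B +
  fixes lact ract :: "'a \<Rightarrow> 'a \<Rightarrow> 'a"
  assumes lact: "x \<in> carrier H \<Longrightarrow> y \<in> carrier H \<Longrightarrow> lact (B x) (T y) = T (adj (B x) y)"
    and ract: "x \<in> carrier H \<Longrightarrow> y \<in> carrier H \<Longrightarrow>
      ract (B x) (T y) = antipode H (B (coadj (T y) (rb_antipode H B x)))"
begin

lemma bilinear_on_image:
  assumes add: "\<And>x x' y. x \<in> carrier H \<Longrightarrow> x' \<in> carrier H \<Longrightarrow> y \<in> carrier H \<Longrightarrow> act (B (x + x')) (T y) = act (B x) (T y) + act (B x') (T y)"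
      "\<And>x y y'. x \<in> carrier H \<Longrightarrow> y \<in> carrier H \<Longrightarrow> y' \<in> carrier H \<Longrightarrow> act (B x) (T (y + y')) = act (B x) (T y) + act (B x) (T y')"
    and scale: "\<And>x y c. x \<in> carrier H \<Longrightarrow> y \<in> carrier H \<Longrightarrow> act (B (smul H c x)) (T y) = smul H c (act (B x) (T y))"
      "\<And>x y c. x \<in> carrier H \<Longrightarrow> y \<in> carrier H \<Longrightarrow> act (B x) (T (smul H c y)) = smul H c (act (B x) (T y))"
  shows "bilinear_on (smul H) (smul H) (smul H) (B ` carrier H) (T ` carrier H) act"
  using add scale by (simp add: bilinear_on_def linear_on_def)

lemma bilinear_on_lact: "bilinear_on (smul H) (smul H) (smul H) (B ` carrier H) (T ` carrier H) lact"
  by (rule bilinear_on_image; simp only: lact carrier_ops; simp)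

lemma bilinear_on_ract: "bilinear_on (smul H) (smul H) (smul H) (B ` carrier H) (T ` carrier H) ract"
  by (rule bilinear_on_image; simp only: ract carrier_ops; simp add: rb_antipode_add rb_antipode_smul)

lemma lact_image: "x \<in> B ` carrier H \<Longrightarrow> a \<in> T ` carrier H \<Longrightarrow> lact x a \<in> T ` carrier H"
  by (auto simp: lact)

lemma ract_image: "x \<in> B ` carrier H \<Longrightarrow> a \<in> T ` carrier H \<Longrightarrow> ract x a \<in> B ` carrier H"
  by (auto simp: ract antipode_B)

lemma lact_T: "x \<in> B ` carrier H \<Longrightarrow> y \<in> carrier H \<Longrightarrow> lact x (T y) = T (adj x y)"
  by (auto simp: lact)

text \<open>\<open>rb_antipode\<close> is an involution that \<open>B\<close> carries to the
  antipode. As values of \<open>ract\<close> have the form \<open>antipode H (B u)\<close>, this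
  lets successive right actions compose.\<close>

lemma ract_antipode_B:
  assumes "x \<in> carrier H" "a \<in> T ` carrier H"
  shows "ract (antipode H (B x)) a = antipode H (B (coadj a x))"
  using assms ract[of "rb_antipode H B x"] by (auto simp: B_rb_antipode rb_antipode_rb_antipode)

lemma ract_B: "x \<in> carrier H \<Longrightarrow> a \<in> T ` carrier H \<Longrightarrow> ract (B x) a = antipode H (B (coadj a (rb_antipode H B x)))"
  using ract by auto

text \<open>The group parameters are written out because several pairs of coalgebras are in use at
  once in \<open>matched_pair_identities_points\<close>.\<close>

lemma lact_points:
  assumes "rota_baxter_points_pair H B \<delta> \<epsilon> \<gamma> \<eta>" "f \<in> points H \<delta> \<epsilon>" "g \<in> points H \<gamma> \<eta>"
  shows "lact (B (f i)) (T (g j)) = T (rota_baxter_group.lam (conv H (prod_comul \<delta> \<gamma>)) ((\<circ>) (antipode H)) ((\<circ>) B)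
    (pull\<^sub>1 H \<eta> f) (pull\<^sub>2 H \<epsilon> g) (i, j))"
  using rota_baxter_points_pair.lam_points[OF assms, of i j]
    lact[OF points_carrier[OF assms(2)] points_carrier[OF assms(3)], of i j] by simp

lemma ract_points:
  assumes "rota_baxter_points_pair H B \<delta> \<epsilon> \<gamma> \<eta>" "f \<in> points H \<delta> \<epsilon>" "g \<in> points H \<gamma> \<eta>"
  shows "ract (B (f i)) (T (g j)) = B (rota_baxter_group.rho (conv H (prod_comul \<delta> \<gamma>)) ((\<circ>) (antipode H)) ((\<circ>) B)
    (pull\<^sub>1 H \<eta> f) (pull\<^sub>2 H \<epsilon> g) (i, j))"
  using rota_baxter_points_pair.B_rho_points[OF assms, of i j]
    ract[OF points_carrier[OF assms(2)] points_carrier[OF assms(3)], of i j] by simp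

text \<open>The function \<open>h\<close> is the action composed with \<open>f\<close> and
  \<open>g\<close>. That it is a point of the product coalgebra expresses compatibility of the
  action with coproduct and counit.\<close>

lemma comul_action:
  assumes D: "rota_baxter_points_pair H B \<delta> \<epsilon> \<gamma> \<eta>" and f: "f \<in> points H \<delta> \<epsilon>" and g: "g \<in> points H \<gamma> \<eta>"
    and act: "bilinear_on (smul H) (smul H) (smul H) (B ` carrier H) (T ` carrier H) act"
    and h: "h \<in> points H (prod_comul \<delta> \<gamma>) (prod_counit \<epsilon> \<eta>)"
    and eq: "\<And>i j. act (B (f i)) (T (g j)) = h (i, j)"
  shows "comul H (act (B (f i)) (T (g j))) = sweedler (image_hopf H B) (B (f i)) (\<lambda>x\<^sub>1 x\<^sub>2.
      sweedler (image_hopf H T) (T (g j)) (\<lambda>a\<^sub>1 a\<^sub>2. pure_tensor H (act x\<^sub>1 a\<^sub>1) (act x\<^sub>2 a\<^sub>2)))"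
    and "counit H (act (B (f i)) (T (g j))) = counit H (B (f i)) * counit H (T (g j))"
proof -
  interpret rota_baxter_points_pair H B \<delta> \<epsilon> \<gamma> \<eta> by fact
  show "comul H (act (B (f i)) (T (g j))) = sweedler (image_hopf H B) (B (f i)) (\<lambda>x\<^sub>1 x\<^sub>2.
      sweedler (image_hopf H T) (T (g j)) (\<lambda>a\<^sub>1 a\<^sub>2. pure_tensor H (act x\<^sub>1 a\<^sub>1) (act x\<^sub>2 a\<^sub>2)))"
    unfolding sweedler_image_pair[OF f g vector_space_tscale bilinear_tens act act]
    by (simp add: eq comul_points[OF h])
  show "counit H (act (B (f i)) (T (g j))) = counit H (B (f i)) * counit H (T (g j))"
    using counit_points[OF h] counit_points[OF f] counit_points[OF g]
      counit_points[OF P1.B_points[OF f], of i] counit_points[OF P2.T_comp_closed[OF g], of j]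
    by (simp add: eq prod_counit_def)
qed

lemma comul_counit_actions:
  assumes "u \<in> carrier H" "v \<in> carrier H"
  shows "comul H (lact (B u) (T v)) = sweedler (image_hopf H B) (B u) (\<lambda>x\<^sub>1 x\<^sub>2.
      sweedler (image_hopf H T) (T v) (\<lambda>a\<^sub>1 a\<^sub>2. pure_tensor H (lact x\<^sub>1 a\<^sub>1) (lact x\<^sub>2 a\<^sub>2))) \<and>
    counit H (lact (B u) (T v)) = counit H (B u) * counit H (T v) \<and>
    comul H (ract (B u) (T v)) = sweedler (image_hopf H B) (B u) (\<lambda>x\<^sub>1 x\<^sub>2.
      sweedler (image_hopf H T) (T v) (\<lambda>a\<^sub>1 a\<^sub>2. pure_tensor H (ract x\<^sub>1 a\<^sub>1) (ract x\<^sub>2 a\<^sub>2))) \<and>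
    counit H (ract (B u) (T v)) = counit H (B u) * counit H (T v)"
  using assms
proof (rule pair_pointE)
  fix \<delta> \<gamma> :: "'a option \<Rightarrow> ('k \<times> 'a option \<times> 'a option) list" and \<epsilon> \<eta> p q i j
  assume D: "rota_baxter_points_pair H B \<delta> \<epsilon> \<gamma> \<eta>" and p: "p \<in> points H \<delta> \<epsilon>" and u: "u = p i" and q: "q \<in> points H \<gamma> \<eta>" and v: "v = q j"
  interpret rota_baxter_points_pair H B \<delta> \<epsilon> \<gamma> \<eta> by fact
  have l: "T \<circ> P12.G.lam (\<pi>\<^sub>1 p) (\<pi>\<^sub>2 q) \<in> P12.P" and r: "B \<circ> P12.G.rho (\<pi>\<^sub>1 p) (\<pi>\<^sub>2 q) \<in> P12.P"
    using p q by (simp_all add: P12.T_comp_closed)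
  note 1 = comul_action[OF D p q bilinear_on_lact l] and 2 = comul_action[OF D p q bilinear_on_ract r]
  show ?thesis
    unfolding u v
    by (intro conjI 1 2) (simp_all add: lact_points[OF D p q] ract_points[OF D p q])
qed

lemma matched_pair_identities_points:
  assumes "rota_baxter_points H B \<delta> \<epsilon>" "rota_baxter_points H B \<gamma> \<eta>" "rota_baxter_points H B \<kappa> \<theta>"
    and p: "p \<in> points H \<delta> \<epsilon>" and q: "q \<in> points H \<gamma> \<eta>" and r: "r \<in> points H \<kappa> \<theta>"
  shows "lact (B (p i)) (T (q j) * T (r k)) = sweedler (image_hopf H B) (B (p i)) (\<lambda>x\<^sub>1 x\<^sub>2.
      sweedler (image_hopf H T) (T (q j)) (\<lambda>a\<^sub>1 a\<^sub>2. lact x\<^sub>1 a\<^sub>1 * lact (ract x\<^sub>2 a\<^sub>2) (T (r k))))" (is ?thesis1)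
    and "ract (B (p i) * B (q j)) (T (r k)) = sweedler (image_hopf H B) (B (q j)) (\<lambda>x\<^sub>1 x\<^sub>2.
      sweedler (image_hopf H T) (T (r k)) (\<lambda>a\<^sub>1 a\<^sub>2. ract (B (p i)) (lact x\<^sub>1 a\<^sub>1) * ract x\<^sub>2 a\<^sub>2))" (is ?thesis2)
proof -
  interpret D12: rota_baxter_points_pair H B \<delta> \<epsilon> \<gamma> \<eta> by (rule rota_baxter_points_pair) fact+
  interpret D23: rota_baxter_points_pair H B \<gamma> \<eta> \<kappa> \<theta> by (rule rota_baxter_points_pair) fact+
  \<comment> \<open>\<open>L\<close> and \<open>R\<close> carry the two bracketings of the triple
    product of coalgebras; the two sides of each identity live naturally over different
    bracketings.\<close>
  interpret L: rota_baxter_points_pair H B "prod_comul \<delta> \<gamma>" "prod_counit \<epsilon> \<eta>" \<kappa> \<theta>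
    by (rule rota_baxter_points_pair) unfold_locales
  interpret R: rota_baxter_points_pair H B \<delta> \<epsilon> "prod_comul \<gamma> \<kappa>" "prod_counit \<eta> \<theta>"
    by (rule rota_baxter_points_pair) unfold_locales
  \<comment> \<open>The associator relabels basis elements without changing coefficients; the weight
    1 gives it the form required by \<open>points_pullback\<close>.\<close>
  have cosum: "cosum s (prod_comul (prod_comul \<delta> \<gamma>) \<kappa>) x
      (\<lambda>a b. s 1 (s 1 (F (fst (fst a), snd (fst a), snd a) (fst (fst b), snd (fst b), snd b)))) =
      s 1 (cosum s (prod_comul \<delta> (prod_comul \<gamma> \<kappa>)) (fst (fst x), snd (fst x), snd x) F)" if "module s" for s x F
    by (simp add: module.scale_one[OF that] cosum_prod_comul[OF that])
  have reassoc_eq: "reassoc = (\<lambda>f x. smul H 1 (f (fst (fst x), snd (fst x), snd x)))"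
    by (simp add: fun_eq_iff reassoc_def)
  interpret hom: rota_baxter_group_hom R.P12.P "conv H (prod_comul \<delta> (prod_comul \<gamma> \<kappa>))"
    "conv_one H (prod_counit \<epsilon> (prod_counit \<eta> \<theta>))" "(\<circ>) (antipode H)" "(\<circ>) B"
    L.P12.P "conv H (prod_comul (prod_comul \<delta> \<gamma>) \<kappa>)"
    "conv_one H (prod_counit (prod_counit \<epsilon> \<eta>) \<theta>)" "(\<circ>) (antipode H)" "(\<circ>) B"
    reassoc
    unfolding reassoc_eq
    by (rule points_pullback[where w = "\<lambda>_. 1", OF L.P12.rota_baxter_points_axioms R.P12.rota_baxter_points_axioms])
      (simp add: prod_counit_def, rule cosum[OF module_smul], rule cosum[OF module_tscale])
  define x where "x = L.\<pi>\<^sub>1 (D12.\<pi>\<^sub>1 p)"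
  define y where "y = L.\<pi>\<^sub>1 (D12.\<pi>\<^sub>2 q)"
  define z where "z = L.\<pi>\<^sub>2 r"
  have [simp]: "x \<in> L.P12.P" "y \<in> L.P12.P" "z \<in> L.P12.P"
    using p q r by (simp_all add: x_def y_def z_def)
  have re: "reassoc (R.\<pi>\<^sub>1 p) = x" "reassoc (R.\<pi>\<^sub>2 (D23.\<pi>\<^sub>1 q)) = y" "reassoc (R.\<pi>\<^sub>2 (D23.\<pi>\<^sub>2 r)) = z"
    by (auto simp: fun_eq_iff x_def y_def z_def reassoc_def pull\<^sub>1_def pull\<^sub>2_def prod_counit_def mult.commute)
  have hom_at: "f (i, j, k) = reassoc f ((i, j), k)" for f :: "_ \<Rightarrow> 'a"
    by (simp add: reassoc_def)
  have mult: "bilinear_on (smul H) (smul H) (smul H) UNIV UNIV (*)"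
    by (simp add: bilinear_simps)
  have lr: "bilinear_on (smul H) (smul H) (smul H) (B ` carrier H) (T ` carrier H) (\<lambda>x a. lact (ract x a) (T (r k)))"
    by (intro bilinear_on_iterate[OF bilinear_on_ract bilinear_on_lact] ract_image imageI points_carrier[OF r])
  have rl: "bilinear_on (smul H) (smul H) (smul H) (B ` carrier H) (T ` carrier H) (\<lambda>x a. ract (B (p i)) (lact x a))"
    by (intro bilinear_on_iterate'[OF bilinear_on_lact bilinear_on_ract] lact_image imageI points_carrier[OF p])
  have lam12: "D12.P12.G.lam (D12.\<pi>\<^sub>1 p) (D12.\<pi>\<^sub>2 q) \<in> D12.P12.P"
    and rho12: "D12.P12.G.rho (D12.\<pi>\<^sub>1 p) (D12.\<pi>\<^sub>2 q) \<in> D12.P12.P"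
    and desc_mult12: "D12.P12.G.desc_mult (D12.\<pi>\<^sub>1 p) (D12.\<pi>\<^sub>2 q) \<in> D12.P12.P"
    and tilde_mult23: "D23.P12.G.tilde_mult (D23.\<pi>\<^sub>1 q) (D23.\<pi>\<^sub>2 r) \<in> D23.P12.P"
    and lam23: "D23.P12.G.lam (D23.\<pi>\<^sub>1 q) (D23.\<pi>\<^sub>2 r) \<in> D23.P12.P"
    using p q r by simp_all
  note pair = D12.rota_baxter_points_pair_axioms D23.rota_baxter_points_pair_axioms
    L.rota_baxter_points_pair_axioms R.rota_baxter_points_pair_axioms

  have "lact (B (p i)) (T (q j) * T (r k)) = T (R.P12.G.lam (R.\<pi>\<^sub>1 p) (R.\<pi>\<^sub>2 (D23.P12.G.tilde_mult (D23.\<pi>\<^sub>1 q) (D23.\<pi>\<^sub>2 r))) (i, j, k))"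
    by (simp add: D23.T_mult_points[OF q r] lact_points[OF pair(4) p tilde_mult23])
  also have "R.P12.G.lam (R.\<pi>\<^sub>1 p) (R.\<pi>\<^sub>2 (D23.P12.G.tilde_mult (D23.\<pi>\<^sub>1 q) (D23.\<pi>\<^sub>2 r))) (i, j, k) = L.P12.G.lam x (L.P12.G.tilde_mult y z) ((i, j), k)"
    unfolding hom_at using p q r by (simp only: re hom.hom_lam hom.hom_tilde_mult R.pi2.hom_tilde_mult
        R.pi1.hom_closed R.pi2.hom_closed D23.pi1.hom_closed D23.pi2.hom_closed D23.P12.G.closed R.P12.G.closed)
  also have "T \<dots> = (T \<circ> L.P12.G.lam x (L.P12.G.tilde_mult y z)) ((i, j), k)" by simp
  also have "T \<circ> L.P12.G.lam x (L.P12.G.tilde_mult y z) = L.P12.cmul (T \<circ> L.P12.G.lam x y) (T \<circ> L.P12.G.lam (L.P12.G.rho x y) z)"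
    by (simp add: L.P12.G.lam_tilde_mult L.P12.T_points L.P12.G.T_tilde_mult)
  \<comment> \<open>As a pullback from the first two indices, the left factor leaves the third index
    without a coproduct.\<close>
  also have "T \<circ> L.P12.G.lam x y = L.\<pi>\<^sub>1 (T \<circ> D12.P12.G.lam (D12.\<pi>\<^sub>1 p) (D12.\<pi>\<^sub>2 q))"
    using lam12 p q by (simp add: L.P12.T_points D12.P12.T_points x_def y_def)
  also have "L.P12.cmul \<dots> (T \<circ> L.P12.G.lam (L.P12.G.rho x y) z) ((i, j), k) =
    cosum (smul H) (prod_comul \<delta> \<gamma>) (i, j) (\<lambda>d e. T (D12.P12.G.lam (D12.\<pi>\<^sub>1 p) (D12.\<pi>\<^sub>2 q) d) *
      T (L.P12.G.lam (L.\<pi>\<^sub>1 (D12.P12.G.rho (D12.\<pi>\<^sub>1 p) (D12.\<pi>\<^sub>2 q))) z (e, k)))"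
    using p q by (simp add: L.conv_pull1 x_def y_def)
  also have "\<dots> = cosum (smul H) (prod_comul \<delta> \<gamma>) (i, j) (\<lambda>d e. lact (B (p (fst d))) (T (q (snd d))) *
      lact (ract (B (p (fst e))) (T (q (snd e)))) (T (r k)))"
    by (simp add: lact_points[OF pair(1) p q] ract_points[OF pair(1) p q] lact_points[OF pair(3) rho12 r] z_def)
  also have "\<dots> = sweedler (image_hopf H B) (B (p i)) (\<lambda>x\<^sub>1 x\<^sub>2.
      sweedler (image_hopf H T) (T (q j)) (\<lambda>a\<^sub>1 a\<^sub>2. lact x\<^sub>1 a\<^sub>1 * lact (ract x\<^sub>2 a\<^sub>2) (T (r k))))"
    by (rule D12.sweedler_image_pair[OF p q vector_space_smul mult bilinear_on_lact lr, symmetric])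
  finally show ?thesis1 .

  have "ract (B (p i) * B (q j)) (T (r k)) = (B \<circ> L.P12.G.rho (L.\<pi>\<^sub>1 (D12.P12.G.desc_mult (D12.\<pi>\<^sub>1 p) (D12.\<pi>\<^sub>2 q))) z) ((i, j), k)"
    by (simp add: D12.B_mult_points[OF p q] ract_points[OF pair(3) desc_mult12 r] z_def)
  also have "L.P12.G.rho (L.\<pi>\<^sub>1 (D12.P12.G.desc_mult (D12.\<pi>\<^sub>1 p) (D12.\<pi>\<^sub>2 q))) z = L.P12.G.rho (L.P12.G.desc_mult x y) z"
    using p q by (simp add: x_def y_def)
  also have "B \<circ> \<dots> = L.P12.cmul (B \<circ> L.P12.G.rho x (L.P12.G.lam y z)) (B \<circ> L.P12.G.rho y z)"
    by (simp add: L.P12.G.B_rho_desc_mult)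
  \<comment> \<open>Over the bracketing of \<open>R\<close> the right factor is a pullback from the
    last two indices, so the first index is left without a coproduct.\<close>
  also have "\<dots> ((i, j), k) = R.P12.cmul (B \<circ> R.P12.G.rho (R.\<pi>\<^sub>1 p) (R.\<pi>\<^sub>2 (D23.P12.G.lam (D23.\<pi>\<^sub>1 q) (D23.\<pi>\<^sub>2 r))))
      (R.\<pi>\<^sub>2 (B \<circ> D23.P12.G.rho (D23.\<pi>\<^sub>1 q) (D23.\<pi>\<^sub>2 r))) (i, j, k)"
    unfolding hom_at using p q r
    by (simp only: re hom.hom_rho hom.hom_mult hom.hom_B hom.hom_lam R.pi2.hom_lam R.pi2.hom_B R.pi2.hom_rho
        R.pi1.hom_closed R.pi2.hom_closed D23.pi1.hom_closed D23.pi2.hom_closed D23.P12.G.closed R.P12.G.closed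
        D23.P12.G.B_closed R.P12.G.B_closed)
  also have "\<dots> = cosum (smul H) (prod_comul \<gamma> \<kappa>) (j, k) (\<lambda>d e.
      B (R.P12.G.rho (R.\<pi>\<^sub>1 p) (R.\<pi>\<^sub>2 (D23.P12.G.lam (D23.\<pi>\<^sub>1 q) (D23.\<pi>\<^sub>2 r))) (i, d)) *
      B (D23.P12.G.rho (D23.\<pi>\<^sub>1 q) (D23.\<pi>\<^sub>2 r) e))"
    by (simp add: R.conv_pull2_right)
  also have "\<dots> = cosum (smul H) (prod_comul \<gamma> \<kappa>) (j, k) (\<lambda>d e.
      ract (B (p i)) (lact (B (q (fst d))) (T (r (snd d)))) * ract (B (q (fst e))) (T (r (snd e))))"
    by (simp add: lact_points[OF pair(2) q r] ract_points[OF pair(2) q r] ract_points[OF pair(4) p lam23])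
  also have "\<dots> = sweedler (image_hopf H B) (B (q j)) (\<lambda>x\<^sub>1 x\<^sub>2.
      sweedler (image_hopf H T) (T (r k)) (\<lambda>a\<^sub>1 a\<^sub>2. ract (B (p i)) (lact x\<^sub>1 a\<^sub>1) * ract x\<^sub>2 a\<^sub>2))"
    by (rule D23.sweedler_image_pair[OF q r vector_space_smul mult rl bilinear_on_ract, symmetric])
  finally show ?thesis2 .
qed

lemma matched_pair_identities:
  assumes "u \<in> carrier H" "v \<in> carrier H" "w \<in> carrier H"
  shows "lact (B u) (T v * T w) = sweedler (image_hopf H B) (B u) (\<lambda>x\<^sub>1 x\<^sub>2.
      sweedler (image_hopf H T) (T v) (\<lambda>a\<^sub>1 a\<^sub>2. lact x\<^sub>1 a\<^sub>1 * lact (ract x\<^sub>2 a\<^sub>2) (T w)))" (is ?thesis1)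
    and "ract (B u * B v) (T w) = sweedler (image_hopf H B) (B v) (\<lambda>x\<^sub>1 x\<^sub>2.
      sweedler (image_hopf H T) (T w) (\<lambda>a\<^sub>1 a\<^sub>2. ract (B u) (lact x\<^sub>1 a\<^sub>1) * ract x\<^sub>2 a\<^sub>2))" (is ?thesis2)
proof -
  obtain \<delta> :: "'a option \<Rightarrow> ('k \<times> 'a option \<times> 'a option) list" and \<epsilon> p i
    where p: "rota_baxter_points H B \<delta> \<epsilon>" "p \<in> points H \<delta> \<epsilon>" "p i = u"
    by (rule pointE[OF assms(1)])
  obtain \<gamma> :: "'a option \<Rightarrow> ('k \<times> 'a option \<times> 'a option) list" and \<eta> q j
    where q: "rota_baxter_points H B \<gamma> \<eta>" "q \<in> points H \<gamma> \<eta>" "q j = v"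
    by (rule pointE[OF assms(2)])
  obtain \<kappa> :: "'a option \<Rightarrow> ('k \<times> 'a option \<times> 'a option) list" and \<theta> r k
    where r: "rota_baxter_points H B \<kappa> \<theta>" "r \<in> points H \<kappa> \<theta>" "r k = w"
    by (rule pointE[OF assms(3)])
  show ?thesis1 ?thesis2
    using matched_pair_identities_points[OF p(1) q(1) r(1) p(2) q(2) r(2), of i j k] by (simp_all only: p(3) q(3) r(3))
qed

lemma matched_pair_images: "matched_pair (image_hopf H B) (image_hopf H T) lact ract"
proof -
  have sel [simp]: "carrier (image_hopf H g) = g ` carrier H" "smul (image_hopf H g) = smul H"
    "comul (image_hopf H g) = comul H" "counit (image_hopf H g) = counit H" for g
    by (simp_all add: image_hopf_def)
  have one: "1 \<in> B ` carrier H" "1 \<in> T ` carrier H"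
    using B_one T_one carrier_ops(2) by (metis imageI)+
  have B_sub: "x \<in> carrier H" if "x \<in> B ` carrier H" for x using that by auto
  have T_sub: "x \<in> carrier H" if "x \<in> T ` carrier H" for x using that by auto
  have l: "left_module_coalgebra (image_hopf H B) (image_hopf H T) lact"
    unfolding left_module_coalgebra_def sel
  proof (intro conjI ballI lact_image bilinear_on_lact)
    show "lact 1 a = a" if "a \<in> T ` carrier H" for a
      using that one by (auto simp: lact_T adj_one_left)
    show "lact (x * y) a = lact x (lact y a)"
      if "x \<in> B ` carrier H" "y \<in> B ` carrier H" "a \<in> T ` carrier H" for x y a
      using that by (auto simp: lact_T adj_mult B_image_mult B_sub)
  qed (auto simp: comul_counit_actions)
  have r: "right_module_coalgebra (image_hopf H T) (image_hopf H B) ract"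
    unfolding right_module_coalgebra_def sel
  proof (intro conjI ballI ract_image bilinear_on_ract)
    show "ract x 1 = x" if "x \<in> B ` carrier H" for x
      using that one by (auto simp: ract_B coadj_one_left B_rb_antipode)
    show "ract x (a * b) = ract (ract x a) b"
      if "x \<in> B ` carrier H" "a \<in> T ` carrier H" "b \<in> T ` carrier H" for x a b
      using that by (auto simp: ract_B ract_antipode_B coadj_mult T_image_mult T_sub)
  qed (auto simp: comul_counit_actions)
  have u1: "lact x 1 = smul H (counit H x) 1" if "x \<in> B ` carrier H" for x
    using that lact_T[OF that, of 1] by (simp add: adj_one_right B_sub)
  have u2: "ract 1 a = smul H (counit H a) 1" if "a \<in> T ` carrier H" for a
    using that ract_B[of 1 a] by (simp add: coadj_one_right T_sub)
  have m1: "lact x (a * b) = sweedler (image_hopf H B) x (\<lambda>x1 x2.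
      sweedler (image_hopf H T) a (\<lambda>a1 a2. lact x1 a1 * lact (ract x2 a2) b))"
    if x: "x \<in> B ` carrier H" and a: "a \<in> T ` carrier H" and b: "b \<in> T ` carrier H" for x a b
  proof -
    obtain u v w where "u \<in> carrier H" "x = B u" "v \<in> carrier H" "a = T v" "w \<in> carrier H" "b = T w"
      using x a b by auto
    then show ?thesis by (simp add: matched_pair_identities)
  qed
  have m2: "ract (x * y) a = sweedler (image_hopf H B) y (\<lambda>y1 y2.
      sweedler (image_hopf H T) a (\<lambda>a1 a2. ract x (lact y1 a1) * ract y2 a2))"
    if x: "x \<in> B ` carrier H" and y: "y \<in> B ` carrier H" and a: "a \<in> T ` carrier H" for x y a
  proof -
    obtain u v w where "u \<in> carrier H" "x = B u" "v \<in> carrier H" "y = B v" "w \<in> carrier H" "a = T w"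
      using x y a by auto
    then show ?thesis by (simp add: matched_pair_identities)
  qed
  show ?thesis
    unfolding matched_pair_def sel
    by (intro conjI ballI hopf_algebra_image_B hopf_algebra_image_T l r u1 u2 m1 m2)
qed

end

section \<open>Well-definedness of the two actions\<close>

context rota_baxter_hopf
begin

text \<open>As \<open>B\<close> and \<open>T\<close> are coalgebra maps, Sweedler sums over their
  values can be taken over their arguments. This connects the adjoint actions with the formulas of
  the theorem.\<close>

lemma adj_B: "x \<in> carrier H \<Longrightarrow> adj (B x) y = sweedler H x (\<lambda>x\<^sub>1 x\<^sub>2. B x\<^sub>1 * y * antipode H (B x\<^sub>2))"
  and coadj_T: "x \<in> carrier H \<Longrightarrow> coadj (T x) y = sweedler H x (\<lambda>x\<^sub>1 x\<^sub>2. antipode H (T x\<^sub>1) * y * T x\<^sub>2)"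
proof -
  assume "x \<in> carrier H"
  then obtain \<delta> :: "'a option \<Rightarrow> ('k \<times> 'a option \<times> 'a option) list" and \<epsilon> p i
    where D: "rota_baxter_points H B \<delta> \<epsilon>" and p: "p \<in> points H \<delta> \<epsilon>" and x: "p i = x"
    by (rule pointE)
  interpret rota_baxter_points H B \<delta> \<epsilon> by fact
  have b: "bilinear_form (smul H) (\<lambda>x\<^sub>1 x\<^sub>2. B x\<^sub>1 * y * antipode H (B x\<^sub>2))"
    "bilinear_form (smul H) (\<lambda>x\<^sub>1 x\<^sub>2. antipode H (T x\<^sub>1) * y * T x\<^sub>2)"
    by (simp_all add: bilinear_simps)
  show "adj (B x) y = sweedler H x (\<lambda>x\<^sub>1 x\<^sub>2. B x\<^sub>1 * y * antipode H (B x\<^sub>2))"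
    using sweedler_points[OF B_points[OF p] vector_space_smul bilinear_adj, of i y]
    by (simp add: adj_def sweedler_points[OF p vector_space_smul b(1)] flip: x)
  show "coadj (T x) y = sweedler H x (\<lambda>x\<^sub>1 x\<^sub>2. antipode H (T x\<^sub>1) * y * T x\<^sub>2)"
    using sweedler_points[OF T_comp_closed[OF p] vector_space_smul bilinear_coadj, of i y]
    by (simp add: coadj_def sweedler_points[OF p vector_space_smul b(2)] flip: x)
qed

text \<open>The right-hand side is a function of \<open>T y\<close>, so the left action is
  independent of the chosen preimage \<open>y\<close>.\<close>

lemma T_adj:
  assumes "x \<in> carrier H" "y \<in> carrier H"
  shows "T (adj (B x) y) = sweedler H x (\<lambda>x\<^sub>1 x\<^sub>2.
    sweedler H (T (antipode H x\<^sub>1) * T y) (\<lambda>k\<^sub>1 k\<^sub>2. k\<^sub>1 * T (coadj k\<^sub>2 x\<^sub>2)))"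
  using assms
proof (rule pair_pointE)
  fix \<delta> \<gamma> :: "'a option \<Rightarrow> ('k \<times> 'a option \<times> 'a option) list" and \<epsilon> \<eta> p q i j
  assume "rota_baxter_points_pair H B \<delta> \<epsilon> \<gamma> \<eta>" and p: "p \<in> points H \<delta> \<epsilon>" "x = p i" and q: "q \<in> points H \<gamma> \<eta>" "y = q j"
  then interpret rota_baxter_points_pair H B \<delta> \<epsilon> \<gamma> \<eta> by simp
  show ?thesis using T_lam_points[OF p(1) q(1), of i j] by (simp add: lam_points[OF p(1) q(1)] p(2) q(2))
qed

text \<open>The right-hand side is a function of \<open>B x\<close>, so the right action is
  independent of the chosen preimage \<open>x\<close>.\<close>

lemma antipode_B_coadj:
  assumes "x \<in> carrier H" "y \<in> carrier H"
  shows "antipode H (B (coadj (T y) (rb_antipode H B x))) =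
    sweedler H (B x) (\<lambda>h\<^sub>1 h\<^sub>2. sweedler H y (\<lambda>y\<^sub>1 y\<^sub>2.
      antipode H (B (adj h\<^sub>1 (antipode H y\<^sub>1))) * (h\<^sub>2 * B (antipode H y\<^sub>2))))"
  using assms
proof (rule pair_pointE)
  fix \<delta> \<gamma> :: "'a option \<Rightarrow> ('k \<times> 'a option \<times> 'a option) list" and \<epsilon> \<eta> p q i j
  assume "rota_baxter_points_pair H B \<delta> \<epsilon> \<gamma> \<eta>" and p: "p \<in> points H \<delta> \<epsilon>" "x = p i" and q: "q \<in> points H \<gamma> \<eta>" "y = q j"
  then interpret rota_baxter_points_pair H B \<delta> \<epsilon> \<gamma> \<eta> by simp
  show ?thesis using B_rho_points'[OF p(1) q(1), of i j] by (simp add: B_rho_points[OF p(1) q(1)] p(2) q(2))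
qed

lemma exists_actions: "\<exists>lact ract. rota_baxter_actions H B lact ract"
proof -
  \<comment> \<open>Preimages are chosen arbitrarily: \<open>t\<close> is needed for the left
    action, \<open>b\<close> for the right one, and by \<open>T_adj\<close> and
    \<open>antipode_B_coadj\<close> the choice does not affect the values.\<close>
  define b where "b = inv_into (carrier H) B"
  define t where "t = inv_into (carrier H) T"
  have b: "b (B x) \<in> carrier H" "B (b (B x)) = B x" if "x \<in> carrier H" for x
    using that by (auto simp: b_def f_inv_into_f intro: inv_into_into)
  have t: "t (T x) \<in> carrier H" "T (t (T x)) = T x" if "x \<in> carrier H" for x
    using that by (auto simp: t_def f_inv_into_f intro: inv_into_into)
  have "rota_baxter_actions H B (\<lambda>h c. T (adj h (t c))) (\<lambda>h c. antipode H (B (coadj c (rb_antipode H B (b h)))))"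
  proof
    fix x y assume xy: "x \<in> carrier H" "y \<in> carrier H"
    show "T (adj (B x) (t (T y))) = T (adj (B x) y)"
      using xy t[OF xy(2)] by (simp add: T_adj)
    show "antipode H (B (coadj (T y) (rb_antipode H B (b (B x))))) = antipode H (B (coadj (T y) (rb_antipode H B x)))"
      using xy b[OF xy(1)] by (simp add: antipode_B_coadj)
  qed
  then show ?thesis by blast
qed

end

theorem theorem2p10:
  fixes H :: "('k::field_char_0, 'h::ring_1) hopf" and B :: "'h \<Rightarrow> 'h"
  assumes "rota_baxter_hopf_algebra H B"
  shows "\<exists>lact ract.
    (\<forall>x\<in>carrier H. \<forall>y\<in>carrier H.
      lact (B x) (rb_tilde H B y) =
      rb_tilde H B (sweedler H x (\<lambda>x1 x2. B x1 * y * antipode H (B x2)))) \<and>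
    (\<forall>x\<in>carrier H. \<forall>y\<in>carrier H.
      ract (B x) (rb_tilde H B y) =
      antipode H (B (sweedler H y (\<lambda>y1 y2.
        antipode H (rb_tilde H B y1) * rb_antipode H B x * rb_tilde H B y2)))) \<and>
    matched_pair (image_hopf H B) (image_hopf H (rb_tilde H B)) lact ract"
proof -
  interpret rota_baxter_hopf H B by unfold_locales (rule assms)
  obtain lact ract where "rota_baxter_actions H B lact ract" using exists_actions by blast
  then interpret rota_baxter_actions H B lact ract .
  show ?thesis
    by (intro exI[of _ lact] exI[of _ ract] conjI ballI matched_pair_images) (simp_all add: lact ract adj_B coadj_T)
qed

end
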